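(* No $\mathbb{Z}_2$-lattice of rank $6$ is primitively $3$-universal. Therefore, $u^\ast_{\mathbb{Z}_2}(3) = 7$.
   Context: A $\mathbb{Z}_2$-lattice is a finitely generated $\mathbb{Z}_2$-submodule of a quadratic space $(V,B)$ over $\mathbb{Q}_2$, assumed integral ($B(L,L)\subseteq\mathbb{Z}_2$) and nondegenerate. A representation is a $\mathbb{Z}_2$-linear map preserving $B$; it is primitive if its image is a direct summand. A lattice is primitively $n$-universal if it primitively represents every $\mathbb{Z}_2$-lattice of rank $n$; $u^\ast_{\mathbb{Z}_2}(n)$ is the minimal rank of such a lattice. *)

theory Defs
  imports "Jordan_Normal_Form.Determinant"
begin

text \<open>An element of Z_2 is a compatible system of residues x_k mod 2^k,
  with canonical representatives 0 <= x_k < 2^k.\<close>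

definition z2_seq :: "(nat \<Rightarrow> int) \<Rightarrow> bool" where
  "z2_seq f \<longleftrightarrow> (\<forall>k. 0 \<le> f k \<and> f k < 2^k \<and> f (Suc k) mod 2^k = f k)"

typedef z2 = "Collect z2_seq"
  by (rule exI[of _ "\<lambda>k. 0"]) (simp add: z2_seq_def)

setup_lifting type_definition_z2

lemma compat_helper:
  fixes a :: int
  shows "(a mod 2^Suc k) mod 2^k = a mod 2^k"
  by (simp add: mod_mod_cancel le_imp_power_dvd)

lemma z2_seq_op2:
  assumes f: "z2_seq f" and g: "z2_seq g"
    and h: "\<And>a b m. (0::int) < m \<Longrightarrow> (op a b) mod m = (op (a mod m) (b mod m)) mod m"
  shows "z2_seq (\<lambda>k. (op (f k) (g k)) mod 2^k)"
  unfolding z2_seq_def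
proof
  fix k :: nat
  have "((op (f (Suc k)) (g (Suc k))) mod 2^Suc k) mod 2^k = (op (f (Suc k)) (g (Suc k))) mod 2^k"
    by (rule compat_helper)
  also have "\<dots> = (op (f (Suc k) mod 2^k) (g (Suc k) mod 2^k)) mod 2^k"
    by (rule h) simp
  also have "\<dots> = (op (f k) (g k)) mod 2^k" using f g by (simp add: z2_seq_def)
  finally show "0 \<le> (op (f k) (g k)) mod 2^k \<and> (op (f k) (g k)) mod 2^k < 2^k \<and>
      ((op (f (Suc k)) (g (Suc k))) mod 2^Suc k) mod 2^k = (op (f k) (g k)) mod 2^k" by simp
qed

instantiation z2 :: comm_ring_1
begin

lift_definition zero_z2 :: z2 is "\<lambda>k. 0" by (simp add: z2_seq_def)
lift_definition one_z2 :: z2 is "\<lambda>k. 1 mod 2^k"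
  unfolding mem_Collect_eq z2_seq_def
proof
  fix k :: nat
  have "(1 mod 2^Suc k) mod 2^k = (1::int) mod 2^k" by (rule compat_helper)
  moreover have "0 \<le> (1::int) mod 2^k" by simp
  moreover have "(1::int) mod 2^k < 2^k" by simp
  ultimately show "0 \<le> (1::int) mod 2^k \<and> (1::int) mod 2^k < 2^k \<and>
     (1 mod 2^Suc k) mod 2^k = (1::int) mod 2^k" by blast
qed
lift_definition plus_z2 :: "z2 \<Rightarrow> z2 \<Rightarrow> z2" is "\<lambda>f g k. (f k + g k) mod 2^k"
  unfolding mem_Collect_eq by (rule z2_seq_op2[where op="(+)"]) (simp_all add: mod_add_eq)
lift_definition minus_z2 :: "z2 \<Rightarrow> z2 \<Rightarrow> z2" is "\<lambda>f g k. (f k - g k) mod 2^k"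
  unfolding mem_Collect_eq by (rule z2_seq_op2[where op="(-)"]) (simp_all add: mod_diff_eq)
lift_definition times_z2 :: "z2 \<Rightarrow> z2 \<Rightarrow> z2" is "\<lambda>f g k. (f k * g k) mod 2^k"
  unfolding mem_Collect_eq by (rule z2_seq_op2[where op="(*)"]) (simp_all add: mod_mult_eq)
lift_definition uminus_z2 :: "z2 \<Rightarrow> z2" is "\<lambda>f k. (0 - f k) mod 2^k"
unfolding mem_Collect_eq proof -
  fix f assume "z2_seq f"
  thus "z2_seq (\<lambda>k. (0 - f k) mod 2^k)"
    using z2_seq_op2[where op="(-)" and f="\<lambda>k. 0" and g=f] by (simp add: mod_diff_eq z2_seq_def)
qed

instance
proof
  fix a b c :: z2
  show "a + b + c = a + (b + c)"
    by transfer (simp add: mod_add_left_eq mod_add_right_eq add.assoc)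
  show "a + b = b + a" by transfer (simp add: add.commute)
  show "0 + a = a" by transfer (auto simp: mod_pos_pos_trivial z2_seq_def)
  show "- a + a = 0" by transfer (simp add: mod_add_left_eq)
  show "a - b = a + - b" by transfer (simp add: mod_add_right_eq mod_diff_right_eq)
  show "a * b * c = a * (b * c)"
    by transfer (simp add: mod_mult_left_eq mod_mult_right_eq mult.assoc)
  show "a * b = b * a" by transfer (simp add: mult.commute)
  show "1 * a = a"
  proof transfer
    fix f :: "nat \<Rightarrow> int"
    assume f0: "f \<in> Collect z2_seq"
    hence f: "\<forall>k. 0 \<le> f k \<and> f k < 2^k" by (simp add: z2_seq_def)
    show "(\<lambda>k. (1 mod 2^k * f k) mod 2^k) = f"
    proof
      fix k
      show "(1 mod 2^k * f k) mod 2^k = f k"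
      proof -
        have a: "0 \<le> f k" and b: "f k < 2^k" using f by auto
        show ?thesis
        proof (cases "k = 0")
          case True thus ?thesis using a b by simp
        next
          case False
          hence "(1::int) < 2^k" by simp
          hence "(1::int) mod 2^k = 1" by (intro mod_pos_pos_trivial) simp_all
          thus ?thesis using a b by (simp add: mod_pos_pos_trivial)
        qed
      qed
    qed
  qed
  show "(a + b) * c = a * c + b * c"
    by transfer (simp add: mod_mult_left_eq mod_add_eq distrib_right)
  show "(0::z2) \<noteq> 1"
  proof
    assume "(0::z2) = 1"
    hence "Rep_z2 0 1 = Rep_z2 1 1" by simp
    thus False by (simp add: zero_z2.rep_eq one_z2.rep_eq)
  qed
qed

end

text \<open>A nondegenerate integral Z_2-lattice of rank n is given (up to isometry), after
  choosing a Z_2-basis, by its Gram matrix: a symmetric n x n matrix over Z_2 with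
  nonzero determinant.\<close>

definition z2_lattice :: "nat \<Rightarrow> z2 mat \<Rightarrow> bool" where
  "z2_lattice n G \<longleftrightarrow> G \<in> carrier_mat n n \<and> G\<^sup>T = G \<and> det G \<noteq> 0"

text \<open>A representation of the lattice with Gram matrix A (rank m) by the lattice with
  Gram matrix G (rank n) is a Z_2-linear map, i.e. an n x m matrix X over Z_2 (columns =
  images of the basis vectors), preserving the bilinear form: X^T G X = A.
  It is primitive if its image is a direct summand of the lattice, i.e. the columns
  of X extend to a Z_2-basis of Z_2^n: X is the first m columns of some invertible
  n x n matrix over Z_2.\<close>

definition prim_represents :: "z2 mat \<Rightarrow> z2 mat \<Rightarrow> bool" where
  "prim_represents G A \<longleftrightarrow>
     (\<exists>X. X \<in> carrier_mat (dim_row G) (dim_row A) \<and> X\<^sup>T * G * X = A \<and>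
        (\<exists>U. U \<in> carrier_mat (dim_row G) (dim_row G) \<and> invertible_mat U \<and>
             (\<forall>i < dim_row G. \<forall>j < dim_row A. U $$ (i, j) = X $$ (i, j))))"

definition prim_universal :: "nat \<Rightarrow> z2 mat \<Rightarrow> bool" where
  "prim_universal n G \<longleftrightarrow> (\<forall>A. z2_lattice n A \<longrightarrow> prim_represents G A)"

definition u_star_z2 :: "nat \<Rightarrow> nat" where
  "u_star_z2 n = (LEAST r. \<exists>G. z2_lattice r G \<and> prim_universal n G)"

end

theory Submission
  imports Defs
begin

text \<open>
  Write H for the even hyperbolic plane with Gram matrix [[0, 1], [1, 0]] and A for the even
  unimodular anisotropic plane [[2, 1], [1, 2]]. The lattice H + H + H + <1> of rank 7 represents
  every ternary lattice primitively, since T + T^t + c c^t runs through all symmetric matrices.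

  Suppose that a lattice L of rank at most 6 were primitively 3-universal. Everything happens modulo
  a high power of 2. A primitive representation of 2^N <1, 1, 1> gives a primitive sublattice that is
  isotropic modulo 2^N, and elementary divisors give coordinates (x, y) of L in which the form is
  sum 2^(a_i) (x_i y_i' + x_i' y_i) + q(y, y'), with a_1 <= a_2 <= a_3. Each of these forms fails to
  represent some ternary lattice. Congruences modulo 8 leave only three families,
    (i) H + H + [[0, 2^c], [2^c, e]], which misses A + <4^(c+1)>,
    (ii) H + [[0, 1], [1, 1]] + [[0, 2^c], [2^c, 2d]], which misses 2A + <2 * 4^c>,
    (iii) H + [[0, 2], [2, e]] + [[0, 2^c], [2^c, 2d]], which misses 4^c A + <1>,
  with d and e odd, and c > 0 in (ii) and (iii). In each of them a suitable vector of a representation is divisible by 2 up to its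
  x_3 coordinate. Halving it, while doubling the x_3 coordinate of the other vectors, lowers c by
  one, so the proof is a descent on c.
\<close>

section \<open>The 2-adic integers\<close>

text \<open>No fixed precision serves all lattices, because the test lattice depends on c. Choose K
  with 2^K not dividing the determinant: a primitive vector then cannot pair to 0 modulo 2^K with
  the whole lattice, so c < K. The test lattices have entries of order 4^c, and integers modulo 2^N
  with N = 2K + 6 retain enough of them. The descent does not lose primitivity. Doubling x_3 embeds
  the form with p3 = 2p in the form with p3 = p. A vector divisible by 2 outside x_3 becomes
  divisible by 2, and its half has the old x_3, which is odd. In (i) and (ii) the halved vector is
  the generator of the unary part, so the binary part keeps its shape. In (iii) a vector of the
  binary part is halved and the shape of the test lattice is lost after one step. Two weaker sets of
  congruences are therefore carried along, according to whether the binary part vanishes modulo 2 on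
  the plane (x_1, y_1). Ranks 3 to 5 are treated together with rank 6 by padding a basis with zero
  vectors.\<close>

lemma Rep_z2_seq: "z2_seq (Rep_z2 x)"
  using Rep_z2[of x] by simp

lemma Rep_z2_range: "0 \<le> Rep_z2 x k" "Rep_z2 x k < 2 ^ k"
  using Rep_z2_seq[of x] by (auto simp: z2_seq_def)

lemma Rep_z2_add_mod: "Rep_z2 x (k + j) mod 2 ^ k = Rep_z2 x k"
proof (induction j)
  case 0
  show ?case using Rep_z2_range[of x k] by (simp add: mod_pos_pos_trivial)
next
  case (Suc j)
  have "Rep_z2 x (k + Suc j) mod 2 ^ k = (Rep_z2 x (Suc (k + j)) mod 2 ^ (k + j)) mod 2 ^ k"
    by (simp add: mod_mod_cancel le_imp_power_dvd)
  also have "\<dots> = Rep_z2 x (k + j) mod 2 ^ k"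
    using Rep_z2_seq[of x] by (simp add: z2_seq_def)
  finally show ?case using Suc by simp
qed

lemma Rep_z2_of_nat: "Rep_z2 (of_nat m) k = int m mod 2 ^ k"
proof (induction m)
  case 0
  show ?case by (simp add: zero_z2.rep_eq)
next
  case (Suc m)
  then show ?case
    by (simp add: plus_z2.rep_eq one_z2.rep_eq mod_simps add.commute)
qed

lemma Rep_z2_of_int: "Rep_z2 (of_int m) k = m mod 2 ^ k"
proof (cases m rule: int_cases2)
  case (nonneg n)
  then show ?thesis by (simp add: Rep_z2_of_nat)
next
  case (nonpos n)
  then show ?thesis by (simp add: uminus_z2.rep_eq Rep_z2_of_nat mod_simps)
qed

lemma z2_dvd_iff_Rep: "2 ^ k dvd x \<longleftrightarrow> Rep_z2 x k = 0"
proof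
  assume "2 ^ k dvd x"
  then obtain y where "x = 2 ^ k * y" ..
  moreover have "(2::z2) ^ k = of_int (2 ^ k)" by (simp only: of_int_power of_int_numeral)
  ultimately have x: "x = of_int (2 ^ k) * y" by (simp only:)
  have "Rep_z2 (of_int (2 ^ k)) k = 0" by (simp only: Rep_z2_of_int mod_self)
  then show "Rep_z2 x k = 0" unfolding x times_z2.rep_eq by simp
next
  assume 0: "Rep_z2 x k = 0"
  \<comment> \<open>The j-th residue of x / 2^k is the (k + j)-th residue of x without its k
    vanishing low bits.\<close>
  define y where "y j = Rep_z2 x (k + j) div 2 ^ k" for j
  have div: "Rep_z2 x (k + j) = 2 ^ k * y j" for j
    using Rep_z2_add_mod[of x k j] 0 by (auto simp: y_def mod_eq_0_iff_dvd)
  have "z2_seq y"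
    unfolding z2_seq_def
  proof
    fix j
    have 1: "0 \<le> y j" unfolding y_def using Rep_z2_range(1) by (simp add: pos_imp_zdiv_nonneg_iff)
    have "2 ^ k * y j < 2 ^ k * 2 ^ j"
      using Rep_z2_range(2)[of x "k + j"] unfolding div by (simp add: power_add)
    then have 2: "y j < 2 ^ j" by simp
    have "(2 ^ k * y (Suc j)) mod 2 ^ (k + j) = 2 ^ k * y j"
      using Rep_z2_add_mod[of x "k + j" 1] by (simp add: div[symmetric])
    then have "2 ^ k * (y (Suc j) mod 2 ^ j) = 2 ^ k * y j"
      by (simp only: power_add mult_mod_right)
    then have 3: "y (Suc j) mod 2 ^ j = y j" by simp
    from 1 2 3 show "0 \<le> y j \<and> y j < 2 ^ j \<and> y (Suc j) mod 2 ^ j = y j" by blast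
  qed
  then have Rep_y: "Rep_z2 (Abs_z2 y) = y" by (simp add: Abs_z2_inverse)
  have "Rep_z2 x j = Rep_z2 (of_int (2 ^ k) * Abs_z2 y) j" for j
  proof -
    have "Rep_z2 (of_int (2 ^ k) * Abs_z2 y) j = (2 ^ k * y j) mod 2 ^ j"
      by (simp only: times_z2.rep_eq Rep_z2_of_int Rep_y mod_mult_left_eq)
    also have "\<dots> = Rep_z2 x (j + k) mod 2 ^ j" by (simp add: div[symmetric] add.commute)
    also have "\<dots> = Rep_z2 x j" by (rule Rep_z2_add_mod)
    finally show ?thesis ..
  qed
  then have "x = of_int (2 ^ k) * Abs_z2 y" by (simp add: Rep_z2_inject[symmetric] fun_eq_iff)
  then show "2 ^ k dvd x" by (simp only: of_int_power of_int_numeral dvd_triv_left)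
qed

lemma z2_dvd_of_int_iff: "(2::z2) ^ k dvd of_int m \<longleftrightarrow> 2 ^ k dvd m"
  by (simp add: z2_dvd_iff_Rep Rep_z2_of_int mod_eq_0_iff_dvd)

lemma z2_dvd_diff_Rep: "2 ^ k dvd x - of_int (Rep_z2 x k)"
  using Rep_z2_range[of x k]
  by (simp add: z2_dvd_iff_Rep minus_z2.rep_eq Rep_z2_of_int mod_simps)

lemma z2_nonzero_not_dvd:
  assumes "x \<noteq> 0"
  obtains k where "\<not> 2 ^ k dvd (x::z2)"
proof -
  from assms have "Rep_z2 x \<noteq> Rep_z2 0" by (simp add: Rep_z2_inject)
  then obtain k where "Rep_z2 x k \<noteq> 0" by (auto simp: zero_z2.rep_eq fun_eq_iff)
  then show thesis using that by (simp add: z2_dvd_iff_Rep)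
qed

lemma of_int_z2_nonzero: "m \<noteq> 0 \<Longrightarrow> (of_int m :: z2) \<noteq> 0"
proof
  assume "m \<noteq> 0" "(of_int m :: z2) = 0"
  then have "2 ^ k dvd m" for k using z2_dvd_of_int_iff[of k m] by simp
  then have "2 ^ nat \<bar>m\<bar> dvd m" .
  then have "2 ^ nat \<bar>m\<bar> \<le> \<bar>m\<bar>" using \<open>m \<noteq> 0\<close> dvd_imp_le_int[of m "2 ^ nat \<bar>m\<bar>"] by (simp add: power_abs)
  moreover have "int (nat \<bar>m\<bar>) < 2 ^ nat \<bar>m\<bar>" by (rule of_nat_less_two_power)
  ultimately show False by simp
qed

section \<open>Three families of senary forms\<close>

text \<open>The Gram matrix is [[0, P], [P, Q]] with P = diag(p1, p2, p3) and Q symmetric. The first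
  three coordinates belong to the isotropic sublattice, so the i-th plane occupies positions i and i
  + 3.\<close>

fun bf :: "int \<Rightarrow> int \<Rightarrow> int \<Rightarrow> int \<Rightarrow> int \<Rightarrow> int \<Rightarrow> int \<Rightarrow> int \<Rightarrow> int \<Rightarrow>
  int \<times> int \<times> int \<times> int \<times> int \<times> int \<Rightarrow> int \<times> int \<times> int \<times> int \<times> int \<times> int \<Rightarrow> int" where
  "bf p1 p2 p3 q11 q12 q13 q22 q23 q33 (x1, x2, x3, y1, y2, y3) (x1', x2', x3', y1', y2', y3') =
     p1 * (x1 * y1' + x1' * y1) + p2 * (x2 * y2' + x2' * y2) + p3 * (x3 * y3' + x3' * y3) +
     (q11 * (y1 * y1') + q12 * (y1 * y2' + y2 * y1') + q13 * (y1 * y3' + y3 * y1') +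
      q22 * (y2 * y2') + q23 * (y2 * y3' + y3 * y2') + q33 * (y3 * y3'))"

fun even6 :: "int \<times> int \<times> int \<times> int \<times> int \<times> int \<Rightarrow> bool" where
  "even6 (x1, x2, x3, y1, y2, y3) \<longleftrightarrow>
     even x1 \<and> even x2 \<and> even x3 \<and> even y1 \<and> even y2 \<and> even y3"


lemma bf_commute:
  "bf p1 p2 p3 q11 q12 q13 q22 q23 q33 u v = bf p1 p2 p3 q11 q12 q13 q22 q23 q33 v u"
  by (cases u; cases v) (simp add: algebra_simps)

fun comb6 :: "int \<times> int \<times> int \<times> int \<times> int \<times> int \<Rightarrow> int \<Rightarrow>
  int \<times> int \<times> int \<times> int \<times> int \<times> int \<Rightarrow> int \<times> int \<times> int \<times> int \<times> int \<times> int" where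
  "comb6 (x1, x2, x3, y1, y2, y3) t (x1', x2', x3', y1', y2', y3') =
     (x1 + t * x1', x2 + t * x2', x3 + t * x3', y1 + t * y1', y2 + t * y2', y3 + t * y3')"

lemma bf_comb6_left:
  "bf p1 p2 p3 q11 q12 q13 q22 q23 q33 (comb6 u t v) w =
     bf p1 p2 p3 q11 q12 q13 q22 q23 q33 u w + t * bf p1 p2 p3 q11 q12 q13 q22 q23 q33 v w"
  by (cases u; cases v; cases w) (simp add: algebra_simps)

lemma bf_comb6_right:
  "bf p1 p2 p3 q11 q12 q13 q22 q23 q33 w (comb6 u t v) =
     bf p1 p2 p3 q11 q12 q13 q22 q23 q33 w u + t * bf p1 p2 p3 q11 q12 q13 q22 q23 q33 w v"
  by (cases u; cases v; cases w) (simp add: algebra_simps)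

text \<open>Doubling x3 is an isometric embedding of the form with p3 = 2 * p into the form with p3
  = p. It transports the vectors that the descent does not halve.\<close>

lemma bf_rescale:
  "bf p1 p2 (2 * p) q11 q12 q13 q22 q23 q33 (a1, a2, a3, a4, a5, a6) (b1, b2, b3, b4, b5, b6) =
     bf p1 p2 p q11 q12 q13 q22 q23 q33 (a1, a2, 2 * a3, a4, a5, a6) (b1, b2, 2 * b3, b4, b5, b6)"
  by (simp add: algebra_simps)

text \<open>The embedding sends a vector that is even outside x3 to twice (a1, ..., a6); the descent
  continues with that half.\<close>

lemma bf_rescale_half:
  "bf p1 p2 (2 * p) q11 q12 q13 q22 q23 q33 (2 * a1, 2 * a2, a3, 2 * a4, 2 * a5, 2 * a6) (b1, b2, b3, b4, b5, b6) =
     2 * bf p1 p2 p q11 q12 q13 q22 q23 q33 (a1, a2, a3, a4, a5, a6) (b1, b2, 2 * b3, b4, b5, b6)"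
  "bf p1 p2 (2 * p) q11 q12 q13 q22 q23 q33 (b1, b2, b3, b4, b5, b6) (2 * a1, 2 * a2, a3, 2 * a4, 2 * a5, 2 * a6) =
     2 * bf p1 p2 p q11 q12 q13 q22 q23 q33 (b1, b2, 2 * b3, b4, b5, b6) (a1, a2, a3, a4, a5, a6)"
  by (simp_all add: algebra_simps)

lemma bf_rescale_half_half:
  "bf p1 p2 (2 * p) q11 q12 q13 q22 q23 q33 (2 * a1, 2 * a2, a3, 2 * a4, 2 * a5, 2 * a6)
     (2 * b1, 2 * b2, b3, 2 * b4, 2 * b5, 2 * b6) =
     4 * bf p1 p2 p q11 q12 q13 q22 q23 q33 (a1, a2, a3, a4, a5, a6) (b1, b2, b3, b4, b5, b6)"
  by (simp add: algebra_simps)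

lemma dvd_halve: "2 ^ Suc k dvd 2 * x \<Longrightarrow> 2 ^ k dvd (x::int)"
  by simp

lemma dvd_quarter: "4 * d dvd 4 * x \<Longrightarrow> d dvd (x::int)"
  by simp

lemma dvd_of_dvd_diff:
  fixes x :: int
  assumes "d dvd x - y" "k dvd d" "k dvd y"
  shows "k dvd x"
  using dvd_add[OF dvd_trans[OF assms(2,1)] assms(3)] by simp

section \<open>Family (i): A + <4^(c+1)> and an Arf invariant argument\<close>

lemma even_half_mod4: "(2 * S + 4 * T) mod 4 = 2 \<Longrightarrow> odd (S::int)"
  by presburger

lemma half_dvd4_iff: "4 dvd 2 * S + 4 * T \<longleftrightarrow> even (S::int)"
  by presburger

text \<open>Even norm forces an even y3, as \<open>e\<close> is odd. Half the norm modulo 2 is then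
  x1 y1 + x2 y2, a quadratic form over F_2 of Arf invariant 0. In it \<open>a\<close> and
  \<open>b\<close> span an anisotropic plane, so the orthogonal complement is anisotropic as well;
  \<open>v\<close> lies there with value 0.\<close>

lemma family_i_even:
  fixes e p :: int
  assumes "odd e"
    and Qa: "bf 1 1 p 0 0 0 0 0 e (a1, a2, a3, a4, a5, a6) (a1, a2, a3, a4, a5, a6) mod 4 = 2"
    and Qb: "bf 1 1 p 0 0 0 0 0 e (b1, b2, b3, b4, b5, b6) (b1, b2, b3, b4, b5, b6) mod 4 = 2"
    and Bab: "odd (bf 1 1 p 0 0 0 0 0 e (a1, a2, a3, a4, a5, a6) (b1, b2, b3, b4, b5, b6))"
    and Qv: "4 dvd bf 1 1 p 0 0 0 0 0 e (v1, v2, v3, v4, v5, v6) (v1, v2, v3, v4, v5, v6)"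
    and Bva: "even (bf 1 1 p 0 0 0 0 0 e (v1, v2, v3, v4, v5, v6) (a1, a2, a3, a4, a5, a6))"
    and Bvb: "even (bf 1 1 p 0 0 0 0 0 e (v1, v2, v3, v4, v5, v6) (b1, b2, b3, b4, b5, b6))"
  shows "even v1 \<and> even v4 \<and> even v2 \<and> even v5 \<and> even v6"
proof -
  have "even (bf 1 1 p 0 0 0 0 0 e (a1, a2, a3, a4, a5, a6) (a1, a2, a3, a4, a5, a6))"
    using Qa by presburger
  then have "even a6" using \<open>odd e\<close> by simp
  have "even (bf 1 1 p 0 0 0 0 0 e (b1, b2, b3, b4, b5, b6) (b1, b2, b3, b4, b5, b6))"
    using Qb by presburger
  then have "even b6" using \<open>odd e\<close> by simp
  have "even (bf 1 1 p 0 0 0 0 0 e (v1, v2, v3, v4, v5, v6) (v1, v2, v3, v4, v5, v6))"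
    using Qv by presburger
  then have "even v6" using \<open>odd e\<close> by simp
  obtain a b v where ab: "a6 = 2 * a" "b6 = 2 * b" "v6 = 2 * v"
    using \<open>even a6\<close> \<open>even b6\<close> \<open>even v6\<close> by (elim evenE)
  have "bf 1 1 p 0 0 0 0 0 e (a1, a2, a3, a4, a5, a6) (a1, a2, a3, a4, a5, a6)
      = 2 * (a1 * a4 + a2 * a5) + 4 * (p * a3 * a + e * a * a)"
    unfolding ab by (simp add: algebra_simps)
  then have 1: "odd (a1 * a4 + a2 * a5)" using Qa even_half_mod4 by metis
  have "bf 1 1 p 0 0 0 0 0 e (b1, b2, b3, b4, b5, b6) (b1, b2, b3, b4, b5, b6)
      = 2 * (b1 * b4 + b2 * b5) + 4 * (p * b3 * b + e * b * b)"
    unfolding ab by (simp add: algebra_simps)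
  then have 2: "odd (b1 * b4 + b2 * b5)" using Qb even_half_mod4 by metis
  have "bf 1 1 p 0 0 0 0 0 e (v1, v2, v3, v4, v5, v6) (v1, v2, v3, v4, v5, v6)
      = 2 * (v1 * v4 + v2 * v5) + 4 * (p * v3 * v + e * v * v)"
    unfolding ab by (simp add: algebra_simps)
  then have 3: "even (v1 * v4 + v2 * v5)" using Qv half_dvd4_iff by metis
  show ?thesis
    using 1 2 3 Bab Bva Bvb \<open>even v6\<close> \<open>even a6\<close> \<open>even b6\<close>
    unfolding bf.simps even_add even_mult_iff by simp argo
qed

text \<open>Each descent step divides the norm of \<open>v\<close> by 4 and its pairings by 2, which
  dictates the exponents; \<open>a\<close> and \<open>b\<close> keep their norms and their
  pairing.\<close>

lemma not_family_i:
  fixes e :: int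
  assumes "odd e"
    and "bf 1 1 (2 ^ c) 0 0 0 0 0 e a a mod 4 = 2"
    and "bf 1 1 (2 ^ c) 0 0 0 0 0 e b b mod 4 = 2"
    and "odd (bf 1 1 (2 ^ c) 0 0 0 0 0 e a b)"
    and "2 * 4 ^ (c + 1) dvd bf 1 1 (2 ^ c) 0 0 0 0 0 e v v - 4 ^ (c + 1)"
    and "2 ^ (c + 1) dvd bf 1 1 (2 ^ c) 0 0 0 0 0 e v a"
    and "2 ^ (c + 1) dvd bf 1 1 (2 ^ c) 0 0 0 0 0 e v b"
    and "\<not> even6 v"
  shows False
  using assms(2-)
proof (induction c arbitrary: a b v)
  case (0 a b v)
  obtain a1 a2 a3 a4 a5 a6 where a: "a = (a1, a2, a3, a4, a5, a6)" by (cases a) auto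
  obtain b1 b2 b3 b4 b5 b6 where b: "b = (b1, b2, b3, b4, b5, b6)" by (cases b) auto
  obtain v1 v2 v3 v4 v5 v6 where v: "v = (v1, v2, v3, v4, v5, v6)" by (cases v) auto
  have Qv: "8 dvd bf 1 1 1 0 0 0 0 0 e v v - 4" using 0 by simp
  then have "4 dvd bf 1 1 1 0 0 0 0 0 e v v" by presburger
  then have ev: "even v1 \<and> even v4 \<and> even v2 \<and> even v5 \<and> even v6"
    using family_i_even[of e 1 a1 a2 a3 a4 a5 a6 b1 b2 b3 b4 b5 b6 v1 v2 v3 v4 v5 v6] 0 \<open>odd e\<close>
    unfolding a b v by simp
  then have "odd v3" using 0 unfolding v by simp
  obtain w1 w2 w4 w5 w6 where w: "v1 = 2 * w1" "v2 = 2 * w2" "v4 = 2 * w4" "v5 = 2 * w5" "v6 = 2 * w6"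
    using ev by (elim conjE evenE)
  \<comment> \<open>As v3 and e are odd, w6 * (v3 + e * w6) is even, so 8 divides the norm of
    \<open>v\<close>, which should be 4 modulo 8.\<close>
  have "bf 1 1 1 0 0 0 0 0 e v v - 4 = 8 * (w1 * w4 + w2 * w5) + 4 * (v3 * w6 + e * w6 * w6 - 1)"
    unfolding v w by (simp add: algebra_simps)
  with Qv have "8 dvd 4 * (v3 * w6 + e * w6 * w6 - 1)" by (simp add: dvd_add_right_iff)
  then have "even (v3 * w6 + e * w6 * w6 - 1)" by presburger
  then show False using \<open>odd v3\<close> \<open>odd e\<close> by auto
next
  case (Suc c a b v)
  obtain a1 a2 a3 a4 a5 a6 where a: "a = (a1, a2, a3, a4, a5, a6)" by (cases a) auto
  obtain b1 b2 b3 b4 b5 b6 where b: "b = (b1, b2, b3, b4, b5, b6)" by (cases b) auto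
  obtain v1 v2 v3 v4 v5 v6 where v: "v = (v1, v2, v3, v4, v5, v6)" by (cases v) auto
  let ?p = "2 ^ Suc c :: int"
  have "(4::int) dvd 2 * 4 ^ (Suc c + 1)" "(4::int) dvd 4 ^ (Suc c + 1)" by simp_all
  then have "4 dvd bf 1 1 ?p 0 0 0 0 0 e v v"
    using Suc.prems(4) dvd_of_dvd_diff by blast
  moreover have "even (bf 1 1 ?p 0 0 0 0 0 e v a)" "even (bf 1 1 ?p 0 0 0 0 0 e v b)"
    using Suc.prems(5,6) by (auto elim!: dvd_trans[rotated])
  ultimately have ev: "even v1 \<and> even v4 \<and> even v2 \<and> even v5 \<and> even v6"
    using family_i_even[of e ?p a1 a2 a3 a4 a5 a6 b1 b2 b3 b4 b5 b6 v1 v2 v3 v4 v5 v6]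
      Suc.prems(1-3) \<open>odd e\<close> unfolding a b v by blast
  then have "odd v3" using Suc.prems unfolding v by simp
  obtain w1 w2 w4 w5 w6 where w: "v1 = 2 * w1" "v2 = 2 * w2" "v4 = 2 * w4" "v5 = 2 * w5" "v6 = 2 * w6"
    using ev by (elim conjE evenE)
  let ?a = "(a1, a2, 2 * a3, a4, a5, a6)" and ?b = "(b1, b2, 2 * b3, b4, b5, b6)"
    and ?v = "(w1, w2, v3, w4, w5, w6)"
  have Qv: "4 * (2 * 4 ^ (c + 1)) dvd 4 * (bf 1 1 (2 ^ c) 0 0 0 0 0 e ?v ?v - 4 ^ (c + 1))"
    using Suc.prems(4) unfolding v w power_Suc bf_rescale_half_half
    by (simp add: algebra_simps del: bf.simps)
  have Bva: "2 ^ Suc (c + 1) dvd 2 * bf 1 1 (2 ^ c) 0 0 0 0 0 e ?v ?a"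
    and Bvb: "2 ^ Suc (c + 1) dvd 2 * bf 1 1 (2 ^ c) 0 0 0 0 0 e ?v ?b"
    using Suc.prems(5,6) unfolding a b v w power_Suc bf_rescale_half add_Suc .
  have "bf 1 1 (2 ^ c) 0 0 0 0 0 e ?a ?a mod 4 = 2" "bf 1 1 (2 ^ c) 0 0 0 0 0 e ?b ?b mod 4 = 2"
    "odd (bf 1 1 (2 ^ c) 0 0 0 0 0 e ?a ?b)"
    using Suc.prems(1-3) unfolding a b power_Suc bf_rescale .
  then show False
  proof (rule Suc.IH)
    show "2 * 4 ^ (c + 1) dvd bf 1 1 (2 ^ c) 0 0 0 0 0 e ?v ?v - 4 ^ (c + 1)"
      using Qv by (rule dvd_quarter)
    show "2 ^ (c + 1) dvd bf 1 1 (2 ^ c) 0 0 0 0 0 e ?v ?a" using Bva by (rule dvd_halve)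
    show "2 ^ (c + 1) dvd bf 1 1 (2 ^ c) 0 0 0 0 0 e ?v ?b" using Bvb by (rule dvd_halve)
    show "\<not> even6 ?v" using \<open>odd v3\<close> by simp
  qed
qed

section \<open>Family (ii): 2A + <2 * 4^c>\<close>

lemma even_quarter_mod8: "(4 * S + 8 * T) mod 8 = 4 \<Longrightarrow> odd (S::int)"
  by presburger

lemma quarter_dvd8_iff: "8 dvd 4 * S + 8 * T \<longleftrightarrow> even (S::int)"
  by presburger

lemma eighth_dvd16_iff: "16 dvd 8 * S + 16 * T \<longleftrightarrow> even (S::int)"
  by presburger

text \<open>For vectors even in the plane (x1, y1), reading the norm modulo 2 and 4 makes y2 and y3
  even. A quarter of the norm is then t (x2 + t) modulo 2 with t = y2 / 2. Norm 4 modulo 8 makes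
  this odd for \<open>a\<close>, so a5 / 2 is odd and a2 is even, and half the pairing of
  \<open>a\<close> with \<open>b\<close> is congruent to b2.\<close>

lemma family_ii_hyperbolic:
  fixes d p :: int
  assumes "odd d" "even p"
    and h: "even a1" "even a4" "even b1" "even b4"
    and Qa: "bf 1 1 p 0 0 0 1 0 (2 * d) (a1, a2, a3, a4, a5, a6) (a1, a2, a3, a4, a5, a6) mod 8 = 4"
    and Qb: "4 dvd bf 1 1 p 0 0 0 1 0 (2 * d) (b1, b2, b3, b4, b5, b6) (b1, b2, b3, b4, b5, b6)"
    and Bab: "even (bf 1 1 p 0 0 0 1 0 (2 * d) (a1, a2, a3, a4, a5, a6) (b1, b2, b3, b4, b5, b6))"
  shows "4 dvd bf 1 1 p 0 0 0 1 0 (2 * d) (a1, a2, a3, a4, a5, a6) (b1, b2, b3, b4, b5, b6) \<longleftrightarrow> even b2"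
    and "even b5" "even b6"
    and "8 dvd bf 1 1 p 0 0 0 1 0 (2 * d) (b1, b2, b3, b4, b5, b6) (b1, b2, b3, b4, b5, b6) \<longleftrightarrow>
      even (b5 div 2) \<or> even (b2 + b5 div 2)"
proof -
  have "even (bf 1 1 p 0 0 0 1 0 (2 * d) (a1, a2, a3, a4, a5, a6) (a1, a2, a3, a4, a5, a6))"
    using Qa by presburger
  then have "even a5" by simp
  have "even (bf 1 1 p 0 0 0 1 0 (2 * d) (b1, b2, b3, b4, b5, b6) (b1, b2, b3, b4, b5, b6))"
    using Qb by presburger
  then show "even b5" by simp
  obtain g1 g4 k1 k4 y t q where w: "a1 = 2 * g1" "a4 = 2 * g4" "b1 = 2 * k1" "b4 = 2 * k4"
    "a5 = 2 * y" "b5 = 2 * t" "p = 2 * q"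
    using h \<open>even a5\<close> \<open>even b5\<close> \<open>even p\<close> by (elim evenE)
  have "bf 1 1 p 0 0 0 1 0 (2 * d) (a1, a2, a3, a4, a5, a6) (a1, a2, a3, a4, a5, a6)
      = 2 * (d * (a6 * a6)) + 4 * (2 * g1 * g4 + a2 * y + y * y + q * a3 * a6)"
    unfolding w by (simp add: algebra_simps)
  then have "even (d * (a6 * a6))"
    using Qa half_dvd4_iff[of "d * (a6 * a6)" "2 * g1 * g4 + a2 * y + y * y + q * a3 * a6"] by presburger
  have "bf 1 1 p 0 0 0 1 0 (2 * d) (b1, b2, b3, b4, b5, b6) (b1, b2, b3, b4, b5, b6)
      = 2 * (d * (b6 * b6)) + 4 * (2 * k1 * k4 + b2 * t + t * t + q * b3 * b6)"
    unfolding w by (simp add: algebra_simps)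
  then have "even (d * (b6 * b6))" using Qb half_dvd4_iff by metis
  then show "even b6" using \<open>odd d\<close> by simp
  obtain s r where sr: "a6 = 2 * s" "b6 = 2 * r"
    using \<open>even (d * (a6 * a6))\<close> \<open>even b6\<close> \<open>odd d\<close> by (auto elim!: evenE)
  have "bf 1 1 p 0 0 0 1 0 (2 * d) (a1, a2, a3, a4, a5, a6) (a1, a2, a3, a4, a5, a6)
      = 4 * (y * (a2 + y)) + 8 * (g1 * g4 + q * a3 * s + d * s * s)"
    unfolding w sr by (simp add: algebra_simps)
  then have "odd (y * (a2 + y))" using Qa even_quarter_mod8 by metis
  then have ya: "odd y" "even a2" by auto
  have "bf 1 1 p 0 0 0 1 0 (2 * d) (b1, b2, b3, b4, b5, b6) (b1, b2, b3, b4, b5, b6)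
      = 4 * (t * (b2 + t)) + 8 * (k1 * k4 + q * b3 * r + d * r * r)"
    unfolding w sr by (simp add: algebra_simps)
  then have "8 dvd bf 1 1 p 0 0 0 1 0 (2 * d) (b1, b2, b3, b4, b5, b6) (b1, b2, b3, b4, b5, b6) \<longleftrightarrow>
      even (t * (b2 + t))" by (simp only: quarter_dvd8_iff)
  then show "8 dvd bf 1 1 p 0 0 0 1 0 (2 * d) (b1, b2, b3, b4, b5, b6) (b1, b2, b3, b4, b5, b6) \<longleftrightarrow>
      even (b5 div 2) \<or> even (b2 + b5 div 2)" unfolding w by (simp del: bf.simps)
  show "4 dvd bf 1 1 p 0 0 0 1 0 (2 * d) (a1, a2, a3, a4, a5, a6) (b1, b2, b3, b4, b5, b6) \<longleftrightarrow> even b2"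
  proof -
    have "bf 1 1 p 0 0 0 1 0 (2 * d) (a1, a2, a3, a4, a5, a6) (b1, b2, b3, b4, b5, b6)
        = 2 * (a2 * t + b2 * y) + 4 * (g1 * k4 + k1 * g4 + q * (a3 * r + b3 * s) + y * t + 2 * d * s * r)"
      unfolding w sr by (simp add: algebra_simps)
    then show ?thesis using ya by (simp only: half_dvd4_iff) simp
  qed
qed

lemma bf_add:
  "bf p1 p2 p3 q11 q12 q13 q22 q23 q33 (comb6 u 1 v) (comb6 u 1 v) =
     bf p1 p2 p3 q11 q12 q13 q22 q23 q33 u u + 2 * bf p1 p2 p3 q11 q12 q13 q22 q23 q33 u v +
     bf p1 p2 p3 q11 q12 q13 q22 q23 q33 v v"
  by (simp add: bf_comb6_left bf_comb6_right bf_commute[of _ _ _ _ _ _ _ _ _ v u])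

text \<open>For even y2, half the norm is x1 y1 + d y3 y3 modulo 2, and \<open>d\<close> is
  odd.\<close>

lemma family_ii_half_planes:
  fixes d p :: int
  assumes "odd d" "even p"
    and Q: "4 dvd bf 1 1 p 0 0 0 1 0 (2 * d) (a1, a2, a3, a4, a5, a6) (a1, a2, a3, a4, a5, a6)"
  shows "even a5" "even (a1 * a4 + a6)"
proof -
  have "even (bf 1 1 p 0 0 0 1 0 (2 * d) (a1, a2, a3, a4, a5, a6) (a1, a2, a3, a4, a5, a6))"
    using Q by presburger
  then show "even a5" by simp
  then obtain y q where w: "a5 = 2 * y" "p = 2 * q" using \<open>even p\<close> by (elim evenE)
  have "bf 1 1 p 0 0 0 1 0 (2 * d) (a1, a2, a3, a4, a5, a6) (a1, a2, a3, a4, a5, a6)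
      = 2 * (a1 * a4 + d * (a6 * a6)) + 4 * (a2 * y + y * y + q * a3 * a6)"
    unfolding w by (simp add: algebra_simps)
  then have "even (a1 * a4 + d * (a6 * a6))" using Q half_dvd4_iff by metis
  then show "even (a1 * a4 + a6)" using \<open>odd d\<close> by simp
qed

text \<open>When \<open>a\<close> vanishes modulo 2 in the plane (x1, y1), \<open>b\<close> cannot,
  and \<open>v\<close> pairs evenly with \<open>b\<close> in that plane. Orthogonal vectors of a
  symplectic plane over F_2 are dependent, so a \<open>v\<close> nonzero there would agree with
  \<open>b\<close>. Then \<open>b + v\<close> would vanish in the plane and keep the norm and the
  pairing that are impossible for such a vector.\<close>

lemma family_ii_even_aux:
  fixes d p :: int
  assumes "odd d" "even p"
    and Qa: "bf 1 1 p 0 0 0 1 0 (2 * d) a a mod 8 = 4"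
    and Qb: "bf 1 1 p 0 0 0 1 0 (2 * d) b b mod 8 = 4"
    and Bab: "bf 1 1 p 0 0 0 1 0 (2 * d) a b mod 4 = 2"
    and Qv: "8 dvd bf 1 1 p 0 0 0 1 0 (2 * d) v v"
    and Bva: "4 dvd bf 1 1 p 0 0 0 1 0 (2 * d) v a"
    and Bvb: "4 dvd bf 1 1 p 0 0 0 1 0 (2 * d) v b"
    and a: "a = (a1, a2, a3, a4, a5, a6)" "even a1" "even a4"
    and v: "v = (v1, v2, v3, v4, v5, v6)"
  shows "even v1 \<and> even v4 \<and> even v2 \<and> 4 dvd v5 \<and> even v6"
proof -
  let ?B = "bf 1 1 p 0 0 0 1 0 (2 * d)"
  obtain b1 b2 b3 b4 b5 b6 where b: "b = (b1, b2, b3, b4, b5, b6)" by (cases b) auto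
  have Q4: "4 dvd ?B a a" "4 dvd ?B b b" "4 dvd ?B v v" using Qa Qb Qv by presburger+
  \<comment> \<open>Pairing 2 modulo 4 with \<open>a\<close> needs an odd t2, whereas norm 4 modulo
    8 needs an even one.\<close>
  have orth: False
    if t: "t = (t1, t2, t3, t4, t5, t6)" "even t1" "even t4" "?B t t mod 8 = 4" "?B a t mod 4 = 2"
    for t t1 t2 t3 t4 t5 t6
  proof -
    have 1: "4 dvd ?B t t" "even (?B a t)" using t by presburger+
    note H = family_ii_hyperbolic[OF \<open>odd d\<close> \<open>even p\<close> a(2,3) t(2,3) Qa[unfolded a(1)] 1[unfolded a(1) t(1)]]
    have "odd t2" using H(1) t(4,5) unfolding a(1) t(1) by presburger
    moreover have "even t2" using H(4) t(4) unfolding a(1) t(1) by presburger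
    ultimately show False by simp
  qed
  have hb: "\<not> (even b1 \<and> even b4)" using orth[OF b _ _ Qb Bab] by blast
  have "even (?B v b)" using Bvb by presburger
  then have vb: "even (v1 * b4 + b1 * v4)"
    using family_ii_half_planes(1)[OF assms(1,2) Q4(2)[unfolded b]]
      family_ii_half_planes(1)[OF assms(1,2) Q4(3)[unfolded v]] \<open>even p\<close>
    unfolding v b by simp
  have hv: "even v1 \<and> even v4"
  proof (rule ccontr)
    assume "\<not> ?thesis"
    then have 1: "even (b1 + 1 * v1)" "even (b4 + 1 * v4)" using hb vb by auto
    have 2: "?B (comb6 b 1 v) (comb6 b 1 v) mod 8 = 4"
      using Qb Bvb Qv unfolding bf_add bf_commute[of _ _ _ _ _ _ _ _ _ b v] by presburger
    have 3: "?B a (comb6 b 1 v) mod 4 = 2"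
      using Bab Bva unfolding bf_comb6_right bf_commute[of _ _ _ _ _ _ _ _ _ a v] by presburger
    show False by (rule orth[OF _ 1 2 3]) (simp add: b v)
  qed
  have "even (?B a v)" using Bva bf_commute[of 1 1 p 0 0 0 1 0 "2 * d" a v] by presburger
  note H = family_ii_hyperbolic[OF \<open>odd d\<close> \<open>even p\<close> a(2,3) conjunct1[OF hv] conjunct2[OF hv]
      Qa[unfolded a(1)] Q4(3)[unfolded v] this[unfolded a(1) v]]
  have "4 dvd ?B a v" using Bva bf_commute[of 1 1 p 0 0 0 1 0 "2 * d" a v] by presburger
  then have "even v2" using H(1) unfolding a(1) v by blast
  moreover have "even (v5 div 2)" using H(4) Qv \<open>even v2\<close> unfolding v by auto
  ultimately show ?thesis using hv H(2,3) by presburger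
qed

text \<open>The vectors \<open>a\<close>, \<open>b\<close> and \<open>a + b\<close> are
  interchangeable: all have norm 4 modulo 8 and mutual pairings 2 modulo 4. Their images in the
  plane (x1, y1) over F_2 are dependent, so one of the three vanishes there.\<close>

lemma family_ii_even:
  fixes d p :: int
  assumes "odd d" "even p"
    and Qa: "bf 1 1 p 0 0 0 1 0 (2 * d) a a mod 8 = 4"
    and Qb: "bf 1 1 p 0 0 0 1 0 (2 * d) b b mod 8 = 4"
    and Bab: "bf 1 1 p 0 0 0 1 0 (2 * d) a b mod 4 = 2"
    and Qv: "8 dvd bf 1 1 p 0 0 0 1 0 (2 * d) v v"
    and Bva: "4 dvd bf 1 1 p 0 0 0 1 0 (2 * d) v a"
    and Bvb: "4 dvd bf 1 1 p 0 0 0 1 0 (2 * d) v b"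
    and v: "v = (v1, v2, v3, v4, v5, v6)"
  shows "even v1 \<and> even v4 \<and> even v2 \<and> 4 dvd v5 \<and> even v6"
proof -
  let ?B = "bf 1 1 p 0 0 0 1 0 (2 * d)"
  obtain a1 a2 a3 a4 a5 a6 where a: "a = (a1, a2, a3, a4, a5, a6)" by (cases a) auto
  obtain b1 b2 b3 b4 b5 b6 where b: "b = (b1, b2, b3, b4, b5, b6)" by (cases b) auto
  have Q4: "4 dvd ?B a a" "4 dvd ?B b b" using Qa Qb by presburger+
  have Bba: "?B b a mod 4 = 2" using Bab bf_commute[of 1 1 p 0 0 0 1 0 "2 * d" a b] by simp
  have "even (?B a b)" using Bab by presburger
  then have "even (a1 * b4 + b1 * a4)"
    using family_ii_half_planes(1)[OF assms(1,2) Q4(1)[unfolded a]]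
      family_ii_half_planes(1)[OF assms(1,2) Q4(2)[unfolded b]] \<open>even p\<close>
    unfolding a b by simp
  then consider "even a1" "even a4" | "even b1" "even b4" | "even (a1 + 1 * b1)" "even (a4 + 1 * b4)"
    by fastforce
  then show ?thesis
  proof cases
    case 1
    then show ?thesis using family_ii_even_aux[OF assms(1,2) Qa Qb Bab Qv Bva Bvb a _ _ v] by blast
  next
    case 2
    then show ?thesis using family_ii_even_aux[OF assms(1,2) Qb Qa Bba Qv Bvb Bva b _ _ v] by blast
  next
    case 3
    let ?s = "comb6 a 1 b"
    have "?B ?s ?s mod 8 = 4" using Qa Qb Bab unfolding bf_add by presburger
    moreover have "?B ?s b mod 4 = 2" using Bab Qb unfolding bf_comb6_left by presburger
    moreover have "4 dvd ?B v ?s" using Bva Bvb unfolding bf_comb6_right by presburger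
    moreover have "?s = (a1 + 1 * b1, a2 + 1 * b2, a3 + 1 * b3, a4 + 1 * b4, a5 + 1 * b5, a6 + 1 * b6)"
      unfolding a b by simp
    ultimately show ?thesis using family_ii_even_aux[OF assms(1,2) _ Qb _ Qv _ Bvb _ 3 v] by blast
  qed
qed

lemma not_family_ii:
  fixes d :: int
  assumes "odd d"
    and "bf 1 1 (2 ^ Suc c) 0 0 0 1 0 (2 * d) a a mod 8 = 4"
    and "bf 1 1 (2 ^ Suc c) 0 0 0 1 0 (2 * d) b b mod 8 = 4"
    and "bf 1 1 (2 ^ Suc c) 0 0 0 1 0 (2 * d) a b mod 4 = 2"
    and "4 ^ (c + 2) dvd bf 1 1 (2 ^ Suc c) 0 0 0 1 0 (2 * d) v v - 2 * 4 ^ (c + 1)"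
    and "2 ^ (c + 2) dvd bf 1 1 (2 ^ Suc c) 0 0 0 1 0 (2 * d) v a"
    and "2 ^ (c + 2) dvd bf 1 1 (2 ^ Suc c) 0 0 0 1 0 (2 * d) v b"
    and "\<not> even6 v"
  shows False
  using assms(2-)
proof (induction c arbitrary: a b v)
  case (0 a b v)
  let ?B = "bf 1 1 2 0 0 0 1 0 (2 * d)"
  obtain a1 a2 a3 a4 a5 a6 where a: "a = (a1, a2, a3, a4, a5, a6)" by (cases a) auto
  obtain b1 b2 b3 b4 b5 b6 where b: "b = (b1, b2, b3, b4, b5, b6)" by (cases b) auto
  obtain v1 v2 v3 v4 v5 v6 where v: "v = (v1, v2, v3, v4, v5, v6)" by (cases v) auto
  have Qv: "16 dvd ?B v v - 8" and Bva: "4 dvd ?B v a" and Bvb: "4 dvd ?B v b"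
    and Qa: "?B a a mod 8 = 4" and Qb: "?B b b mod 8 = 4" and Bab: "?B a b mod 4 = 2"
    using 0 by simp_all
  have "8 dvd ?B v v" using Qv by presburger
  then have ev: "even v1 \<and> even v4 \<and> even v2 \<and> 4 dvd v5 \<and> even v6"
    using family_ii_even[OF \<open>odd d\<close> _ Qa Qb Bab _ Bva Bvb v] by simp
  then have "odd v3" using 0(7) unfolding v by auto
  obtain w1 w2 w4 w5 w6 where w: "v1 = 2 * w1" "v2 = 2 * w2" "v4 = 2 * w4" "v5 = 4 * w5" "v6 = 2 * w6"
    using ev by (elim conjE evenE dvdE)
  have "?B v v - 8 = 8 * (w1 * w4 + v3 * w6 + d * w6 * w6 - 1) + 16 * (w2 * w5 + w5 * w5)"
    unfolding v w by (simp add: algebra_simps)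
  with Qv have "even (w1 * w4 + v3 * w6 + d * w6 * w6 - 1)" by presburger
  \<comment> \<open>The term w6 * (v3 + d * w6) is even, so w1 * w4 is odd.\<close>
  then have w14: "odd w1" "odd w4" using \<open>odd v3\<close> \<open>odd d\<close> by auto
  \<comment> \<open>Here t5 is even and t6 is congruent to t1 * t4, so orthogonality to
    \<open>v\<close> says that t1 + t4 + t1 * t4 is even, which happens only for even t1 and t4. For
    both \<open>a\<close> and \<open>b\<close> this is excluded by
    \<open>family_ii_hyperbolic\<close>.\<close>
  have planes: "even t1 \<and> even t4"
    if "?B t t mod 8 = 4" "4 dvd ?B v t" "t = (t1, t2, t3, t4, t5, t6)" for t t1 t2 t3 t4 t5 t6
  proof -
    have "4 dvd ?B (t1, t2, t3, t4, t5, t6) (t1, t2, t3, t4, t5, t6)"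
      using that by (simp del: bf.simps) presburger
    note H = family_ii_half_planes[OF \<open>odd d\<close> _ this]
    have "?B v t = 2 * (w1 * t4 + w4 * t1 + v3 * t6 + w2 * t5) +
      4 * (w5 * t2 + w5 * t5 + w6 * t3 + d * w6 * t6)"
      unfolding v w that(3) by (simp add: algebra_simps)
    then have "even (w1 * t4 + w4 * t1 + v3 * t6 + w2 * t5)" using that(2) half_dvd4_iff by metis
    then show ?thesis using H w14 \<open>odd v3\<close> by auto
  qed
  have "even a1 \<and> even a4" "even b1 \<and> even b4"
    using planes Qa Qb Bva Bvb a b by blast+
  moreover have "4 dvd ?B b b" "8 dvd ?B b b \<longleftrightarrow> False" "even (?B a b)" "4 dvd ?B a b \<longleftrightarrow> False"
    using Qb Bab by presburger+
  ultimately show False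
    using family_ii_hyperbolic[of d 2 a1 a4 b1 b4 a2 a3 a5 a6 b2 b3 b5 b6] Qa \<open>odd d\<close>
    unfolding a b by (auto simp del: bf.simps)
next
  case (Suc c a b v)
  let ?p = "2 ^ Suc (Suc c) :: int"
  obtain a1 a2 a3 a4 a5 a6 where a: "a = (a1, a2, a3, a4, a5, a6)" by (cases a) auto
  obtain b1 b2 b3 b4 b5 b6 where b: "b = (b1, b2, b3, b4, b5, b6)" by (cases b) auto
  obtain v1 v2 v3 v4 v5 v6 where v: "v = (v1, v2, v3, v4, v5, v6)" by (cases v) auto
  have "(8::int) dvd 4 ^ (Suc c + 2)" "(8::int) dvd 2 * 4 ^ (Suc c + 1)"
    using dvd_mult2[of 8 64 "4 ^ c"] dvd_mult2[of 8 32 "4 ^ c"] by simp_all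
  then have "8 dvd bf 1 1 ?p 0 0 0 1 0 (2 * d) v v" using Suc.prems(4) dvd_of_dvd_diff by blast
  moreover have "(4::int) dvd 2 ^ (Suc c + 2)" by simp
  then have "4 dvd bf 1 1 ?p 0 0 0 1 0 (2 * d) v a" "4 dvd bf 1 1 ?p 0 0 0 1 0 (2 * d) v b"
    using Suc.prems(5,6) dvd_trans by blast+
  ultimately have ev: "even v1 \<and> even v4 \<and> even v2 \<and> 4 dvd v5 \<and> even v6"
    using family_ii_even[OF \<open>odd d\<close> _ Suc.prems(1-3) _ _ _ v] by simp
  then have "odd v3" using Suc.prems(7) unfolding v by auto
  obtain w1 w2 w4 w5 w6 where w: "v1 = 2 * w1" "v2 = 2 * w2" "v4 = 2 * w4" "v5 = 2 * w5" "v6 = 2 * w6"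
    using ev by (auto elim!: evenE)
  let ?a = "(a1, a2, 2 * a3, a4, a5, a6)" and ?b = "(b1, b2, 2 * b3, b4, b5, b6)"
    and ?v = "(w1, w2, v3, w4, w5, w6)"
  have Qv: "4 * 4 ^ (c + 2) dvd 4 * (bf 1 1 (2 ^ Suc c) 0 0 0 1 0 (2 * d) ?v ?v - 2 * 4 ^ (c + 1))"
    using Suc.prems(4) unfolding v w power_Suc[of _ "Suc c"] bf_rescale_half_half
    by (simp add: algebra_simps del: bf.simps)
  have Bva: "2 ^ Suc (c + 2) dvd 2 * bf 1 1 (2 ^ Suc c) 0 0 0 1 0 (2 * d) ?v ?a"
    and Bvb: "2 ^ Suc (c + 2) dvd 2 * bf 1 1 (2 ^ Suc c) 0 0 0 1 0 (2 * d) ?v ?b"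
    using Suc.prems(5,6) unfolding a b v w power_Suc[of _ "Suc c"] bf_rescale_half add_Suc .
  have "bf 1 1 (2 ^ Suc c) 0 0 0 1 0 (2 * d) ?a ?a mod 8 = 4"
    "bf 1 1 (2 ^ Suc c) 0 0 0 1 0 (2 * d) ?b ?b mod 8 = 4"
    "bf 1 1 (2 ^ Suc c) 0 0 0 1 0 (2 * d) ?a ?b mod 4 = 2"
    using Suc.prems(1-3) unfolding a b power_Suc[of _ "Suc c"] bf_rescale .
  then show False
  proof (rule Suc.IH)
    show "4 ^ (c + 2) dvd bf 1 1 (2 ^ Suc c) 0 0 0 1 0 (2 * d) ?v ?v - 2 * 4 ^ (c + 1)"
      using Qv by (rule dvd_quarter)
    show "2 ^ (c + 2) dvd bf 1 1 (2 ^ Suc c) 0 0 0 1 0 (2 * d) ?v ?a" using Bva by (rule dvd_halve)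
    show "2 ^ (c + 2) dvd bf 1 1 (2 ^ Suc c) 0 0 0 1 0 (2 * d) ?v ?b" using Bvb by (rule dvd_halve)
    show "\<not> even6 ?v" using \<open>odd v3\<close> by simp
  qed
qed

section \<open>Family (iii): 4^c A + <1> and two descents\<close>

text \<open>The norm is read modulo 2, 4 and 8 in turn. The deciding terms are e m5^2, then 2 d
  m6^2, then e m5^2 again, now with m5 = 2 y.\<close>

lemma family_iii_even:
  fixes d e p :: int
  assumes "odd d" "odd e" "even p" "even m1" "even m4"
    and Q: "8 dvd bf 1 2 p 0 0 0 e 0 (2 * d) (m1, m2, m3, m4, m5, m6) (m1, m2, m3, m4, m5, m6)"
  shows "4 dvd m5 \<and> even m6"
proof -
  have "even (bf 1 2 p 0 0 0 e 0 (2 * d) (m1, m2, m3, m4, m5, m6) (m1, m2, m3, m4, m5, m6))"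
    and Q4: "4 dvd bf 1 2 p 0 0 0 e 0 (2 * d) (m1, m2, m3, m4, m5, m6) (m1, m2, m3, m4, m5, m6)"
    using Q by presburger+
  then have "even m5" using \<open>odd e\<close> by simp
  then obtain g1 g4 y q where w: "m1 = 2 * g1" "m4 = 2 * g4" "m5 = 2 * y" "p = 2 * q"
    using assms(3-5) by (elim evenE)
  have "bf 1 2 p 0 0 0 e 0 (2 * d) (m1, m2, m3, m4, m5, m6) (m1, m2, m3, m4, m5, m6)
      = 2 * (d * (m6 * m6)) + 4 * (2 * g1 * g4 + 2 * m2 * y + q * m3 * m6 + e * y * y)"
    unfolding w by (simp add: algebra_simps)
  then have "even (d * (m6 * m6))" using Q4 half_dvd4_iff by metis
  then have "even m6" using \<open>odd d\<close> by simp
  then obtain s where s: "m6 = 2 * s" by (elim evenE)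
  have "bf 1 2 p 0 0 0 e 0 (2 * d) (m1, m2, m3, m4, m5, m6) (m1, m2, m3, m4, m5, m6)
      = 4 * (e * (y * y)) + 8 * (g1 * g4 + m2 * y + q * m3 * s + d * s * s)"
    unfolding w s by (simp add: algebra_simps)
  then have "even (e * (y * y))" using Q quarter_dvd8_iff by metis
  then have "even y" using \<open>odd e\<close> by simp
  then show ?thesis using \<open>even m6\<close> w(3) by auto
qed

lemma dvd8_pow4: "(8::int) dvd 4 ^ (c + 2)" "(8::int) dvd 2 * 4 ^ (c + 1)"
  using dvd_mult2[of 8 16 "4 ^ c"] dvd_mult2[of 8 8 "4 ^ c"] by simp_all

text \<open>The halved vector m need not have even coordinates m1 and m4 any more; adding l times v, with
  l = 0 or l = 1, restores this.\<close>

lemma not_family_iii_chain1: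
  fixes d e :: int
  defines "B c \<equiv> bf 1 2 (2 ^ Suc c) 0 0 0 e 0 (2 * d)"
  assumes "odd d" "odd e"
    and "u = (u1, u2, u3, u4, u5, u6)" "odd u5"
    and "m = (m1, m2, m3, m4, m5, m6)" "even m1" "even m4" "odd m3"
    and "v = (v1, v2, v3, v4, v5, v6)" "\<not> (even v1 \<and> even v4)"
    and "4 ^ (c + 2) dvd B c m m - 2 * 4 ^ (c + 1)"
    and "2 * 4 ^ (c + 1) dvd B c v v"
    and "4 ^ (c + 1) dvd B c m v"
    and "2 ^ (c + 2) dvd B c u m"
    and "2 ^ (c + 2) dvd B c u v"
  shows False
  using assms(4-)
proof (induction c arbitrary: u u1 u2 u3 u4 u5 u6 m m1 m2 m3 m4 m5 m6 v v1 v2 v3 v4 v5 v6)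
  case 0
  note u = 0(1) and m = 0(3) and v = 0(7)
  have Qm: "16 dvd B 0 m m - 8" and Qv: "8 dvd B 0 v v" and Bmv: "4 dvd B 0 m v"
    using 0 by simp_all
  have "8 dvd B 0 m m" "even (B 0 v v)" using Qm Qv by presburger+
  then have ev: "4 dvd m5 \<and> even m6" and "even v5"
    using family_iii_even[OF \<open>odd d\<close> \<open>odd e\<close> _ 0(4,5), of "2 ^ Suc 0"] \<open>odd e\<close>
    unfolding m v B_def by (simp_all del: bf.simps) (simp add: algebra_simps)
  then obtain g1 g4 y s t where w: "m1 = 2 * g1" "m4 = 2 * g4" "m5 = 4 * y" "m6 = 2 * s" "v5 = 2 * t"
    using 0(4,5) by (elim conjE evenE dvdE)
  have "B 0 m m - 8 = 8 * (g1 * g4 + m3 * s + d * s * s - 1) + 16 * (m2 * y + e * y * y)"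
    unfolding m w B_def by (simp add: algebra_simps)
  with Qm have "even (g1 * g4 + m3 * s + d * s * s - 1)" by presburger
  \<comment> \<open>The term s * (m3 + d * s) is even, so g1 * g4 is odd. The two parities derived
    next combine to v1 + v4 + v1 * v4 even, which forces v1 and v4 to be even.\<close>
  then have g: "odd g1" "odd g4" using \<open>odd m3\<close> \<open>odd d\<close> by auto
  have "B 0 m v = 2 * (g1 * v4 + g4 * v1 + m3 * v6) +
      4 * (m2 * t + 2 * y * v2 + s * v3 + 2 * e * y * t + d * s * v6)"
    unfolding m v w B_def by (simp add: algebra_simps)
  then have 1: "even (g1 * v4 + g4 * v1 + m3 * v6)" using Bmv half_dvd4_iff by metis
  have "B 0 v v = 2 * (v1 * v4 + d * (v6 * v6)) + 4 * (2 * v2 * t + v3 * v6 + e * t * t)"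
    unfolding v w B_def by (simp add: algebra_simps)
  moreover have "4 dvd B 0 v v" using Qv by presburger
  ultimately have "even (v1 * v4 + d * (v6 * v6))" using half_dvd4_iff by metis
  then show False using 1 g \<open>odd m3\<close> \<open>odd d\<close> 0(8) by auto
next
  case (Suc c)
  note u = Suc.prems(1) and m = Suc.prems(3) and v = Suc.prems(7)
  define q where "q = (2::int) ^ c"
  have p: "2 ^ Suc (Suc c) = 4 * q" unfolding q_def by simp
  have Q8: "8 dvd B (Suc c) m m" "8 dvd B (Suc c) v v"
    using Suc.prems(9,10) dvd8_pow4[of "Suc c"] dvd_of_dvd_diff dvd_trans by blast+
  have four: "(4::int) dvd 4 ^ (Suc c + 1)" "(4::int) dvd 2 ^ (Suc c + 2)" by simp_all
  have Bmv: "4 dvd B (Suc c) m v" and Bum: "4 dvd B (Suc c) u m" and Buv: "4 dvd B (Suc c) u v"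
    using Suc.prems(11-13) four dvd_trans by blast+
  have ev: "4 dvd m5 \<and> even m6"
    using family_iii_even[OF \<open>odd d\<close> \<open>odd e\<close> _ Suc.prems(4,5) Q8(1)[unfolded m B_def]] by simp
  have "even (B (Suc c) v v)" "even (B (Suc c) u v)" using Q8(2) Buv by presburger+
  then have "even v5" and uv: "even (u1 * v4 + v1 * u4)"
    using \<open>odd e\<close> unfolding u v B_def p by auto
  obtain g1 g4 y s t where w: "m1 = 2 * g1" "m4 = 2 * g4" "m5 = 4 * y" "m6 = 2 * s" "v5 = 2 * t"
    using ev \<open>even v5\<close> Suc.prems(4,5) by (elim conjE evenE dvdE)
  have "B (Suc c) m v = 2 * (g1 * v4 + g4 * v1) +
      4 * (m2 * t + 2 * y * v2 + q * (m3 * v6 + v3 * 2 * s) + 2 * e * y * t + d * s * v6)"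
    unfolding m v w B_def p by (simp add: algebra_simps)
  then have gv: "even (g1 * v4 + g4 * v1)" using Bmv half_dvd4_iff by metis
  have "B (Suc c) u m = 2 * (g1 * u4 + g4 * u1 + m2 * u5) +
      4 * (2 * y * u2 + q * (m3 * u6 + u3 * 2 * s) + e * u5 * y + d * s * u6)"
    unfolding m u w B_def p by (simp add: algebra_simps)
  then have "even (g1 * u4 + g4 * u1 + m2 * u5)" using Bum half_dvd4_iff by metis
  \<comment> \<open>In F_2^2 both (u1, u4) and (g1, g4) are orthogonal to the nonzero (v1, v4),
    hence multiples of it and orthogonal to each other. Only m2 * u5 remains.\<close>
  then have "even m2" using gv uv \<open>odd u5\<close> Suc.prems(8) by auto
  then obtain x where x: "m2 = 2 * x" by (elim evenE)
  define l where "l = (if even g1 \<and> even g4 then 0 else 1::int)"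
  have gl: "even (g1 + l * v1)" "even (g4 + l * v4)"
    using gv Suc.prems(8) unfolding l_def by auto
  let ?u = "(u1, u2, 2 * u3, u4, u5, u6)" and ?v = "(v1, v2, 2 * v3, v4, v5, v6)"
    and ?h = "(g1, x, m3, g4, 2 * y, s)"
  have mh: "m = (2 * g1, 2 * x, m3, 2 * g4, 2 * (2 * y), 2 * s)" unfolding m w x by simp
  let ?m = "comb6 ?h l ?v"
  have r: "B (Suc c) m m = 4 * B c ?h ?h" "B (Suc c) m v = 2 * B c ?h ?v"
    "B (Suc c) u m = 2 * B c ?u ?h" "B (Suc c) v v = B c ?v ?v" "B (Suc c) u v = B c ?u ?v"
    unfolding B_def power_Suc[of _ "Suc c"] mh u v
    by (rule bf_rescale_half_half bf_rescale_half bf_rescale)+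
  have Qh: "4 ^ (c + 2) dvd B c ?h ?h - 2 * 4 ^ (c + 1)"
  proof (rule dvd_quarter)
    show "4 * 4 ^ (c + 2) dvd 4 * (B c ?h ?h - 2 * 4 ^ (c + 1))"
      using Suc.prems(9) unfolding r by (simp add: algebra_simps)
  qed
  have Bhv: "2 * 4 ^ (c + 1) dvd B c ?h ?v"
  proof -
    have "2 * (2 * 4 ^ (c + 1)) dvd 2 * B c ?h ?v" using Suc.prems(11) unfolding r by simp
    then show ?thesis by (simp only: dvd_mult_cancel_left) simp
  qed
  have Buh: "2 ^ (c + 2) dvd B c ?u ?h"
    using Suc.prems(12) unfolding r add_Suc by (rule dvd_halve)
  have Qv: "4 ^ (c + 2) dvd B c ?v ?v"
    using Suc.prems(10) unfolding r by (auto elim: dvd_mult_right)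
  have l01: "l = 0 \<or> l = 1" unfolding l_def by simp
  show False
  proof (rule Suc.IH)
    show "?u = (u1, u2, 2 * u3, u4, u5, u6)" by simp
    show "?m = (g1 + l * v1, x + l * v2, m3 + l * (2 * v3), g4 + l * v4, 2 * y + l * v5, s + l * v6)"
      by simp
    show "?v = (v1, v2, 2 * v3, v4, v5, v6)" by simp
    show "odd (m3 + l * (2 * v3))" using Suc.prems(6) by simp
    have "B c ?m ?m - 2 * 4 ^ (c + 1)
        = (B c ?h ?h - 2 * 4 ^ (c + 1)) + (l * (2 * B c ?h ?v) + l * B c ?v ?v)"
      unfolding B_def bf_comb6_left bf_comb6_right bf_commute[of _ _ _ _ _ _ _ _ _ ?v ?h]
      using l01 by (elim disjE) (simp_all add: algebra_simps del: bf.simps)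
    moreover have "4 ^ (c + 2) dvd 2 * B c ?h ?v"
      using mult_dvd_mono[OF dvd_refl[of 2] Bhv] by simp
    ultimately show "4 ^ (c + 2) dvd B c ?m ?m - 2 * 4 ^ (c + 1)"
      using Qh Qv by (simp only: dvd_add dvd_mult)
    have 2: "2 * 4 ^ (c + 1) dvd (4 ^ (c + 2) :: int)" by simp
    then show "2 * 4 ^ (c + 1) dvd B c ?v ?v" using Qv dvd_trans by blast
    have "4 ^ (c + 1) dvd (2 * 4 ^ (c + 1) :: int)" by simp
    then have "4 ^ (c + 1) dvd B c ?h ?v" "4 ^ (c + 1) dvd B c ?v ?v"
      using Bhv Qv 2 dvd_trans by blast+
    then show "4 ^ (c + 1) dvd B c ?m ?v"
      unfolding B_def bf_comb6_left by (simp del: bf.simps)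
    have "2 ^ (c + 2) dvd (2 ^ (Suc c + 2) :: int)" by simp
    then have "2 ^ (c + 2) dvd B c ?u ?v" using Suc.prems(13) unfolding r by (rule dvd_trans)
    then show "2 ^ (c + 2) dvd B c ?u ?v" "2 ^ (c + 2) dvd B c ?u ?m"
      using Buh unfolding B_def bf_comb6_right by (simp_all del: bf.simps)
  qed (use gl Suc.prems(2,8) in simp_all)
qed

text \<open>The companion \<open>r\<close> is never halved. It repairs an odd m2: as r2 is odd,
  \<open>m + r\<close> has an even one. The quantity \<open>B c r r + 2 * B c r m\<close> is the
  change of the norm under this replacement, so its divisibility keeps the norm condition on
  \<open>m\<close> intact.\<close>

lemma not_family_iii_chain2:
  fixes d e :: int
  defines "B c \<equiv> bf 1 2 (2 ^ Suc c) 0 0 0 e 0 (2 * d)"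
  assumes "odd d" "odd e"
    and "u = (u1, u2, u3, u4, u5, u6)" "odd u5"
    and "r = (r1, r2, r3, r4, r5, r6)" "even r1" "even r4" "odd r2" "even r3"
    and "m = (m1, m2, m3, m4, m5, m6)" "even m1" "even m4" "odd m3"
    and "4 ^ (c + 2) dvd B c m m - 2 * 4 ^ (c + 1)"
    and "2 * 4 ^ (c + 1) dvd B c r r"
    and "4 ^ (c + 1) dvd B c r m"
    and "4 ^ (c + 2) dvd B c r r + 2 * B c r m"
    and "2 ^ (c + 2) dvd B c u r"
    and "2 ^ (c + 2) dvd B c u m"
  shows False
  using assms(4-)
proof (induction c arbitrary: u u1 u2 u3 u4 u5 u6 m m1 m2 m3 m4 m5 m6 r r1 r2 r3 r4 r5 r6)
  case 0
  note u = 0(1) and r = 0(3) and m = 0(8)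
  have Qm: "16 dvd B 0 m m - 8" and Qr: "8 dvd B 0 r r" and Qrm: "16 dvd B 0 r r + 2 * B 0 r m"
    and Bur: "4 dvd B 0 u r"
    using 0 by simp_all
  have "8 dvd B 0 m m" using Qm by presburger
  then have em: "4 dvd m5 \<and> even m6"
    using family_iii_even[OF \<open>odd d\<close> \<open>odd e\<close> _ 0(9,10), of "2 ^ Suc 0"] unfolding m B_def by simp
  have er: "4 dvd r5 \<and> even r6"
    using family_iii_even[OF \<open>odd d\<close> \<open>odd e\<close> _ 0(4,5), of "2 ^ Suc 0"] Qr unfolding r B_def by simp
  obtain g1 g4 y s where w: "m1 = 2 * g1" "m4 = 2 * g4" "m5 = 4 * y" "m6 = 2 * s"
    using em 0(9,10) by (elim conjE evenE dvdE)
  obtain k1 k4 t z x where w': "r1 = 2 * k1" "r4 = 2 * k4" "r3 = 2 * z" "r5 = 4 * t" "r6 = 2 * x"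
    using er 0(4,5,7) by (elim conjE evenE dvdE)
  have "B 0 m m - 8 = 8 * (g1 * g4 + m3 * s + d * s * s - 1) + 16 * (m2 * y + e * y * y)"
    unfolding m w B_def by (simp add: algebra_simps)
  with Qm have "even (g1 * g4 + m3 * s + d * s * s - 1)" by presburger
  then have g: "odd g1" "odd g4" using \<open>odd m3\<close> \<open>odd d\<close> by auto
  have "B 0 r r + 2 * B 0 r m = 8 * (k1 * k4 + d * x * x + k1 * g4 + k4 * g1 + m3 * x) +
      16 * (r2 * t + e * t * t + z * x + r2 * y + m2 * t + z * s + 2 * e * y * t + d * x * s)"
    unfolding m r w w' B_def by (simp add: algebra_simps)
  then have "even (k1 * k4 + d * x * x + k1 * g4 + k4 * g1 + m3 * x)" using Qrm eighth_dvd16_iff by metis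
  \<comment> \<open>With g1 and g4 odd and x * (d * x + m3) even, this says that k1 + k4 + k1 * k4
    is even.\<close>
  then have k: "even k1" "even k4" using g \<open>odd m3\<close> \<open>odd d\<close> by auto
  have "B 0 u r = 2 * (k1 * u4 + k4 * u1 + r2 * u5) + 4 * (2 * u2 * t + u3 * x + z * u6 + e * u5 * t + d * u6 * x)"
    unfolding u r w' B_def by (simp add: algebra_simps)
  then have "even (k1 * u4 + k4 * u1 + r2 * u5)" using Bur half_dvd4_iff by metis
  then show False using k \<open>odd r2\<close> \<open>odd u5\<close> by auto
next
  case (Suc c)
  note u = Suc.prems(1) and r = Suc.prems(3)
  define q where "q = (2::int) ^ c"
  have p: "2 ^ Suc (Suc c) = 4 * q" unfolding q_def by simp
  have four: "(4::int) dvd 2 ^ (Suc c + 2)" "(8::int) dvd 4 ^ (Suc c + 1)"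
    using dvd_mult2[of 8 16 "4 ^ c"] by simp_all
  have Q8r: "8 dvd B (Suc c) r r" using Suc.prems(13) dvd8_pow4(2) dvd_trans by blast
  have er: "4 dvd r5 \<and> even r6"
    using family_iii_even[OF \<open>odd d\<close> \<open>odd e\<close> _ Suc.prems(4,5) Q8r[unfolded r B_def]] by simp
  obtain k1 k4 t x where w': "r1 = 2 * k1" "r4 = 2 * k4" "r5 = 4 * t" "r6 = 2 * x"
    using er Suc.prems(4,5) by (elim conjE evenE dvdE)
  have step: False
    if m: "m = (m1, m2, m3, m4, m5, m6)" "even m1" "even m4" "odd m3" "even m2"
      and Qm: "4 ^ (Suc c + 2) dvd B (Suc c) m m - 2 * 4 ^ (Suc c + 1)"
      and Brm: "4 ^ (Suc c + 1) dvd B (Suc c) r m"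
      and Bum: "2 ^ (Suc c + 2) dvd B (Suc c) u m"
    for m m1 m2 m3 m4 m5 m6
  proof -
    have "8 dvd B (Suc c) m m" using Qm dvd8_pow4[of "Suc c"] dvd_of_dvd_diff by blast
    then have em: "4 dvd m5 \<and> even m6"
      using family_iii_even[OF \<open>odd d\<close> \<open>odd e\<close> _ m(2,3), of "2 ^ Suc (Suc c)"] unfolding m(1) B_def
      by (simp del: bf.simps)
    obtain g1 g4 y s xm where w: "m1 = 2 * g1" "m4 = 2 * g4" "m5 = 4 * y" "m6 = 2 * s" "m2 = 2 * xm"
      using em m(2,3,5) by (elim conjE evenE dvdE)
    have "4 dvd B (Suc c) u m" "4 dvd B (Suc c) u r" "8 dvd B (Suc c) r m"
      using Bum Brm Suc.prems(16) four dvd_trans by blast+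
    moreover have "B (Suc c) u m = 2 * (g1 * u4 + g4 * u1) +
        4 * (xm * u5 + 2 * y * u2 + q * (m3 * u6 + u3 * 2 * s) + e * u5 * y + d * s * u6)"
      unfolding m(1) u w B_def p by (simp add: algebra_simps)
    moreover have "B (Suc c) u r = 2 * (k1 * u4 + k4 * u1 + r2 * u5) +
        4 * (2 * t * u2 + q * (r3 * u6 + u3 * 2 * x) + e * u5 * t + d * x * u6)"
      unfolding r u w' B_def p by (simp add: algebra_simps)
    moreover have "B (Suc c) r m = 4 * (k1 * g4 + k4 * g1) +
        8 * (r2 * y + 2 * xm * t + q * (r3 * s + m3 * x) + 2 * e * y * t + d * x * s)"
      unfolding r m(1) w w' B_def p by (simp add: algebra_simps)
    ultimately have "even (g1 * u4 + g4 * u1)" "even (k1 * u4 + k4 * u1 + r2 * u5)" "even (k1 * g4 + k4 * g1)"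
      using half_dvd4_iff quarter_dvd8_iff by metis+
    \<comment> \<open>Since r2 * u5 is odd, (k1, k4) and (u1, u4) form a basis of F_2^2, and (g1,
      g4) is orthogonal to both.\<close>
    then have "even g1" "even g4" using \<open>odd r2\<close> \<open>odd u5\<close> by auto
    let ?u = "(u1, u2, 2 * u3, u4, u5, u6)" and ?r = "(r1, r2, 2 * r3, r4, r5, r6)"
      and ?m = "(g1, xm, m3, g4, 2 * y, s)"
    have mh: "m = (2 * g1, 2 * xm, m3, 2 * g4, 2 * (2 * y), 2 * s)" unfolding m(1) w by simp
    have h: "B (Suc c) m m = 4 * B c ?m ?m" "B (Suc c) r m = 2 * B c ?r ?m"
      "B (Suc c) u m = 2 * B c ?u ?m" "B (Suc c) r r = B c ?r ?r" "B (Suc c) u r = B c ?u ?r"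
      unfolding B_def power_Suc[of _ "Suc c"] mh u r
      by (rule bf_rescale_half_half bf_rescale_half bf_rescale)+
    have Bh: "2 * 4 ^ (c + 1) dvd B c ?r ?m"
    proof -
      have "2 * (2 * 4 ^ (c + 1)) dvd 2 * B c ?r ?m" using Brm unfolding h by simp
      then show ?thesis by (simp only: dvd_mult_cancel_left) simp
    qed
    have Qr: "4 ^ (c + 2) dvd B c ?r ?r"
      using Suc.prems(13) unfolding h by (auto elim: dvd_mult_right)
    show False
    proof (rule Suc.IH)
      show "?u = (u1, u2, 2 * u3, u4, u5, u6)" by simp
      show "?r = (r1, r2, 2 * r3, r4, r5, r6)" by simp
      show "?m = (g1, xm, m3, g4, 2 * y, s)" by simp
      show "4 ^ (c + 2) dvd B c ?m ?m - 2 * 4 ^ (c + 1)"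
      proof (rule dvd_quarter)
        show "4 * 4 ^ (c + 2) dvd 4 * (B c ?m ?m - 2 * 4 ^ (c + 1))"
          using Qm unfolding h by (simp add: algebra_simps)
      qed
      have "2 * 4 ^ (c + 1) dvd (4 ^ (c + 2) :: int)" by simp
      then show "2 * 4 ^ (c + 1) dvd B c ?r ?r" using Qr dvd_trans by blast
      have "4 ^ (c + 1) dvd (2 * 4 ^ (c + 1) :: int)" by simp
      then show "4 ^ (c + 1) dvd B c ?r ?m" using Bh dvd_trans by blast
      have "4 ^ (c + 2) dvd 2 * B c ?r ?m"
        using mult_dvd_mono[OF dvd_refl[of 2] Bh] by simp
      then show "4 ^ (c + 2) dvd B c ?r ?r + 2 * B c ?r ?m" using Qr by (rule dvd_add[rotated])
      have "2 ^ (c + 2) dvd (2 ^ (Suc c + 2) :: int)" by simp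
      then show "2 ^ (c + 2) dvd B c ?u ?r" using Suc.prems(16) unfolding h by (rule dvd_trans)
      show "2 ^ (c + 2) dvd B c ?u ?m" using Bum unfolding h add_Suc by (rule dvd_halve)
    qed (use \<open>even g1\<close> \<open>even g4\<close> \<open>odd m3\<close> Suc.prems(2,4-7) in simp_all)
  qed
  show False
  proof (cases "even m2")
    case True
    then show False using step Suc.prems(8-12,14,17) by blast
  next
    case False
    let ?m = "comb6 m 1 r"
    show False
    proof (rule step)
      show "?m = (m1 + 1 * r1, m2 + 1 * r2, m3 + 1 * r3, m4 + 1 * r4, m5 + 1 * r5, m6 + 1 * r6)"
        unfolding Suc.prems(3,8) by simp
      have "B (Suc c) ?m ?m - 2 * 4 ^ (Suc c + 1) = (B (Suc c) m m - 2 * 4 ^ (Suc c + 1)) +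
          (B (Suc c) r r + 2 * B (Suc c) r m)"
        unfolding B_def bf_add bf_commute[of _ _ _ _ _ _ _ _ _ m r] by (simp del: bf.simps)
      then show "4 ^ (Suc c + 2) dvd B (Suc c) ?m ?m - 2 * 4 ^ (Suc c + 1)"
        using Suc.prems(12,15) by (simp only: dvd_add)
      have "4 ^ (Suc c + 1) dvd (2 * 4 ^ (Suc c + 1) :: int)" by simp
      then have "4 ^ (Suc c + 1) dvd B (Suc c) r r" using Suc.prems(13) by (rule dvd_trans)
      then show "4 ^ (Suc c + 1) dvd B (Suc c) r ?m"
        using Suc.prems(14) unfolding B_def bf_comb6_right mult_1 by (rule dvd_add[rotated])
      show "2 ^ (Suc c + 2) dvd B (Suc c) u ?m"
        using Suc.prems(17,16) unfolding B_def bf_comb6_right mult_1 by (rule dvd_add)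
    qed (use False Suc.prems(4-7,9-11) in simp_all)
  qed
qed

text \<open>If \<open>a\<close> and \<open>b\<close> both vanish modulo 2 in the plane (x1, y1),
  only x2 and x3 survive modulo 2. Primitivity then makes a, b, a + b the three nonzero vectors of
  F_2^2, and the one with even x3 is the companion in \<open>not_family_iii_chain2\<close>.
  Otherwise \<open>a\<close> and \<open>b\<close> are dependent in that plane: one of a, b, a + b
  vanishes there and another does not, as in \<open>not_family_iii_chain1\<close>.\<close>

lemma not_family_iii:
  fixes d e :: int
  defines "B c \<equiv> bf 1 2 (2 ^ Suc c) 0 0 0 e 0 (2 * d)"
  assumes "odd d" "odd e"
    and Qu: "odd (B c u u)"
    and Qa: "4 ^ (c + 3) dvd B c a a - 2 * 4 ^ (c + 1)"
    and Qb: "4 ^ (c + 3) dvd B c b b - 2 * 4 ^ (c + 1)"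
    and Bab: "4 ^ (c + 3) dvd B c a b - 4 ^ (c + 1)"
    and Bua: "4 ^ (c + 3) dvd B c u a"
    and Bub: "4 ^ (c + 3) dvd B c u b"
    and prim: "\<not> even6 a" "\<not> even6 b" "\<not> even6 (comb6 a 1 b)"
  shows False
proof -
  obtain u1 u2 u3 u4 u5 u6 where u: "u = (u1, u2, u3, u4, u5, u6)" by (cases u) auto
  obtain a1 a2 a3 a4 a5 a6 where a: "a = (a1, a2, a3, a4, a5, a6)" by (cases a) auto
  obtain b1 b2 b3 b4 b5 b6 where b: "b = (b1, b2, b3, b4, b5, b6)" by (cases b) auto
  let ?s = "comb6 a 1 b"
  have s: "?s = (a1 + 1 * b1, a2 + 1 * b2, a3 + 1 * b3, a4 + 1 * b4, a5 + 1 * b5, a6 + 1 * b6)"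
    unfolding a b by simp
  define q where "q = (2::int) ^ c"
  have p: "2 ^ Suc c = 2 * q" unfolding q_def by simp
  have "odd u5" using Qu unfolding u B_def p by auto
  \<comment> \<open>The common stock of congruences for both descents; in
    \<open>not_family_iii_chain2\<close> the second vector is \<open>r\<close>.\<close>
  define G where "G m v \<longleftrightarrow> 4 ^ (c + 2) dvd B c m m - 2 * 4 ^ (c + 1) \<and> 2 * 4 ^ (c + 1) dvd B c v v \<and>
    4 ^ (c + 1) dvd B c m v \<and> 4 ^ (c + 2) dvd B c v v + 2 * B c v m \<and>
    2 ^ (c + 2) dvd B c u m \<and> 2 ^ (c + 2) dvd B c u v" for m v
  define P where "P = (4::int) ^ (c + 1)"
  have P: "4 ^ (c + 3) = 16 * P" "4 ^ (c + 2) = 4 * P" unfolding P_def by (simp_all add: power_add)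
  obtain ka kb kab kua kub where "B c a a - 2 * P = 16 * P * ka" "B c b b - 2 * P = 16 * P * kb"
    "B c a b - P = 16 * P * kab" "B c u a = 16 * P * kua" "B c u b = 16 * P * kub"
    using Qa Qb Bab Bua Bub unfolding P P_def[symmetric] by (elim dvdE)
  then have k: "B c a a = 2 * P + 16 * P * ka" "B c b b = 2 * P + 16 * P * kb"
    "B c a b = P + 16 * P * kab" "B c u a = 16 * P * kua" "B c u b = 16 * P * kub"
    by linarith+
  have kba: "B c b a = P + 16 * P * kab" using k(3) unfolding B_def by (subst bf_commute)
  have ks: "B c ?s ?s = 4 * P * (1 + 4 * ka + 4 * kb + 8 * kab) + 2 * P"
    "B c ?s a = P * (3 + 16 * ka + 16 * kab)" "B c a ?s = P * (3 + 16 * ka + 16 * kab)"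
    "B c u ?s = 16 * P * (kua + kub)"
    using k kba unfolding B_def bf_comb6_left bf_comb6_right by (simp_all add: algebra_simps)
  have two: "2 ^ (c + 2) dvd 16 * P"
  proof -
    have "(2::int) ^ (c + 2) dvd 2 ^ (2 * c + 6)" by (rule le_imp_power_dvd) simp
    also have "(2::int) ^ (2 * c + 6) = 16 * P" unfolding P_def by (simp add: power_add power_mult)
    finally show ?thesis .
  qed
  have G: "G a b" "G b a" "G ?s a" "G a ?s"
  proof -
    note D = G_def P P_def[symmetric] k ks kba
    have A: "2 ^ (c + 2) dvd 16 * P * x" for x using two by (rule dvd_mult2)
    have A': "2 ^ (c + 2) dvd 16 * P * x + 16 * P * y" for x y using A by (intro dvd_add)
    show "G a b"
      unfolding D by (intro conjI A dvdI[of _ _ "4 * ka"] dvdI[of _ _ "1 + 8 * kb"]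
          dvdI[of _ _ "1 + 16 * kab"] dvdI[of _ _ "1 + 4 * kb + 8 * kab"]) (simp_all add: algebra_simps)
    show "G b a"
      unfolding D by (intro conjI A dvdI[of _ _ "4 * kb"] dvdI[of _ _ "1 + 8 * ka"]
          dvdI[of _ _ "1 + 16 * kab"] dvdI[of _ _ "1 + 4 * ka + 8 * kab"]) (simp_all add: algebra_simps)
    show "G ?s a"
      unfolding D by (intro conjI A dvdI[of _ _ "1 + 4 * ka + 4 * kb + 8 * kab"] dvdI[of _ _ "1 + 8 * ka"]
          dvdI[of _ _ "3 + 16 * ka + 16 * kab"] dvdI[of _ _ "2 + 12 * ka + 8 * kab"]) (simp_all add: algebra_simps)
    show "G a ?s"
      unfolding D by (intro conjI A dvdI[of _ _ "4 * ka"] dvdI[of _ _ "3 + 8 * ka + 8 * kb + 16 * kab"]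
          dvdI[of _ _ "3 + 16 * ka + 16 * kab"] dvdI[of _ _ "3 + 12 * ka + 4 * kb + 16 * kab"]) (simp_all add: algebra_simps)
  qed
  have chain2: False
    if "G m r" "r = (r1, r2, r3, r4, r5, r6)" "even r1" "even r4" "odd r2" "even r3"
      "m = (m1, m2, m3, m4, m5, m6)" "even m1" "even m4" "odd m3"
    for m m1 m2 m3 m4 m5 m6 r r1 r2 r3 r4 r5 r6
    using not_family_iii_chain2[OF \<open>odd d\<close> \<open>odd e\<close> u \<open>odd u5\<close> that(2-10), of c] that(1)
      bf_commute[of 1 2 "2 ^ Suc c" 0 0 0 e 0 "2 * d" m r]
    unfolding G_def B_def by argo
  have Q8: "8 dvd B c m m" "8 dvd B c v v" "4 dvd B c m v" "even (B c u v)" "4 dvd B c u m"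
    if "G m v" for m v
  proof -
    show "8 dvd B c m m" using that dvd8_pow4[of c] dvd_of_dvd_diff unfolding G_def by blast
    show "8 dvd B c v v" using that dvd8_pow4[of c] dvd_trans unfolding G_def by blast
    have "(4::int) dvd 4 ^ (c + 1)" "(4::int) dvd 2 ^ (c + 2)" "(2::int) dvd 2 ^ (c + 2)" by simp_all
    then show "4 dvd B c m v" "even (B c u v)" "4 dvd B c u m"
      using that dvd_trans unfolding G_def by blast+
  qed
  have even56: "even m5 \<and> even m6"
    if "G m v" "m = (m1, m2, m3, m4, m5, m6)" "even m1" "even m4" for m v m1 m2 m3 m4 m5 m6
  proof -
    have "4 dvd m5 \<and> even m6"
      using family_iii_even[OF \<open>odd d\<close> \<open>odd e\<close> _ that(3,4), of "2 ^ Suc c"] Q8(1)[OF that(1)]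
      unfolding that(2) B_def by simp
    then show ?thesis by presburger
  qed
  have even5: "even v5" if "G m v" "v = (v1, v2, v3, v4, v5, v6)" for m v v1 v2 v3 v4 v5 v6
  proof -
    have "even (B c v v)" using Q8(2)[OF that(1)] by presburger
    then show ?thesis using \<open>odd e\<close> unfolding that(2) B_def p by simp
  qed
  have chain1: False
    if "G m v" and m: "m = (m1, m2, m3, m4, m5, m6)" and "even m1" "even m4" "\<not> even6 m"
      and v: "v = (v1, v2, v3, v4, v5, v6)" and "\<not> (even v1 \<and> even v4)"
    for m m1 m2 m3 m4 m5 m6 v v1 v2 v3 v4 v5 v6
  proof (cases "even m3")
    case False
    then show ?thesis
      using not_family_iii_chain1[OF \<open>odd d\<close> \<open>odd e\<close> u \<open>odd u5\<close> m \<open>even m1\<close> \<open>even m4\<close> _ v that(7), of c] that(1)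
      unfolding G_def B_def by argo
  next
    case True
    have "4 dvd m5 \<and> even m6"
      using family_iii_even[OF \<open>odd d\<close> \<open>odd e\<close> _ \<open>even m1\<close> \<open>even m4\<close>, of "2 ^ Suc c"] Q8(1)[OF that(1)]
      unfolding m B_def by simp
    moreover have "even v5" using even5[OF that(1) v] .
    ultimately obtain g1 g4 z y t w where w: "m1 = 2 * g1" "m4 = 2 * g4" "m3 = 2 * z" "m5 = 4 * y" "m6 = 2 * w"
      "v5 = 2 * t"
      using \<open>even m1\<close> \<open>even m4\<close> True by (elim conjE evenE dvdE)
    have "B c m v = 2 * (g1 * v4 + g4 * v1) +
        4 * (m2 * t + 2 * y * v2 + q * (z * v6 + v3 * w) + 2 * e * y * t + d * w * v6)"
      unfolding m v w B_def p by (simp add: algebra_simps)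
    then have 1: "even (g1 * v4 + g4 * v1)" using Q8(3)[OF that(1)] half_dvd4_iff by metis
    have "B c u m = 2 * (g1 * u4 + g4 * u1 + m2 * u5) +
        4 * (2 * y * u2 + q * (z * u6 + u3 * w) + e * u5 * y + d * w * u6)"
      unfolding m u w B_def p by (simp add: algebra_simps)
    then have 2: "even (g1 * u4 + g4 * u1 + m2 * u5)" using Q8(5)[OF that(1)] half_dvd4_iff by metis
    have "even (u1 * v4 + v1 * u4)"
      using Q8(4)[OF that(1)] unfolding u v w B_def p by simp
    \<comment> \<open>Again (u1, u4) and (g1, g4) are multiples of the nonzero (v1, v4) modulo 2.
      Now all coordinates of \<open>m\<close> are even, against primitivity.\<close>
    then have "even m2" using 1 2 \<open>odd u5\<close> that(7) by auto
    then show False using \<open>\<not> even6 m\<close> unfolding m w by simp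
  qed
  show False
  proof (cases "even a1 \<and> even a4 \<and> even b1 \<and> even b4")
    case True
    have e: "even a5 \<and> even a6" "even b5 \<and> even b6"
      using even56[OF G(1) a] even56[OF G(2) b] True by blast+
    show False
    proof (cases "even a3")
      case a3: True
      then have "odd a2" "odd b3" using prim e True unfolding s unfolding a b by auto
      then show False using chain2[OF G(2) a _ _ _ _ b] True a3 by blast
    next
      case a3: False
      show False
      proof (cases "even b3")
        case b3: True
        then have "odd b2" using prim e True unfolding a b by auto
        then show False using chain2[OF G(1) b _ _ _ _ a] True a3 b3 by blast
      next
        case b3: False
        then have "odd (a2 + 1 * b2)" using prim a3 e True unfolding s unfolding a b by auto
        moreover have "even (a3 + 1 * b3)" "even (a1 + 1 * b1)" "even (a4 + 1 * b4)"
          using a3 b3 True by auto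
        ultimately show False using chain2[OF G(4) s _ _ _ _ a] True a3 by blast
      qed
    qed
  next
    case False
    have "even (B c a b)" using Q8(3)[OF G(1)] by presburger
    then have "even (a1 * b4 + b1 * a4)"
      using even5[OF G(1) b] even5[OF G(2) a] unfolding a b B_def p by simp
    then consider "even a1" "even a4" | "even b1" "even b4"
      | "even (a1 + 1 * b1)" "even (a4 + 1 * b4)" "\<not> (even a1 \<and> even a4)"
      using False by fastforce
    then show False
    proof cases
      case 1
      then show False using chain1[OF G(1) a _ _ prim(1) b] False by blast
    next
      case 2
      then show False using chain1[OF G(2) b _ _ prim(2) a] False by blast
    next
      case 3
      then show False using chain1[OF G(3) s _ _ prim(3) a] by blast
    qed
  qed
qed

section \<open>Forms that represent all ternary forms modulo a power of 2\<close>

text \<open>Independence modulo 2 is how primitivity of a sublattice over Z_2 is expressed in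
  coordinates.\<close>

definition prim3 :: "int \<times> int \<times> int \<times> int \<times> int \<times> int \<Rightarrow> int \<times> int \<times> int \<times> int \<times> int \<times> int \<Rightarrow>
    int \<times> int \<times> int \<times> int \<times> int \<times> int \<Rightarrow> bool" where
  "prim3 a b u \<longleftrightarrow> (\<forall>r s t. even6 (comb6 (comb6 (comb6 (0, 0, 0, 0, 0, 0) r a) s b) t u) \<longrightarrow>
     even r \<and> even s \<and> even t)"

text \<open>The test forms are [[s11, s12], [s12, s22]] + <s33>: every lattice used as an
  obstruction is a binary lattice plus a line.\<close>

definition univ_form :: "nat \<Rightarrow> int \<Rightarrow> int \<Rightarrow> int \<Rightarrow> int \<Rightarrow> int \<Rightarrow> int \<Rightarrow> int \<Rightarrow> int \<Rightarrow> int \<Rightarrow> bool" where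
  "univ_form N p1 p2 p3 q11 q12 q13 q22 q23 q33 \<longleftrightarrow>
     (let B = bf p1 p2 p3 q11 q12 q13 q22 q23 q33 in
      \<forall>s11 s12 s22 s33. (s11 * s22 - s12 * s12) * s33 \<noteq> 0 \<longrightarrow>
        (\<exists>a b u. prim3 a b u \<and> 2 ^ N dvd B a a - s11 \<and> 2 ^ N dvd B a b - s12 \<and> 2 ^ N dvd B b b - s22 \<and>
          2 ^ N dvd B u a \<and> 2 ^ N dvd B u b \<and> 2 ^ N dvd B u u - s33))"

lemma univ_formE:
  assumes "univ_form N p1 p2 p3 q11 q12 q13 q22 q23 q33" "m \<le> N" "(s11 * s22 - s12 * s12) * s33 \<noteq> 0"
  obtains a b u where "prim3 a b u"
    "2 ^ m dvd bf p1 p2 p3 q11 q12 q13 q22 q23 q33 a a - s11"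
    "2 ^ m dvd bf p1 p2 p3 q11 q12 q13 q22 q23 q33 a b - s12"
    "2 ^ m dvd bf p1 p2 p3 q11 q12 q13 q22 q23 q33 b b - s22"
    "2 ^ m dvd bf p1 p2 p3 q11 q12 q13 q22 q23 q33 u a"
    "2 ^ m dvd bf p1 p2 p3 q11 q12 q13 q22 q23 q33 u b"
    "2 ^ m dvd bf p1 p2 p3 q11 q12 q13 q22 q23 q33 u u - s33"
proof -
  have "2 ^ m dvd (2 ^ N :: int)" using assms(2) by (rule le_imp_power_dvd)
  then show thesis
    using assms(1,3) that unfolding univ_form_def Let_def by (meson dvd_trans)
qed

lemma prim3_not_even6:
  assumes "prim3 a b u"
  shows "\<not> even6 a" "\<not> even6 b" "\<not> even6 u" "\<not> even6 (comb6 a 1 b)"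
proof -
  have z: "comb6 w 0 v = w" "comb6 (0, 0, 0, 0, 0, 0) 1 v = v" for v w by (cases v; cases w; simp)+
  show "\<not> even6 a" using assms[unfolded prim3_def, rule_format, of 1 0 0] by (auto simp: z)
  show "\<not> even6 b" using assms[unfolded prim3_def, rule_format, of 0 1 0] by (auto simp: z)
  show "\<not> even6 u" using assms[unfolded prim3_def, rule_format, of 0 0 1] by (auto simp: z)
  show "\<not> even6 (comb6 a 1 b)" using assms[unfolded prim3_def, rule_format, of 1 1 0] by (auto simp: z)
qed

section \<open>Changes of coordinates\<close>

text \<open>Representations are pushed forward along \<open>f\<close>. They stay primitive because
  \<open>f\<close> is linear and has trivial kernel modulo 2.\<close>

lemma univ_form_subst:
  assumes "univ_form N p1 p2 p3 q11 q12 q13 q22 q23 q33"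
    and form: "\<And>u v. 2 ^ N dvd bf p1 p2 p3 q11 q12 q13 q22 q23 q33 u v -
      bf p1' p2' p3' q11' q12' q13' q22' q23' q33' (f u) (f v)"
    and lin: "\<And>u t v. f (comb6 u t v) = comb6 (f u) t (f v)"
    and zero: "f (0, 0, 0, 0, 0, 0) = (0, 0, 0, 0, 0, 0)"
    and par: "\<And>v. even6 (f v) \<Longrightarrow> even6 v"
  shows "univ_form N p1' p2' p3' q11' q12' q13' q22' q23' q33'"
proof -
  let ?B = "bf p1 p2 p3 q11 q12 q13 q22 q23 q33"
  let ?B' = "bf p1' p2' p3' q11' q12' q13' q22' q23' q33'"
  have *: "2 ^ N dvd ?B' (f u) (f v) - s" if "2 ^ N dvd ?B u v - s" for u v s
    using dvd_diff[OF that form[of u v]] by (simp add: algebra_simps del: bf.simps)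
  have **: "2 ^ N dvd ?B' (f u) (f v)" if "2 ^ N dvd ?B u v" for u v
    using *[of u v 0] that by simp
  have "prim3 (f a) (f b) (f u)" if "prim3 a b u" for a b u
    using that par unfolding prim3_def by (metis lin zero)
  then show ?thesis
    using assms(1) * ** unfolding univ_form_def Let_def by meson
qed

lemma univ_form_swap12:
  assumes "univ_form N p1 p2 p3 q11 q12 q13 q22 q23 q33"
  shows "univ_form N p2 p1 p3 q22 q12 q23 q11 q13 q33"
  by (rule univ_form_subst[OF assms, of _ _ _ _ _ _ _ _ _ "\<lambda>(x1, x2, x3, y1, y2, y3). (x2, x1, x3, y2, y1, y3)"])
    (auto simp: algebra_simps split: prod.splits)

lemma univ_form_swap23:
  assumes "univ_form N p1 p2 p3 q11 q12 q13 q22 q23 q33"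
  shows "univ_form N p1 p3 p2 q11 q13 q12 q33 q23 q22"
  by (rule univ_form_subst[OF assms, of _ _ _ _ _ _ _ _ _ "\<lambda>(x1, x2, x3, y1, y2, y3). (x1, x3, x2, y1, y3, y2)"])
    (auto simp: algebra_simps split: prod.splits)

text \<open>When p1 = 1, the coordinate x1 absorbs every term that contains y1.\<close>

lemma univ_form_clear1:
  assumes "univ_form N 1 p2 p3 q11 q12 q13 q22 q23 q33"
    and "even (q11 + q22 * s2 * s2 + q33 * s3 * s3 + 2 * (q23 * s2 * s3 + q12 * s2 + q13 * s3))"
  shows "univ_form N 1 p2 p3 0 0 0 q22 q23 q33"
proof -
  obtain k where k: "q11 = 2 * k - (q22 * s2 * s2 + q33 * s3 * s3 + 2 * (q23 * s2 * s3 + q12 * s2 + q13 * s3))"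
    using assms(2) by (metis add_diff_cancel_right' evenE add.assoc)
  \<comment> \<open>After y2 = y2' + s2 y1 and y3 = y3' + s3 y1 the coefficient of y1 y1 is 2 k. The
    new x1 collects k y1 and all cross terms, including those that come from p2 x2 y2 and p3 x3
    y3.\<close>
  show ?thesis
    by (rule univ_form_subst[OF assms(1), of _ _ _ _ _ _ _ _ _ "\<lambda>(x1, x2, x3, y1, y2, y3).
       (x1 + p2 * s2 * x2 + p3 * s3 * x3 + (q12 + q22 * s2 + q23 * s3) * (y2 - s2 * y1) +
         (q13 + q23 * s2 + q33 * s3) * (y3 - s3 * y1) + k * y1, x2, x3, y1, y2 - s2 * y1, y3 - s3 * y1)"])
      (auto simp: k algebra_simps split: prod.splits)
qed

lemma univ_form_clear2:
  assumes "univ_form N p1 1 p3 q11 q12 q13 q22 q23 q33" "odd q22"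
  shows "univ_form N p1 1 p3 q11 q12 q13 1 0 q33"
proof -
  obtain k where k: "q22 = 2 * k + 1" using assms(2) by (elim oddE)
  show ?thesis
    by (rule univ_form_subst[OF assms(1), of _ _ _ _ _ _ _ _ _ "\<lambda>(x1, x2, x3, y1, y2, y3).
       (x1, x2 + k * y2 + q23 * y3, x3, y1, y2, y3)"])
      (auto simp: k algebra_simps split: prod.splits)
qed

lemma univ_form_clear23:
  assumes "univ_form N p1 2 p3 q11 q12 q13 q22 q23 q33" "even q23"
  shows "univ_form N p1 2 p3 q11 q12 q13 q22 0 q33"
proof -
  obtain k where k: "q23 = 2 * k" using assms(2) by (elim evenE)
  show ?thesis
    by (rule univ_form_subst[OF assms(1), of _ _ _ _ _ _ _ _ _ "\<lambda>(x1, x2, x3, y1, y2, y3).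
       (x1, x2 + k * y3, x3, y1, y2, y3)"])
      (auto simp: k algebra_simps split: prod.splits)
qed

text \<open>This completes the square in y2, with \<open>r\<close> inverse to q22 modulo 2^N. The
  dual change of x3 preserves x2 y2 + x3 y3, which suffices because both planes have the same
  coefficient \<open>p\<close>.\<close>

lemma univ_form_shear:
  assumes "univ_form N 1 p p 0 0 0 q22 q23 q33" and inv: "2 ^ N dvd q22 * r - 1"
  shows "univ_form N 1 p p 0 0 0 q22 0 (q33 - r * q23 * q23)"
proof -
  let ?f = "\<lambda>(x1, x2, x3, y1, y2, y3). (x1, x2, x3 - r * q23 * x2, y1, y2 + r * q23 * y3, y3)"
  show ?thesis
  proof (rule univ_form_subst[OF assms(1), of _ _ _ _ _ _ _ _ _ ?f])
    fix u v :: "int \<times> int \<times> int \<times> int \<times> int \<times> int"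
    obtain x1 x2 x3 y1 y2 y3 where u: "u = (x1, x2, x3, y1, y2, y3)" by (cases u) auto
    obtain x1' x2' x3' y1' y2' y3' where v: "v = (x1', x2', x3', y1', y2', y3')" by (cases v) auto
    have "bf 1 p p 0 0 0 q22 q23 q33 u v - bf 1 p p 0 0 0 q22 0 (q33 - r * q23 * q23) (?f u) (?f v)
        = (q22 * r - 1) * - (q23 * (y2 * y3' + y3 * y2') + r * q23 * q23 * (y3 * y3'))"
      unfolding u v by (simp add: algebra_simps)
    then show "2 ^ N dvd bf 1 p p 0 0 0 q22 q23 q33 u v - bf 1 p p 0 0 0 q22 0 (q33 - r * q23 * q23) (?f u) (?f v)"
      using inv by (simp only: dvd_mult2)
  qed (auto simp: algebra_simps split: prod.splits)
qed

section \<open>Obstructions modulo 4\<close>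

lemma univ_form_odd:
  assumes "univ_form N p1 p2 p3 q11 q12 q13 q22 q23 q33" "1 \<le> N"
  shows "odd q11 \<or> odd q22 \<or> odd q33"
proof -
  obtain u where "2 dvd bf p1 p2 p3 q11 q12 q13 q22 q23 q33 u u - 1"
    by (rule univ_formE[OF assms, of 1 1 0 1]) auto
  then show ?thesis by (cases u) auto
qed

text \<open>For even p_i the terms 2 p_i x_i y_i vanish modulo 4, and q(y, y) modulo 4 depends only
  on y modulo 2.\<close>

lemma bf_mod4_parity:
  fixes p1 p2 p3 :: int
  assumes "even p1" "even p2" "even p3" "even (y1 - y1')" "even (y2 - y2')" "even (y3 - y3')"
  shows "4 dvd bf p1 p2 p3 q11 q12 q13 q22 q23 q33 (x1, x2, x3, y1, y2, y3) (x1, x2, x3, y1, y2, y3) -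
    bf p1 p2 p3 q11 q12 q13 q22 q23 q33 (x1', x2', x3', y1', y2', y3') (x1', x2', x3', y1', y2', y3')"
proof -
  obtain r1 r2 r3 k1 k2 k3 where k: "p1 = 2 * r1" "p2 = 2 * r2" "p3 = 2 * r3"
    "y1 - y1' = 2 * k1" "y2 - y2' = 2 * k2" "y3 - y3' = 2 * k3"
    using assms by (elim evenE)
  then have y: "y1 = y1' + 2 * k1" "y2 = y2' + 2 * k2" "y3 = y3' + 2 * k3" by simp_all
  show ?thesis
    unfolding k(1-3) y
    by (rule dvdI[of _ _ "r1 * (x1 * (y1' + 2 * k1) - x1' * y1') + r2 * (x2 * (y2' + 2 * k2) - x2' * y2') +
        r3 * (x3 * (y3' + 2 * k3) - x3' * y3') + q11 * (y1' * k1 + k1 * k1) + q22 * (y2' * k2 + k2 * k2) +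
        q33 * (y3' * k3 + k3 * k3) + q12 * (y1' * k2 + k1 * y2' + 2 * k1 * k2) +
        q13 * (y1' * k3 + k1 * y3' + 2 * k1 * k3) + q23 * (y2' * k3 + k2 * y3' + 2 * k2 * k3)"])
      (simp add: algebra_simps)
qed

text \<open>The vectors of even norm form a plane over the field with two elements, so the even
  unimodular planes [[2, 1], [1, 2]] and [[0, 1], [1, 0]] cannot both be represented.\<close>

lemma not_univ_form_even_p:
  assumes "univ_form N p1 p2 p3 q11 q12 q13 q22 q23 q33" "2 \<le> N"
    and p: "even p1" "even p2" "even p3"
  shows False
proof -
  let ?B = "bf p1 p2 p3 q11 q12 q13 q22 q23 q33"
  have l: "odd q11 \<or> odd q22 \<or> odd q33" using univ_form_odd[OF assms(1)] assms(2) by simp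
  obtain a b where ab: "4 dvd ?B a a - 2" "4 dvd ?B a b - 1" "4 dvd ?B b b - 2"
    by (rule univ_formE[OF assms(1,2), of 2 2 1 1]) auto
  obtain h k where hk: "4 dvd ?B h h - 0" "4 dvd ?B h k - 1" "4 dvd ?B k k - 0"
    by (rule univ_formE[OF assms(1,2), of 0 0 1 1]) auto
  obtain a1 a2 a3 a4 a5 a6 where a: "a = (a1, a2, a3, a4, a5, a6)" by (cases a) auto
  obtain b1 b2 b3 b4 b5 b6 where b: "b = (b1, b2, b3, b4, b5, b6)" by (cases b) auto
  obtain h1 h2 h3 h4 h5 h6 where h: "h = (h1, h2, h3, h4, h5, h6)" by (cases h) auto
  obtain k1 k2 k3 k4 k5 k6 where k: "k = (k1, k2, k3, k4, k5, k6)" by (cases k) auto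
  have e: "even (?B a a)" "even (?B b b)" "even (?B h h)" "odd (?B a b)" "odd (?B h k)"
    using ab hk by presburger+
  have lin: "even (q11 * v4 + q22 * v5 + q33 * v6)"
    if "v = (v1, v2, v3, v4, v5, v6)" "even (?B v v)" for v v1 v2 v3 v4 v5 v6
    using that(2) p unfolding that(1) by simp
  have ne: "odd v4 \<or> odd v5 \<or> odd v6" if "v = (v1, v2, v3, v4, v5, v6)" "odd (?B v w)"
    for v w v1 v2 v3 v4 v5 v6
    using that(2) p unfolding that(1) by (cases w) auto
  have "odd (?B b a)" using e(4) by (subst bf_commute)
  then have nz: "odd a4 \<or> odd a5 \<or> odd a6" "odd b4 \<or> odd b5 \<or> odd b6" "odd h4 \<or> odd h5 \<or> odd h6"
    using ne[OF a e(4)] ne[OF b] ne[OF h e(5)] by blast+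
  have "?B (comb6 a 1 b) b = ?B a b + ?B b b" by (simp add: bf_comb6_left)
  then have "odd (?B (comb6 a 1 b) b)" using e by presburger
  then have "odd (a4 + 1 * b4) \<or> odd (a5 + 1 * b5) \<or> odd (a6 + 1 * b6)"
    by (rule ne[rotated]) (simp add: a b)
  \<comment> \<open>The plane has three nonzero vectors, the classes of a, b and a + b, all of norm
    2 modulo 4, and \<open>h\<close> falls into one of these classes.\<close>
  with lin[OF a e(1)] lin[OF b e(2)] lin[OF h e(3)] nz l consider "even (h4 - a4)" "even (h5 - a5)" "even (h6 - a6)"
    | "even (h4 - b4)" "even (h5 - b5)" "even (h6 - b6)"
    | "even (h4 - (a4 + 1 * b4))" "even (h5 - (a5 + 1 * b5))" "even (h6 - (a6 + 1 * b6))"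
    by (cases "even q11"; cases "even q22"; cases "even q33"; simp; argo)
  then show False
  proof cases
    case 1
    then have "4 dvd ?B h h - ?B a a" unfolding a h by (intro bf_mod4_parity p)
    then show False using ab hk by presburger
  next
    case 2
    then have "4 dvd ?B h h - ?B b b" unfolding b h by (intro bf_mod4_parity p)
    then show False using ab hk by presburger
  next
    case 3
    then have "4 dvd ?B h h - ?B (comb6 a 1 b) (comb6 a 1 b)"
      unfolding a b h comb6.simps by (intro bf_mod4_parity p)
    then show False using ab hk unfolding bf_add by presburger
  qed
qed

text \<open>Even norm forces an even y1, and half the norm modulo 2 is then a binary quadratic form
  in y2 and y3 over F_2. Representing A makes it anisotropic; representing H gives it a nontrivial
  zero.\<close>

lemma not_univ_form_even_q:
  assumes "univ_form N 1 p2 p3 q11 q12 q13 q22 q23 q33" "2 \<le> N"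
    and even: "even p2" "even p3" "even q22" "even q33"
  shows False
proof -
  let ?B = "bf 1 p2 p3 q11 q12 q13 q22 q23 q33"
  have q11: "odd q11" using univ_form_odd[OF assms(1)] assms by simp
  obtain r2 r3 t2 t3 where r: "p2 = 2 * r2" "p3 = 2 * r3" "q22 = 2 * t2" "q33 = 2 * t3"
    using even by (elim evenE)
  obtain a b where ab: "4 dvd ?B a a - 2" "4 dvd ?B a b - 1" "4 dvd ?B b b - 2"
    by (rule univ_formE[OF assms(1,2), of 2 2 1 1]) auto
  obtain h k where hk: "4 dvd ?B h h - 0" "4 dvd ?B h k - 1" "4 dvd ?B k k - 0"
    by (rule univ_formE[OF assms(1,2), of 0 0 1 1]) auto
  obtain a1 a2 a3 a4 a5 a6 where a: "a = (a1, a2, a3, a4, a5, a6)" by (cases a) auto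
  obtain b1 b2 b3 b4 b5 b6 where b: "b = (b1, b2, b3, b4, b5, b6)" by (cases b) auto
  obtain h1 h2 h3 h4 h5 h6 where h: "h = (h1, h2, h3, h4, h5, h6)" by (cases h) auto
  obtain k1 k2 k3 k4 k5 k6 where k: "k = (k1, k2, k3, k4, k5, k6)" by (cases k) auto
  have e: "even (?B a a)" "even (?B b b)" "even (?B h h)" "even (?B k k)" "odd (?B a b)" "odd (?B h k)"
    using ab hk by presburger+
  then have e4: "even a4" "even b4" "even h4" "even k4" using q11 unfolding a b h k r by auto
  have half: "4 dvd ?B v v \<longleftrightarrow> even (t2 * v5 + q23 * v5 * v6 + t3 * v6)"
    if v: "v = (v1, v2, v3, v4, v5, v6)" and "even v4" for v v1 v2 v3 v4 v5 v6
  proof -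
    obtain w where w: "v4 = 2 * w" using \<open>even v4\<close> by (elim evenE)
    have "?B v v = 2 * (t2 * (v5 * v5) + q23 * v5 * v6 + t3 * (v6 * v6)) +
      4 * (v1 * w + r2 * v2 * v5 + r3 * v3 * v6 + q11 * w * w + q12 * w * v5 + q13 * w * v6)"
      unfolding v w r by (simp add: algebra_simps)
    then have "4 dvd ?B v v \<longleftrightarrow> even (t2 * (v5 * v5) + q23 * v5 * v6 + t3 * (v6 * v6))"
      by (simp only: half_dvd4_iff)
    then show ?thesis by simp
  qed
  have not4: "\<not> 4 dvd ?B a a" "\<not> 4 dvd ?B b b" "4 dvd ?B h h" using ab hk by presburger+
  have "odd (q23 * (a5 * b6 + a6 * b5))" "odd (q23 * (h5 * k6 + h6 * k5))"
    using e(5,6) e4 unfolding a b h k r by auto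
  then show False using not4[unfolded half[OF a e4(1)] half[OF b e4(2)] half[OF h e4(3)]] by auto
qed

text \<open>Even norm forces an even y2, and half the norm is then x1 y1 modulo 2. The value 1
  occurs only at (1, 1), so two generators of A would agree in that plane and pair evenly.\<close>

lemma not_univ_form_ii_dvd4:
  assumes "univ_form N 1 1 p3 0 0 0 1 0 q33" "2 \<le> N" "even p3" "4 dvd q33"
  shows False
proof -
  let ?B = "bf 1 1 p3 0 0 0 1 0 q33"
  obtain a b where ab: "4 dvd ?B a a - 2" "4 dvd ?B a b - 1" "4 dvd ?B b b - 2"
    by (rule univ_formE[OF assms(1,2), of 2 2 1 1]) auto
  obtain a1 a2 a3 a4 a5 a6 where a: "a = (a1, a2, a3, a4, a5, a6)" by (cases a) auto
  obtain b1 b2 b3 b4 b5 b6 where b: "b = (b1, b2, b3, b4, b5, b6)" by (cases b) auto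
  obtain r t where r: "p3 = 2 * r" "q33 = 4 * t" using assms(3,4) by (elim evenE dvdE)
  have e: "even (?B a a)" "even (?B b b)" "odd (?B a b)" using ab by presburger+
  then have e4: "even a5" "even b5" unfolding a b r by auto
  have half: "4 dvd ?B v v \<longleftrightarrow> even (v1 * v4)"
    if v: "v = (v1, v2, v3, v4, v5, v6)" and "even v5" for v v1 v2 v3 v4 v5 v6
  proof -
    obtain w where w: "v5 = 2 * w" using \<open>even v5\<close> by (elim evenE)
    have "?B v v = 2 * (v1 * v4) + 4 * (v2 * w + r * v3 * v6 + w * w + t * v6 * v6)"
      unfolding v w r by (simp add: algebra_simps)
    then show ?thesis by (simp only: half_dvd4_iff)
  qed
  have "\<not> 4 dvd ?B a a" "\<not> 4 dvd ?B b b" using ab by presburger+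
  then show False using e(3) e4 unfolding half[OF a e4(1)] half[OF b e4(2)] unfolding a b r by auto
qed

section \<open>The three families as forms modulo 2^N\<close>

lemma not_univ_form_i:
  assumes "univ_form N 1 1 (2 ^ c) 0 0 0 0 0 e" "2 * c + 3 \<le> N" "odd e"
  shows False
proof -
  let ?B = "bf 1 1 (2 ^ c) 0 0 0 0 0 e"
  obtain a b v where r: "prim3 a b v" "2 ^ (2 * c + 3) dvd ?B a a - 2" "2 ^ (2 * c + 3) dvd ?B a b - 1"
    "2 ^ (2 * c + 3) dvd ?B b b - 2" "2 ^ (2 * c + 3) dvd ?B v a" "2 ^ (2 * c + 3) dvd ?B v b"
    "2 ^ (2 * c + 3) dvd ?B v v - 4 ^ (c + 1)"
    by (rule univ_formE[OF assms(1,2), of 2 2 1 "4 ^ (c + 1)"]) auto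
  have "4 dvd (2::int) ^ (2 * c + 3)" "2 ^ (c + 1) dvd (2::int) ^ (2 * c + 3)"
    by (simp add: power_add) (rule le_imp_power_dvd, simp)
  moreover have "(2::int) ^ (2 * c + 3) = 2 * 4 ^ (c + 1)" by (simp add: power_add power_mult)
  ultimately have "4 dvd ?B a a - 2" "4 dvd ?B a b - 1" "4 dvd ?B b b - 2" "2 ^ (c + 1) dvd ?B v a"
    "2 ^ (c + 1) dvd ?B v b" "2 * 4 ^ (c + 1) dvd ?B v v - 4 ^ (c + 1)"
    using r dvd_trans by metis+
  moreover from this(1-3) have "?B a a mod 4 = 2" "?B b b mod 4 = 2" "odd (?B a b)" by presburger+
  ultimately show False using not_family_i[OF \<open>odd e\<close>] prim3_not_even6(3)[OF r(1)] by blast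
qed

lemma not_univ_form_ii:
  assumes "univ_form N 1 1 (2 ^ Suc c) 0 0 0 1 0 (2 * d)" "2 * c + 4 \<le> N" "odd d"
  shows False
proof -
  let ?B = "bf 1 1 (2 ^ Suc c) 0 0 0 1 0 (2 * d)"
  obtain a b v where r: "prim3 a b v" "2 ^ (2 * c + 4) dvd ?B a a - 4" "2 ^ (2 * c + 4) dvd ?B a b - 2"
    "2 ^ (2 * c + 4) dvd ?B b b - 4" "2 ^ (2 * c + 4) dvd ?B v a" "2 ^ (2 * c + 4) dvd ?B v b"
    "2 ^ (2 * c + 4) dvd ?B v v - 2 * 4 ^ (c + 1)"
    by (rule univ_formE[OF assms(1,2), of 4 4 2 "2 * 4 ^ (c + 1)"]) auto
  have "8 dvd (2::int) ^ (2 * c + 4)" "2 ^ (c + 2) dvd (2::int) ^ (2 * c + 4)"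
    using dvd_mult2[of 8 16 "2 ^ (2 * c) :: int"] by (simp add: power_add mult.commute) (rule le_imp_power_dvd, simp)
  moreover have "(2::int) ^ (2 * c + 4) = 4 ^ (c + 2)" by (simp add: power_add power_mult)
  ultimately have "8 dvd ?B a a - 4" "8 dvd ?B a b - 2" "8 dvd ?B b b - 4" "2 ^ (c + 2) dvd ?B v a"
    "2 ^ (c + 2) dvd ?B v b" "4 ^ (c + 2) dvd ?B v v - 2 * 4 ^ (c + 1)"
    using r dvd_trans by metis+
  moreover from this(1-3) have "?B a a mod 8 = 4" "?B b b mod 8 = 4" "?B a b mod 4 = 2" by presburger+
  ultimately show False using not_family_ii[OF \<open>odd d\<close>] prim3_not_even6(3)[OF r(1)] by blast
qed

lemma not_univ_form_iii:
  assumes "univ_form N 1 2 (2 ^ Suc c) 0 0 0 e 0 (2 * d)" "2 * c + 6 \<le> N" "odd e" "odd d"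
  shows False
proof -
  let ?B = "bf 1 2 (2 ^ Suc c) 0 0 0 e 0 (2 * d)"
  obtain a b v where r: "prim3 a b v" "2 ^ (2 * c + 6) dvd ?B a a - 2 * 4 ^ (c + 1)"
    "2 ^ (2 * c + 6) dvd ?B a b - 4 ^ (c + 1)" "2 ^ (2 * c + 6) dvd ?B b b - 2 * 4 ^ (c + 1)"
    "2 ^ (2 * c + 6) dvd ?B v a" "2 ^ (2 * c + 6) dvd ?B v b" "2 ^ (2 * c + 6) dvd ?B v v - 1"
    by (rule univ_formE[OF assms(1,2), of "2 * 4 ^ (c + 1)" "2 * 4 ^ (c + 1)" "4 ^ (c + 1)" 1]) auto
  have "2 dvd (2::int) ^ (2 * c + 6)" by simp
  then have "2 dvd ?B v v - 1" using r(7) dvd_trans by blast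
  then have "odd (?B v v)" by presburger
  moreover have "(2::int) ^ (2 * c + 6) = 4 ^ (c + 3)" by (simp add: power_add power_mult)
  ultimately show False
    using not_family_iii[OF \<open>odd d\<close> \<open>odd e\<close>, where u = v] r(2-6) prim3_not_even6[OF r(1)] by metis
qed

section \<open>Forms with p1 = 1 and even p2, p3: the binary part modulo 8\<close>

lemma odd_square_mod8:
  assumes "odd (x::int)"
  obtains k where "x * x = 1 + 8 * k"
proof -
  have "x * x mod 8 = 1"
  proof -
    have "x mod 8 = 1 \<or> x mod 8 = 3 \<or> x mod 8 = 5 \<or> x mod 8 = 7" using assms by presburger
    then show ?thesis by (auto simp: mod_mult_eq[of x 8 x, symmetric])
  qed
  then show thesis using that[of "x * x div 8"] div_mult_mod_eq[of "x * x" 8] by linarith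
qed

text \<open>Completing the square: modulo 8 the form in y2 and y3 becomes diagonal in
  s = y2 + al be y3 and t = y3.\<close>

lemma bf_complete_square:
  fixes al be ga rho :: int
  assumes k: "al * al = 1 + 8 * k" and rho: "rho = ga - al * be * be"
  shows "bf 1 p2 p3 0 0 0 al be ga (x1, x2, x3, y1, y2, y3) (x1', x2', x3', y1', y2', y3') =
    (x1 * y1' + x1' * y1) + p2 * (x2 * y2' + x2' * y2) + p3 * (x3 * y3' + x3' * y3) +
    al * ((y2 + al * be * y3) * (y2' + al * be * y3')) + rho * (y3 * y3') -
    8 * (k * be * (y2 * y3' + y3 * y2' + al * be * y3 * y3'))"
proof -
  have "al * ((y2 + al * be * y3) * (y2' + al * be * y3')) = al * y2 * y2' +
    (al * al) * (be * (y2 * y3' + y3 * y2') + al * be * be * (y3 * y3'))"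
    by (simp add: algebra_simps)
  also have "\<dots> = al * y2 * y2' + (be * (y2 * y3' + y3 * y2') + al * be * be * (y3 * y3')) +
    8 * (k * be * (y2 * y3' + y3 * y2' + al * be * y3 * y3'))"
    unfolding k by (simp add: algebra_simps)
  finally show ?thesis by (simp add: rho algebra_simps)
qed

text \<open>X is a norm of H + <al> + <rho> modulo 4: P is the product x1 y1, and \<open>s\<close>,
  \<open>t\<close> say whether the two diagonal coordinates are even, so that their squares are 0 or
  1.\<close>

lemma binary_mod4_even:
  fixes P :: int
  assumes "X = 2 * P + (if s then 0 else al) + (if t then 0 else rho) + 4 * T"
    and "4 dvd X - 2" "rho mod 4 = 0 \<or> (rho + al) mod 4 = 0" "odd al"
  shows "odd P \<and> (s \<longleftrightarrow> even rho \<or> t)"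
  using assms by (cases s; cases t; simp only: if_True if_False simp_thms; presburger)

text \<open>As rho and al agree modulo 4, norm -al needs exactly one odd diagonal coordinate; it
  contributes al, and 2 P = -2 al modulo 4 remains.\<close>

lemma binary_mod4_odd:
  fixes P :: int
  assumes "X = 2 * P + (if s then 0 else al) + (if t then 0 else rho) + 4 * T"
    and "4 dvd X + al" "odd rho" "(rho - al) mod 4 = 0"
  shows "odd P \<and> (s \<longleftrightarrow> \<not> t)"
  using assms by (cases s; cases t; simp only: if_True if_False simp_thms; presburger)

text \<open>Modulo 4 the form is H + <al> + <rho> in the coordinates of
  \<open>bf_complete_square\<close>. For rho = 0 or -al modulo 4 it misses A; for rho = al it misses
  <-al, -al, -al>. Only rho = 2 is left.\<close>

lemma univ_form_binary_mod4:
  assumes "univ_form N 1 p2 p3 0 0 0 al be ga" "2 \<le> N" "even p2" "even p3" "odd al"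
  shows "(ga - al * be * be) mod 4 = 2"
proof -
  let ?B = "bf 1 p2 p3 0 0 0 al be ga"
  obtain k where k: "al * al = 1 + 8 * k" using \<open>odd al\<close> by (rule odd_square_mod8)
  obtain r2 r3 where r: "p2 = 2 * r2" "p3 = 2 * r3" using assms(3,4) by (elim evenE)
  define rho where "rho = ga - al * be * be"
  note cs = bf_complete_square[OF k rho_def, of "2 * r2" "2 * r3"]
  have Q: "\<exists>T. ?B v v = 2 * (v1 * v4) + al * ((v5 + al * be * v6) * (v5 + al * be * v6)) + rho * (v6 * v6) + 4 * T"
    if v: "v = (v1, v2, v3, v4, v5, v6)" for v v1 v2 v3 v4 v5 v6
    unfolding v cs r
    by (rule exI[of _ "r2 * v2 * v5 + r3 * v3 * v6 - 2 * (k * be * (2 * v5 * v6 + al * be * v6 * v6))"])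
      (simp add: algebra_simps)
  have Bp: "even (?B v w) \<longleftrightarrow> even (v1 * w4 + w1 * v4 + (v5 + al * be * v6) * (w5 + al * be * w6) + rho * (v6 * w6))"
    if v: "v = (v1, v2, v3, v4, v5, v6)" and w: "w = (w1, w2, w3, w4, w5, w6)"
    for v v1 v2 v3 v4 v5 v6 w w1 w2 w3 w4 w5 w6
    using \<open>odd al\<close> unfolding v w cs r by simp
  have sq: "\<exists>m. x * x = (if even x then 0 else 1) + 4 * m" for x :: int
  proof (cases "even x")
    case True
    then obtain y where "x = 2 * y" by (elim evenE)
    then show ?thesis using True by (intro exI[of _ "y * y"]) simp
  next
    case False
    then obtain m where "x * x = 1 + 8 * m" by (rule odd_square_mod8)
    then show ?thesis using False by (intro exI[of _ "2 * m"]) simp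
  qed
  have Q4: "\<exists>T. ?B v v = 2 * (v1 * v4) + (if even (v5 + al * be * v6) then 0 else al) + (if even v6 then 0 else rho) + 4 * T"
    if v: "v = (v1, v2, v3, v4, v5, v6)" for v v1 v2 v3 v4 v5 v6
  proof -
    define s where "s = v5 + al * be * v6"
    obtain T where T: "?B v v = 2 * (v1 * v4) + al * (s * s) + rho * (v6 * v6) + 4 * T"
      using Q[OF v, folded s_def] by blast
    obtain m m' where m: "s * s = (if even s then 0 else 1) + 4 * m"
      "v6 * v6 = (if even v6 then 0 else 1) + 4 * m'" using sq by meson
    show ?thesis unfolding T m s_def[symmetric]
      by (intro exI[of _ "al * m + rho * m' + T"]) (simp add: algebra_simps)
  qed
  obtain a b where ab: "4 dvd ?B a a - 2" "4 dvd ?B a b - 1" "4 dvd ?B b b - 2"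
    by (rule univ_formE[OF assms(1,2), of 2 2 1 1]) auto
  have "al \<noteq> 0" using \<open>odd al\<close> by auto
  obtain c d u where cdu: "4 dvd ?B c c + al" "4 dvd ?B c d" "4 dvd ?B d d + al"
    "4 dvd ?B u c" "4 dvd ?B u d" "4 dvd ?B u u + al"
    by (rule univ_formE[OF assms(1,2), of "- al" "- al" 0 "- al"]) (use \<open>al \<noteq> 0\<close> in auto)
  obtain a1 a2 a3 a4 a5 a6 where a: "a = (a1, a2, a3, a4, a5, a6)" by (cases a) auto
  obtain b1 b2 b3 b4 b5 b6 where b: "b = (b1, b2, b3, b4, b5, b6)" by (cases b) auto
  obtain c1 c2 c3 c4 c5 c6 where c: "c = (c1, c2, c3, c4, c5, c6)" by (cases c) auto
  obtain d1 d2 d3 d4 d5 d6 where d: "d = (d1, d2, d3, d4, d5, d6)" by (cases d) auto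
  obtain u1 u2 u3 u4 u5 u6 where u: "u = (u1, u2, u3, u4, u5, u6)" by (cases u) auto
  have "rho mod 4 = 2"
  proof (rule ccontr)
    assume "rho mod 4 \<noteq> 2"
    then have "rho mod 4 = 0 \<or> (rho + al) mod 4 = 0 \<or> odd rho \<and> (rho - al) mod 4 = 0"
      using \<open>odd al\<close> by presburger
    then consider "rho mod 4 = 0 \<or> (rho + al) mod 4 = 0" | "odd rho" "(rho - al) mod 4 = 0"
      by blast
    then show False
    proof cases
      case 1
      have H: "odd (v1 * v4) \<and> (even (v5 + al * be * v6) \<longleftrightarrow> even rho \<or> even v6)"
        if "4 dvd ?B v v - 2" "v = (v1, v2, v3, v4, v5, v6)" for v v1 v2 v3 v4 v5 v6
        using Q4[OF that(2)] binary_mod4_even[OF _ that(1) 1 \<open>odd al\<close>] by blast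
      \<comment> \<open>Both vectors are (1, 1) on H modulo 2. Their diagonal parts pair evenly too:
        either rho and the first diagonal coordinates are even, or rho is odd and each vector has
        diagonal coordinates of equal parity.\<close>
      have "odd (?B a b)" using ab(2) by presburger
      then show False using H[OF ab(1) a] H[OF ab(3) b] unfolding Bp[OF a b] by auto
    next
      case 2
      have H: "odd (v1 * v4) \<and> (even (v5 + al * be * v6) \<longleftrightarrow> odd v6)"
        if "4 dvd ?B v v + al" "v = (v1, v2, v3, v4, v5, v6)" for v v1 v2 v3 v4 v5 v6
        using Q4[OF that(2)] binary_mod4_odd[OF _ that(1) 2] by blast
      \<comment> \<open>Each of c, d, u is (1, 1) on H with exactly one odd diagonal coordinate. Two
        of them agree modulo 2 and therefore have an odd pairing.\<close>
      have "even (?B c d)" "even (?B u c)" "even (?B u d)" using cdu(2,4,5) by presburger+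
      then show False using H[OF cdu(1) c] H[OF cdu(3) d] H[OF cdu(6) u] 2(1)
        unfolding Bp[OF c d] Bp[OF u c] Bp[OF u d] by auto
    qed
  qed
  then show ?thesis unfolding rho_def .
qed

text \<open>The obstruction is H + <5 al>. The generators of H fill the plane (x1, y1) modulo 2, so
  \<open>v\<close> vanishes there modulo 2. Then y3 is even, and only al s^2 with an odd s survives
  modulo 8: the norm of \<open>v\<close> is al instead of 5 al.\<close>

lemma univ_form_binary_not_dvd4:
  assumes "univ_form N 1 p2 p3 0 0 0 al be ga" "3 \<le> N" "even p2" "even p3" "odd al"
  shows "\<not> 4 dvd p2"
proof
  assume "4 dvd p2"
  let ?B = "bf 1 p2 p3 0 0 0 al be ga"
  obtain k where k: "al * al = 1 + 8 * k" using \<open>odd al\<close> by (rule odd_square_mod8)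
  obtain r2 r3 where r: "p2 = 4 * r2" "p3 = 2 * r3" using \<open>4 dvd p2\<close> \<open>even p3\<close> by (elim evenE dvdE)
  define rho where "rho = ga - al * be * be"
  have "rho mod 4 = 2" unfolding rho_def using univ_form_binary_mod4[OF assms(1)] assms by simp
  then have "rho = 2 * (rho div 2)" "odd (rho div 2)" by presburger+
  then obtain sg where sg: "rho = 2 * sg" "odd sg" by blast
  note cs = bf_complete_square[OF k rho_def, of "4 * r2" "2 * r3"]
  obtain a b v where abv: "8 dvd ?B a a" "8 dvd ?B a b - 1" "8 dvd ?B b b" "8 dvd ?B v a" "8 dvd ?B v b"
    "8 dvd ?B v v - 5 * al"
    by (rule univ_formE[OF assms(1,2), of 0 0 1 "5 * al"]) (use \<open>odd al\<close> in auto)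
  obtain a1 a2 a3 a4 a5 a6 where a: "a = (a1, a2, a3, a4, a5, a6)" by (cases a) auto
  obtain b1 b2 b3 b4 b5 b6 where b: "b = (b1, b2, b3, b4, b5, b6)" by (cases b) auto
  obtain v1 v2 v3 v4 v5 v6 where v: "v = (v1, v2, v3, v4, v5, v6)" by (cases v) auto
  have "even (?B a a)" "odd (?B a b)" "even (?B b b)" "even (?B v a)" "even (?B v b)" "odd (?B v v)"
    using abv \<open>odd al\<close> by presburger+
  then have p: "even (v1 * a4 + a1 * v4)" "even (v1 * b4 + b1 * v4)" "odd (a1 * b4 + b1 * a4)"
    "odd (v5 + al * be * v6)"
    using \<open>odd al\<close> unfolding a b v cs r sg by auto
  then have "even v1" "even v4" by auto
  then obtain w1 w4 where w: "v1 = 2 * w1" "v4 = 2 * w4" by (elim evenE)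
  obtain m where m: "(v5 + al * be * v6) * (v5 + al * be * v6) = 1 + 8 * m"
    using p(4) by (rule odd_square_mod8)
  have Q: "?B v v - 5 * al = 4 * (r3 * v3 * v6 - al) + 2 * (sg * (v6 * v6)) +
    8 * (w1 * w4 + r2 * v2 * v5 + al * m - k * be * (2 * v5 * v6 + al * be * v6 * v6))"
    unfolding v cs m r sg w by (simp add: algebra_simps)
  then have "?B v v - 5 * al = 2 * (sg * (v6 * v6)) + 4 * (r3 * v3 * v6 - al +
    2 * (w1 * w4 + r2 * v2 * v5 + al * m - k * be * (2 * v5 * v6 + al * be * v6 * v6)))"
    by (simp only: distrib_left)
  moreover have "4 dvd ?B v v - 5 * al" using abv(6) by presburger
  ultimately have "even (sg * (v6 * v6))" using half_dvd4_iff by metis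
  then obtain t where t: "v6 = 2 * t" using sg(2) by (auto elim: evenE)
  have "?B v v - 5 * al = - 4 * al + 8 * (r3 * v3 * t + sg * t * t +
    (w1 * w4 + r2 * v2 * v5 + al * m - k * be * (2 * v5 * v6 + al * be * v6 * v6)))"
    unfolding Q unfolding t by (simp add: algebra_simps)
  then show False using abv(6) \<open>odd al\<close> by presburger
qed

lemma odd_inverse_mod_pow2:
  assumes "odd (x::int)"
  obtains r where "2 ^ N dvd x * r - 1"
proof -
  have "coprime x (2 ^ N)" using assms by simp
  then obtain r s where "r * x + s * 2 ^ N = 1" using bezout_int[of x "2 ^ N"] by auto
  then have "x * r - 1 = 2 ^ N * - s" by (simp add: algebra_simps)
  then show thesis using that dvd_triv_left by metis
qed

text \<open>An even \<open>ga\<close> makes \<open>be\<close> even and leads to family (iii)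
  directly. An odd \<open>ga\<close> gives the third plane the role of the second, so that p3 = 2 as
  well; then the shear removes the cross term.\<close>

lemma not_univ_form_binary:
  assumes "univ_form N 1 2 (2 ^ Suc c) 0 0 0 al be ga" "2 * c + 6 \<le> N" "odd al"
  shows False
proof -
  have p: "even (2 ^ Suc c :: int)" "2 \<le> N" "3 \<le> N" using assms(2) by simp_all
  have rho: "(ga - al * be * be) mod 4 = 2"
    using univ_form_binary_mod4[OF assms(1) p(2) _ p(1) assms(3)] by simp
  show False
  proof (cases "even ga")
    case True
    have "even (ga - al * be * be)" using rho by presburger
    then have "even be" using True \<open>odd al\<close> by simp
    then obtain k where k: "be = 2 * k" by (elim evenE)
    have "ga - al * be * be = ga - 4 * (al * k * k)" unfolding k by simp
    then have "ga = 2 * (ga div 2)" "odd (ga div 2)" using rho by presburger+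
    then show False
      using not_univ_form_iii[OF _ assms(2,3)] univ_form_clear23[OF assms(1) \<open>even be\<close>] by metis
  next
    case False
    have "\<not> (4::int) dvd 2 ^ Suc c"
      using univ_form_binary_not_dvd4[OF univ_form_swap23[OF assms(1)] p(3,1) _ False] by simp
    then have "c = 0" by (cases c) auto
    obtain r where inv: "2 ^ N dvd al * r - 1" using \<open>odd al\<close> by (rule odd_inverse_mod_pow2)
    have f: "univ_form N 1 2 2 0 0 0 al 0 (ga - r * be * be)"
      using univ_form_shear[OF _ inv] assms(1) \<open>c = 0\<close> by simp
    from univ_form_binary_mod4[OF this p(2) _ _ assms(3)]
    have m: "(ga - r * be * be) mod 4 = 2" by simp
    define g where "g = ga - r * be * be"
    have "g = 2 * (g div 2)" "odd (g div 2)" using m unfolding g_def[symmetric] by presburger+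
    then show False
      using not_univ_form_iii[of N 0 al "g div 2"] f assms(2,3) \<open>c = 0\<close> unfolding g_def[symmetric] by simp
  qed
qed

section \<open>Reduction of all forms to the three families\<close>

text \<open>A shift along y3 changes the parity of the coefficients of y1 y1 and y2 y2, because q33
  is odd. Both planes with coefficient 1 can thus be made hyperbolic, which is family (i).\<close>

lemma not_univ_form_11_odd:
  assumes "univ_form N 1 1 (2 ^ c) q11 q12 q13 q22 q23 q33" "2 * c + 3 \<le> N" "odd q33"
  shows False
proof -
  have ex: "\<exists>s3. even (q + r * 0 * 0 + q33 * s3 * s3 + 2 * (u * 0 * s3 + v * 0 + w * s3))" for q r u v w :: int
    using \<open>odd q33\<close> by (cases "even q") (auto intro: exI[of _ 0] exI[of _ 1])
  have "univ_form N 1 1 (2 ^ c) 0 0 0 q22 q23 q33"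
    using ex univ_form_clear1[OF assms(1)] by meson
  from univ_form_swap12[OF this]
  have "univ_form N 1 1 (2 ^ c) 0 0 0 0 0 q33"
    using ex univ_form_clear1 by meson
  then show False using not_univ_form_i assms by blast
qed

lemma not_univ_form_11_even:
  assumes "univ_form N 1 1 (2 ^ c) q11 q12 q13 q22 q23 q33" "2 * c + 4 \<le> N" "even q33" "odd q22"
  shows False
proof -
  have "\<exists>s2. even (q11 + q22 * s2 * s2 + q33 * 0 * 0 + 2 * (q23 * s2 * 0 + q12 * s2 + q13 * 0))"
    using \<open>odd q22\<close> by (cases "even q11") (auto intro: exI[of _ 0] exI[of _ 1])
  then have f: "univ_form N 1 1 (2 ^ c) 0 0 0 q22 q23 q33"
    using univ_form_clear1[OF assms(1)] by meson
  show False
  proof (cases c)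
    case 0
    then show False
      using not_univ_form_11_odd[of N 0 0 0 0 q33 q23 q22] univ_form_swap23[OF f] assms by simp
  next
    case (Suc c')
    note g = univ_form_clear2[OF f \<open>odd q22\<close>]
    show False
    proof (cases "4 dvd q33")
      case True
      then show False using not_univ_form_ii_dvd4[OF g] assms Suc by simp
    next
      case False
      then have "q33 = 2 * (q33 div 2)" "odd (q33 div 2)" using \<open>even q33\<close> by presburger+
      then show False using not_univ_form_ii[of N c' "q33 div 2"] g assms(2) Suc by simp
    qed
  qed
qed

text \<open>An even p1 is excluded modulo 4. The case p1 = p2 = 1 leads to (i) or (ii). For p1 = 1
  and even p2, p3, one of q22 and q33 is odd and forces its own p to be exactly 2, which leads to
  (iii).\<close>

theorem not_univ_form_pow2:
  assumes "univ_form N (2 ^ a) (2 ^ b) (2 ^ c) q11 q12 q13 q22 q23 q33" "a \<le> b" "b \<le> c" "2 * c + 6 \<le> N"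
  shows False
proof (cases "a = 0")
  case False
  then show False using not_univ_form_even_p[OF assms(1)] assms by simp
next
  case True
  then have f: "univ_form N 1 (2 ^ b) (2 ^ c) q11 q12 q13 q22 q23 q33" using assms(1) by simp
  show False
  proof (cases "b = 0")
    case True
    then have f: "univ_form N 1 1 (2 ^ c) q11 q12 q13 q22 q23 q33" using f by simp
    show False
      using univ_form_odd[OF f] not_univ_form_11_odd[OF f] not_univ_form_11_even[OF f]
        not_univ_form_11_even[OF univ_form_swap12[OF f]] assms(4) by auto
  next
    case False
    then have ev: "even (2 ^ b :: int)" "even (2 ^ c :: int)" and N: "2 \<le> N" "3 \<le> N" using assms by simp_all
    have odd: "odd q22 \<or> odd q33" using not_univ_form_even_q[OF f N(1) ev] by blast
    then have "\<exists>s2 s3. even (q11 + q22 * s2 * s2 + q33 * s3 * s3 + 2 * (q23 * s2 * s3 + q12 * s2 + q13 * s3))"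
    proof (cases "even q11")
      case True
      then show ?thesis by (intro exI[of _ 0]) simp
    next
      case q11: False
      show ?thesis
      proof (cases "odd q22")
        case True
        then show ?thesis using q11 by (intro exI[of _ 1] exI[of _ 0]) simp
      next
        case False
        then show ?thesis using q11 odd by (intro exI[of _ 0] exI[of _ 1]) simp
      qed
    qed
    then have g: "univ_form N 1 (2 ^ b) (2 ^ c) 0 0 0 q22 q23 q33"
      using univ_form_clear1[OF f] by meson
    have one: "k = 1" if "\<not> (4::int) dvd 2 ^ k" "0 < k" for k
    proof (rule ccontr)
      assume "k \<noteq> 1"
      then have "2 ^ 2 dvd (2::int) ^ k" using that(2) by (intro le_imp_power_dvd) simp
      then show False using that(1) by simp
    qed
    show False
    proof (cases "odd q22")
      case True
      then have "b = 1" using one univ_form_binary_not_dvd4[OF g N(2) ev] False by blast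
      moreover obtain c' where "c = Suc c'" using False assms(3) by (cases c) auto
      ultimately show False using not_univ_form_binary[of N c' q22 q23 q33] g True assms(4) by simp
    next
      case q22: False
      then have "odd q33" using odd by blast
      note h = univ_form_swap23[OF g]
      have "c = 1" using one univ_form_binary_not_dvd4[OF h N(2) ev(2,1) \<open>odd q33\<close>] False assms(3) by auto
      then have "b = 1" using False assms(3) by simp
      then show False using not_univ_form_binary[of N 0 q33 q23 q22] h \<open>odd q33\<close> \<open>c = 1\<close> assms(4) by simp
    qed
  qed
qed

section \<open>Elementary divisors of an almost isotropic sublattice\<close>

definition bil :: "nat \<Rightarrow> (nat \<Rightarrow> nat \<Rightarrow> int) \<Rightarrow> (nat \<Rightarrow> int) \<Rightarrow> (nat \<Rightarrow> int) \<Rightarrow> int" where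
  "bil n g x y = (\<Sum>i<n. \<Sum>j<n. x i * g i j * y j)"

definition lincomb6 :: "int \<Rightarrow> (nat \<Rightarrow> int) \<Rightarrow> int \<Rightarrow> (nat \<Rightarrow> int) \<Rightarrow> int \<Rightarrow> (nat \<Rightarrow> int) \<Rightarrow>
    int \<Rightarrow> (nat \<Rightarrow> int) \<Rightarrow> int \<Rightarrow> (nat \<Rightarrow> int) \<Rightarrow> int \<Rightarrow> (nat \<Rightarrow> int) \<Rightarrow> nat \<Rightarrow> int" where
  "lincomb6 a1 e1 a2 e2 a3 e3 b1 f1 b2 f2 b3 f3 =
     (\<lambda>i. a1 * e1 i + a2 * e2 i + a3 * e3 i + b1 * f1 i + b2 * f2 i + b3 * f3 i)"

text \<open>Elimination without division: if x and y pair with z to 2^a r and 2^a u, then u x - r y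
  is orthogonal to z. An odd u is a unit modulo 2^N.\<close>

definition lin :: "int \<Rightarrow> (nat \<Rightarrow> int) \<Rightarrow> int \<Rightarrow> (nat \<Rightarrow> int) \<Rightarrow> nat \<Rightarrow> int" where
  "lin u x r y = (\<lambda>i. u * x i - r * y i)"

text \<open>This is generation modulo 2^N; zero vectors may occur among the six, which accommodates
  ranks below 6.\<close>

definition spanning :: "nat \<Rightarrow> nat \<Rightarrow> (nat \<Rightarrow> int) \<Rightarrow> (nat \<Rightarrow> int) \<Rightarrow> (nat \<Rightarrow> int) \<Rightarrow>
    (nat \<Rightarrow> int) \<Rightarrow> (nat \<Rightarrow> int) \<Rightarrow> (nat \<Rightarrow> int) \<Rightarrow> bool" where
  "spanning n N e1 e2 e3 f1 f2 f3 \<longleftrightarrow> (\<forall>x. \<exists>a1 a2 a3 b1 b2 b3. \<forall>i<n.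
     2 ^ N dvd x i - lincomb6 a1 e1 a2 e2 a3 e3 b1 f1 b2 f2 b3 f3 i)"

definition primv :: "nat \<Rightarrow> (nat \<Rightarrow> int) \<Rightarrow> (nat \<Rightarrow> int) \<Rightarrow> (nat \<Rightarrow> int) \<Rightarrow> bool" where
  "primv n e1 e2 e3 \<longleftrightarrow>
     (\<forall>r s t. (\<forall>i<n. even (r * e1 i + s * e2 i + t * e3 i)) \<longrightarrow> even r \<and> even s \<and> even t)"

lemma bil_lin_left: "bil n g (lin u x r y) z = u * bil n g x z - r * bil n g y z"
  by (simp add: bil_def lin_def algebra_simps sum.distrib sum_subtractf sum_distrib_left)

lemma bil_lin_right: "bil n g z (lin u x r y) = u * bil n g z x - r * bil n g z y"
  by (simp add: bil_def lin_def algebra_simps sum.distrib sum_subtractf sum_distrib_left)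

lemma bil_lincomb6_left:
  "bil n g (lincomb6 a1 e1 a2 e2 a3 e3 b1 f1 b2 f2 b3 f3) z = a1 * bil n g e1 z + a2 * bil n g e2 z +
     a3 * bil n g e3 z + b1 * bil n g f1 z + b2 * bil n g f2 z + b3 * bil n g f3 z"
  by (simp add: bil_def lincomb6_def algebra_simps sum.distrib sum_distrib_left)

lemma bil_lincomb6_right:
  "bil n g z (lincomb6 a1 e1 a2 e2 a3 e3 b1 f1 b2 f2 b3 f3) = a1 * bil n g z e1 + a2 * bil n g z e2 +
     a3 * bil n g z e3 + b1 * bil n g z f1 + b2 * bil n g z f2 + b3 * bil n g z f3"
  by (simp add: bil_def lincomb6_def algebra_simps sum.distrib sum_distrib_left)

lemma bil_cong_left:
  assumes "\<And>i. i < n \<Longrightarrow> d dvd x i - x' i"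
  shows "d dvd bil n g x y - bil n g x' y"
proof -
  have "bil n g x y - bil n g x' y = (\<Sum>i<n. \<Sum>j<n. (x i - x' i) * (g i j * y j))"
    by (simp add: bil_def sum_subtractf algebra_simps)
  then show ?thesis using assms by (auto intro!: dvd_sum)
qed

lemma bil_cong_right:
  assumes "\<And>i. i < n \<Longrightarrow> d dvd x i - x' i"
  shows "d dvd bil n g y x - bil n g y x'"
proof -
  have "bil n g y x - bil n g y x' = (\<Sum>i<n. \<Sum>j<n. (x j - x' j) * (g i j * y i))"
    by (simp add: bil_def sum_subtractf algebra_simps)
  then show ?thesis using assms by (auto intro!: dvd_sum)
qed

lemma spanning_lin:
  assumes "spanning n N e1 e2 e3 f1 f2 f3" and odd: "odd u2" "odd u3" "odd v2" "odd v3"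
  shows "spanning n N e1 (lin u2 e2 r2 e1) (lin u3 e3 r3 e1) f1 (lin v2 f2 s2 f1) (lin v3 f3 s3 f1)"
  unfolding spanning_def
proof
  fix x
  obtain a1 a2 a3 b1 b2 b3 where x: "\<And>i. i < n \<Longrightarrow>
    2 ^ N dvd x i - lincomb6 a1 e1 a2 e2 a3 e3 b1 f1 b2 f2 b3 f3 i"
    using assms(1) unfolding spanning_def by metis
  obtain i2 i3 j2 j3 where inv: "2 ^ N dvd u2 * i2 - 1" "2 ^ N dvd u3 * i3 - 1"
    "2 ^ N dvd v2 * j2 - 1" "2 ^ N dvd v3 * j3 - 1"
    using odd by (meson odd_inverse_mod_pow2)
  show "\<exists>c1 c2 c3 d1 d2 d3. \<forall>i<n. 2 ^ N dvd x i - lincomb6 c1 e1 c2 (lin u2 e2 r2 e1)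
      c3 (lin u3 e3 r3 e1) d1 f1 d2 (lin v2 f2 s2 f1) d3 (lin v3 f3 s3 f1) i"
  proof (intro exI allI impI)
    fix i assume "i < n"
    have "x i - lincomb6 (a1 + a2 * i2 * r2 + a3 * i3 * r3) e1 (a2 * i2) (lin u2 e2 r2 e1)
        (a3 * i3) (lin u3 e3 r3 e1) (b1 + b2 * j2 * s2 + b3 * j3 * s3) f1 (b2 * j2) (lin v2 f2 s2 f1)
        (b3 * j3) (lin v3 f3 s3 f1) i =
      (x i - lincomb6 a1 e1 a2 e2 a3 e3 b1 f1 b2 f2 b3 f3 i) - (u2 * i2 - 1) * (a2 * e2 i) -
        (u3 * i3 - 1) * (a3 * e3 i) - (v2 * j2 - 1) * (b2 * f2 i) - (v3 * j3 - 1) * (b3 * f3 i)"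
      by (simp add: lincomb6_def lin_def algebra_simps)
    then show "2 ^ N dvd x i - lincomb6 (a1 + a2 * i2 * r2 + a3 * i3 * r3) e1 (a2 * i2) (lin u2 e2 r2 e1)
        (a3 * i3) (lin u3 e3 r3 e1) (b1 + b2 * j2 * s2 + b3 * j3 * s3) f1 (b2 * j2) (lin v2 f2 s2 f1)
        (b3 * j3) (lin v3 f3 s3 f1) i"
      using x[OF \<open>i < n\<close>] inv by (simp only: dvd_diff dvd_mult2)
  qed
qed

lemma primv_lin:
  assumes "primv n e1 e2 e3" "odd u2" "odd u3"
  shows "primv n e1 (lin u2 e2 r2 e1) (lin u3 e3 r3 e1)"
  unfolding primv_def
proof (intro allI impI)
  fix r s t
  assume *: "\<forall>i<n. even (r * e1 i + s * lin u2 e2 r2 e1 i + t * lin u3 e3 r3 e1 i)"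
  have "r * e1 i + s * lin u2 e2 r2 e1 i + t * lin u3 e3 r3 e1 i =
    (r - s * r2 - t * r3) * e1 i + (s * u2) * e2 i + (t * u3) * e3 i" for i
    by (simp add: lin_def algebra_simps)
  then have "\<forall>i<n. even ((r - s * r2 - t * r3) * e1 i + (s * u2) * e2 i + (t * u3) * e3 i)"
    using * by (simp only:)
  then have "even (r - s * r2 - t * r3) \<and> even (s * u2) \<and> even (t * u3)"
    using assms(1) unfolding primv_def by blast
  then show "even r \<and> even s \<and> even t" using assms(2,3) by auto
qed

lemma ex_odd_part:
  assumes "\<not> 2 ^ k dvd (m::int)"
  obtains c w where "c < k" "odd w" "m = 2 ^ c * w"
  using assms
proof (induction k arbitrary: m thesis)
  case 0
  then show ?case by simp
next
  case (Suc k)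
  show ?case
  proof (cases "even m")
    case True
    then obtain m' where m': "m = 2 * m'" by (elim evenE)
    then have "\<not> 2 ^ k dvd m'" using Suc.prems(2) by simp
    from Suc.IH[OF _ this] obtain c w where "c < k" "odd w" "m' = 2 ^ c * w" by metis
    then show ?thesis using Suc.prems(1)[of "Suc c" w] m' by simp
  next
    case False
    then show ?thesis using Suc.prems(1)[of 0 m] by simp
  qed
qed

section \<open>Diagonalizing the pairing of the isotropic part\<close>

text \<open>An integer model modulo 2^N of a primitively 3-universal lattice.
  \<open>nondegenerate\<close> reflects that 2^K does not divide the determinant; f1, f2, f3 come
  from the basis that extends the primitive images e1, e2, e3.\<close>

locale universal_lattice =
  fixes n N K :: nat and g :: "nat \<Rightarrow> nat \<Rightarrow> int"
  assumes N: "2 * K + 6 \<le> N"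
    and sym: "\<And>i j. i < n \<Longrightarrow> j < n \<Longrightarrow> g i j = g j i"
    and nondegenerate: "\<And>x i. (\<And>y. 2 ^ K dvd bil n g x y) \<Longrightarrow> i < n \<Longrightarrow> even (x i)"
    and universal: "\<And>s11 s12 s22 s33. (s11 * s22 - s12 * s12) * s33 \<noteq> 0 \<Longrightarrow>
      \<exists>e1 e2 e3 f1 f2 f3. spanning n N e1 e2 e3 f1 f2 f3 \<and> primv n e1 e2 e3 \<and>
        2 ^ N dvd bil n g e1 e1 - s11 \<and> 2 ^ N dvd bil n g e1 e2 - s12 \<and> 2 ^ N dvd bil n g e2 e2 - s22 \<and>
        2 ^ N dvd bil n g e3 e1 \<and> 2 ^ N dvd bil n g e3 e2 \<and> 2 ^ N dvd bil n g e3 e3 - s33"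
begin

abbreviation "B \<equiv> bil n g"

lemma B_commute: "B x y = B y x"
proof -
  have "B x y = (\<Sum>j<n. \<Sum>i<n. x i * g i j * y j)" unfolding bil_def by (rule sum.swap)
  also have "\<dots> = B y x" unfolding bil_def by (intro sum.cong refl) (simp add: sym mult_ac)
  finally show ?thesis .
qed

definition frame :: "(nat \<Rightarrow> int) \<Rightarrow> (nat \<Rightarrow> int) \<Rightarrow> (nat \<Rightarrow> int) \<Rightarrow>
    (nat \<Rightarrow> int) \<Rightarrow> (nat \<Rightarrow> int) \<Rightarrow> (nat \<Rightarrow> int) \<Rightarrow> bool" where
  "frame e1 e2 e3 f1 f2 f3 \<longleftrightarrow> spanning n N e1 e2 e3 f1 f2 f3 \<and> primv n e1 e2 e3 \<and>
     2 ^ N dvd B e1 e1 \<and> 2 ^ N dvd B e1 e2 \<and> 2 ^ N dvd B e1 e3 \<and>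
     2 ^ N dvd B e2 e2 \<and> 2 ^ N dvd B e2 e3 \<and> 2 ^ N dvd B e3 e3"

lemma ex_frame: obtains e1 e2 e3 f1 f2 f3 where "frame e1 e2 e3 f1 f2 f3"
proof -
  obtain e1 e2 e3 f1 f2 f3 where e: "spanning n N e1 e2 e3 f1 f2 f3" "primv n e1 e2 e3"
    "2 ^ N dvd B e1 e1 - 2 ^ N" "2 ^ N dvd B e1 e2 - 0" "2 ^ N dvd B e2 e2 - 2 ^ N"
    "2 ^ N dvd B e3 e1" "2 ^ N dvd B e3 e2" "2 ^ N dvd B e3 e3 - 2 ^ N"
    using universal[of "2 ^ N" "2 ^ N" 0 "2 ^ N"] by auto
  then have "frame e1 e2 e3 f1 f2 f3"
    unfolding frame_def B_commute[of e1 e3] B_commute[of e2 e3]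
    by (auto dest: dvd_of_dvd_diff[OF _ dvd_refl dvd_refl])
  then show thesis by (rule that)
qed

lemma spanning_swap:
  assumes "spanning n N e1 e2 e3 f1 f2 f3"
  shows "spanning n N e2 e1 e3 f1 f2 f3" "spanning n N e1 e3 e2 f1 f2 f3"
    "spanning n N e1 e2 e3 f2 f1 f3" "spanning n N e1 e2 e3 f1 f3 f2"
proof -
  have *: "lincomb6 a1 e1 a2 e2 a3 e3 b1 f1 b2 f2 b3 f3 = lincomb6 a2 e2 a1 e1 a3 e3 b1 f1 b2 f2 b3 f3"
    "lincomb6 a1 e1 a2 e2 a3 e3 b1 f1 b2 f2 b3 f3 = lincomb6 a1 e1 a3 e3 a2 e2 b1 f1 b2 f2 b3 f3"
    "lincomb6 a1 e1 a2 e2 a3 e3 b1 f1 b2 f2 b3 f3 = lincomb6 a1 e1 a2 e2 a3 e3 b2 f2 b1 f1 b3 f3"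
    "lincomb6 a1 e1 a2 e2 a3 e3 b1 f1 b2 f2 b3 f3 = lincomb6 a1 e1 a2 e2 a3 e3 b1 f1 b3 f3 b2 f2"
    for a1 a2 a3 b1 b2 b3
    by (auto simp: lincomb6_def)
  show "spanning n N e2 e1 e3 f1 f2 f3" using assms unfolding spanning_def *(1) by meson
  show "spanning n N e1 e3 e2 f1 f2 f3" using assms unfolding spanning_def *(2) by meson
  show "spanning n N e1 e2 e3 f2 f1 f3" using assms unfolding spanning_def *(3) by meson
  show "spanning n N e1 e2 e3 f1 f3 f2" using assms unfolding spanning_def *(4) by meson
qed

lemma primv_swap:
  assumes "primv n e1 e2 e3"
  shows "primv n e2 e1 e3" "primv n e1 e3 e2"
  using assms unfolding primv_def by (simp_all add: add_ac) (smt (verit) add.commute add.left_commute)+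

lemma frame_swap:
  assumes "frame e1 e2 e3 f1 f2 f3"
  shows "frame e2 e1 e3 f1 f2 f3" "frame e1 e3 e2 f1 f2 f3"
    "frame e1 e2 e3 f2 f1 f3" "frame e1 e2 e3 f1 f3 f2"
  using assms spanning_swap[of e1 e2 e3 f1 f2 f3] primv_swap[of e1 e2 e3]
  unfolding frame_def by (simp_all add: B_commute)

lemma frame_lin:
  assumes "frame e1 e2 e3 f1 f2 f3" "odd u2" "odd u3" "odd v2" "odd v3"
  shows "frame e1 (lin u2 e2 r2 e1) (lin u3 e3 r3 e1) f1 (lin v2 f2 s2 f1) (lin v3 f3 s3 f1)"
  using assms spanning_lin primv_lin unfolding frame_def bil_lin_left bil_lin_right
  by (simp add: B_commute dvd_diff)

text \<open>Otherwise e1 pairs to 0 modulo 2^K with the whole lattice and is even, against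
  primitivity. This is what bounds the elementary divisors.\<close>

lemma frame_pairing:
  assumes "frame e1 e2 e3 f1 f2 f3"
  shows "\<not> (2 ^ K dvd B e1 f1 \<and> 2 ^ K dvd B e1 f2 \<and> 2 ^ K dvd B e1 f3)"
proof
  assume f: "2 ^ K dvd B e1 f1 \<and> 2 ^ K dvd B e1 f2 \<and> 2 ^ K dvd B e1 f3"
  have KN: "2 ^ K dvd (2 ^ N :: int)" using N by (intro le_imp_power_dvd) simp
  have e: "2 ^ K dvd B e1 e1" "2 ^ K dvd B e1 e2" "2 ^ K dvd B e1 e3"
    using assms KN dvd_trans unfolding frame_def by blast+
  have "2 ^ K dvd B e1 y" for y
  proof -
    obtain a1 a2 a3 b1 b2 b3 where y: "\<And>i. i < n \<Longrightarrow>
      2 ^ N dvd y i - lincomb6 a1 e1 a2 e2 a3 e3 b1 f1 b2 f2 b3 f3 i"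
      using assms unfolding frame_def spanning_def by metis
    have "2 ^ N dvd B e1 y - B e1 (lincomb6 a1 e1 a2 e2 a3 e3 b1 f1 b2 f2 b3 f3)"
      using y by (rule bil_cong_right)
    moreover have "2 ^ K dvd B e1 (lincomb6 a1 e1 a2 e2 a3 e3 b1 f1 b2 f2 b3 f3)"
      unfolding bil_lincomb6_right using e f by (intro dvd_add dvd_mult) blast+
    ultimately show ?thesis using KN dvd_of_dvd_diff by blast
  qed
  then have "\<forall>i<n. even (1 * e1 i + 0 * e2 i + 0 * e3 i)" using nondegenerate by simp
  then show False using assms unfolding frame_def primv_def by (metis odd_one)
qed

text \<open>The minimum is taken over all frames at once. Since permutations bring any of the nine
  pairings of a frame to the front, 2^a divides all of them.\<close>

lemma ex_least_pairing:
  "\<exists>a. (\<forall>e1 e2 e3 f1 f2 f3. frame e1 e2 e3 f1 f2 f3 \<longrightarrow> 2 ^ a dvd B e1 f1) \<and>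
     (\<exists>e1 e2 e3 f1 f2 f3. frame e1 e2 e3 f1 f2 f3 \<and> \<not> 2 ^ Suc a dvd B e1 f1)"
proof -
  define P where "P a \<longleftrightarrow> (\<exists>e1 e2 e3 f1 f2 f3. frame e1 e2 e3 f1 f2 f3 \<and> \<not> 2 ^ Suc a dvd B e1 f1)" for a
  obtain e1 e2 e3 f1 f2 f3 where f: "frame e1 e2 e3 f1 f2 f3" by (rule ex_frame)
  have "\<exists>e1 e2 e3 f1 f2 f3. frame e1 e2 e3 f1 f2 f3 \<and> \<not> 2 ^ K dvd B e1 f1"
    using frame_pairing[OF f] f frame_swap(3)[OF f] frame_swap(3)[OF frame_swap(4)[OF f]] by blast
  moreover have "2 ^ K dvd (2 ^ Suc K :: int)" by simp
  ultimately have "P K" unfolding P_def by (meson dvd_trans)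
  define a where "a = (LEAST a. P a)"
  have "P a" unfolding a_def using \<open>P K\<close> by (rule LeastI)
  moreover have "2 ^ a dvd B e1 f1" if "frame e1 e2 e3 f1 f2 f3" for e1 e2 e3 f1 f2 f3
  proof (cases a)
    case (Suc b)
    then have "\<not> P b" unfolding a_def by (metis lessI not_less_Least)
    then show ?thesis using that Suc unfolding P_def by metis
  qed simp
  ultimately show ?thesis unfolding P_def by blast
qed

definition split_frame :: "(nat \<Rightarrow> int) \<Rightarrow> (nat \<Rightarrow> int) \<Rightarrow> (nat \<Rightarrow> int) \<Rightarrow>
    (nat \<Rightarrow> int) \<Rightarrow> (nat \<Rightarrow> int) \<Rightarrow> (nat \<Rightarrow> int) \<Rightarrow> nat \<Rightarrow> bool" where
  "split_frame e1 e2 e3 f1 f2 f3 a \<longleftrightarrow> frame e1 e2 e3 f1 f2 f3 \<and> (\<exists>u. odd u \<and> B e1 f1 = 2 ^ a * u) \<and>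
     B e1 f2 = 0 \<and> B e1 f3 = 0 \<and> B e2 f1 = 0 \<and> B e3 f1 = 0"

lemma split_frame_swap:
  assumes "split_frame e1 e2 e3 f1 f2 f3 a"
  shows "split_frame e1 e3 e2 f1 f2 f3 a" "split_frame e1 e2 e3 f1 f3 f2 a"
  using assms frame_swap(2,4)[of e1 e2 e3 f1 f2 f3] unfolding split_frame_def by auto

lemma odd_part_of_dvd:
  assumes "2 ^ a dvd m" "\<not> 2 ^ Suc a dvd (m::int)"
  obtains u where "odd u" "m = 2 ^ a * u"
proof -
  obtain u where u: "m = 2 ^ a * u" using assms(1) ..
  then have "odd u" using assms(2) by auto
  then show thesis using u that by blast
qed

lemma ex_split_frame:
  "\<exists>a. (\<forall>e1 e2 e3 f1 f2 f3. frame e1 e2 e3 f1 f2 f3 \<longrightarrow> 2 ^ a dvd B e1 f1) \<and>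
     (\<exists>e1 e2 e3 f1 f2 f3. split_frame e1 e2 e3 f1 f2 f3 a)"
proof -
  obtain a where dvd: "\<And>e1 e2 e3 f1 f2 f3. frame e1 e2 e3 f1 f2 f3 \<Longrightarrow> 2 ^ a dvd B e1 f1"
    and ex: "\<exists>e1 e2 e3 f1 f2 f3. frame e1 e2 e3 f1 f2 f3 \<and> \<not> 2 ^ Suc a dvd B e1 f1"
    using ex_least_pairing by metis
  obtain e1 e2 e3 f1 f2 f3 where f: "frame e1 e2 e3 f1 f2 f3" "\<not> 2 ^ Suc a dvd B e1 f1"
    using ex by blast
  obtain u where u: "odd u" "B e1 f1 = 2 ^ a * u" using dvd[OF f(1)] f(2) by (rule odd_part_of_dvd)
  have "2 ^ a dvd B e1 f2" "2 ^ a dvd B e1 f3" "2 ^ a dvd B e2 f1" "2 ^ a dvd B e3 f1"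
    using dvd f(1) frame_swap by meson+
  then obtain r2 r3 s2 s3 where r: "B e1 f2 = 2 ^ a * s2" "B e1 f3 = 2 ^ a * s3"
    "B e2 f1 = 2 ^ a * r2" "B e3 f1 = 2 ^ a * r3" by (elim dvdE)
  have "split_frame e1 (lin u e2 r2 e1) (lin u e3 r3 e1) f1 (lin u f2 s2 f1) (lin u f3 s3 f1) a"
    unfolding split_frame_def bil_lin_left bil_lin_right r u(2)
    using frame_lin[OF f(1) u(1) u(1) u(1) u(1)] u(1) by auto
  then show ?thesis using dvd by blast
qed

lemma ex_diagonal_frame:
  obtains e1 e2 e3 f1 f2 f3 a b c u v w where "frame e1 e2 e3 f1 f2 f3"
    "a \<le> b" "b \<le> c" "c < K" "odd u" "odd v" "odd w"
    "B e1 f1 = 2 ^ a * u" "B e2 f2 = 2 ^ b * v" "B e3 f3 = 2 ^ c * w"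
    "B e1 f2 = 0" "B e1 f3 = 0" "B e2 f1 = 0" "B e2 f3 = 0" "B e3 f1 = 0" "B e3 f2 = 0"
proof -
  obtain a where dvd_a: "\<And>e1 e2 e3 f1 f2 f3. frame e1 e2 e3 f1 f2 f3 \<Longrightarrow> 2 ^ a dvd B e1 f1"
    and ex_a: "\<exists>e1 e2 e3 f1 f2 f3. split_frame e1 e2 e3 f1 f2 f3 a"
    using ex_split_frame by metis
  \<comment> \<open>For the second pivot the minimum runs only over frames whose first row and
    column are already cleared.\<close>
  define P where "P b \<longleftrightarrow>
    (\<exists>e1 e2 e3 f1 f2 f3. split_frame e1 e2 e3 f1 f2 f3 a \<and> \<not> 2 ^ Suc b dvd B e2 f2)" for b
  obtain e1 e2 e3 f1 f2 f3 where f: "split_frame e1 e2 e3 f1 f2 f3 a" using ex_a by blast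
  then have "frame e1 e2 e3 f1 f2 f3" and z: "B e2 f1 = 0" unfolding split_frame_def by blast+
  from frame_pairing[OF frame_swap(1)[OF this(1)]] z
  have "\<exists>e1 e2 e3 f1 f2 f3. split_frame e1 e2 e3 f1 f2 f3 a \<and> \<not> 2 ^ K dvd B e2 f2"
    using f split_frame_swap(2)[OF f] by (metis dvd_0_right)
  moreover have "2 ^ K dvd (2 ^ Suc K :: int)" by simp
  ultimately have "P K" unfolding P_def by (meson dvd_trans)
  define b where "b = (LEAST b. P b)"
  have "P b" unfolding b_def using \<open>P K\<close> by (rule LeastI)
  have dvd_b: "2 ^ b dvd B e2 f2" if "split_frame e1 e2 e3 f1 f2 f3 a" for e1 e2 e3 f1 f2 f3
  proof (cases b)
    case (Suc b')
    then have "\<not> P b'" unfolding b_def by (metis lessI not_less_Least)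
    then show ?thesis using that Suc unfolding P_def by metis
  qed simp
  obtain e1 e2 e3 f1 f2 f3 where f: "split_frame e1 e2 e3 f1 f2 f3 a" "\<not> 2 ^ Suc b dvd B e2 f2"
    using \<open>P b\<close> unfolding P_def by blast
  obtain v where v: "odd v" "B e2 f2 = 2 ^ b * v" using dvd_b[OF f(1)] f(2) by (rule odd_part_of_dvd)
  obtain u where u: "odd u" "B e1 f1 = 2 ^ a * u" using f(1) unfolding split_frame_def by blast
  have fr: "frame e1 e2 e3 f1 f2 f3" and z: "B e1 f2 = 0" "B e1 f3 = 0" "B e2 f1 = 0" "B e3 f1 = 0"
    using f(1) unfolding split_frame_def by blast+
  have "2 ^ a dvd B e2 f2" using dvd_a frame_swap(1)[OF frame_swap(3)[OF fr]] by blast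
  then have "a \<le> b" using f(2) by (metis dvd_trans le_imp_power_dvd not_less_eq_eq)
  obtain r s where r: "B e3 f2 = 2 ^ b * r" "B e2 f3 = 2 ^ b * s"
    using dvd_b[OF split_frame_swap(1)[OF f(1)]] dvd_b[OF split_frame_swap(2)[OF f(1)]] by (elim dvdE)
  let ?e = "lin v e3 r e2" and ?f = "lin v f3 s f2"
  \<comment> \<open>\<open>frame_lin\<close> eliminates with the first index, so e2 and f2 go to the
    front; the coefficients 1 and 0 leave e1 and f1 alone.\<close>
  have "frame e2 (lin 1 e1 0 e2) ?e f2 (lin 1 f1 0 f2) ?f"
    using frame_lin[OF frame_swap(1)[OF frame_swap(3)[OF fr]], of 1 v 1 v 0 r 0 s] v(1) by simp
  then have "frame e2 e1 ?e f2 f1 ?f" by (simp add: lin_def)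
  then have fr': "frame e1 e2 ?e f1 f2 ?f" using frame_swap(1,3) by blast
  have z': "B e1 ?f = 0" "B e2 ?f = 0" "B ?e f1 = 0" "B ?e f2 = 0"
    unfolding bil_lin_left bil_lin_right using r v z by simp_all
  have "frame ?e e1 e2 f1 f2 ?f" using fr' frame_swap(1,2) by blast
  from frame_pairing[OF this] have "\<not> 2 ^ K dvd B ?e ?f" using z' by simp
  then obtain c w where w: "c < K" "odd w" "B ?e ?f = 2 ^ c * w" by (rule ex_odd_part)
  have sf: "split_frame e1 e2 ?e f1 f2 ?f a"
    unfolding split_frame_def using fr' u z z' by blast
  have "2 ^ b dvd B ?e ?f" using dvd_b[OF split_frame_swap(1)[OF split_frame_swap(2)[OF sf]]] .
  then have "2 ^ b dvd (2 ^ c * w)" using w(3) by simp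
  moreover have "coprime (2 ^ b) w" using w(2) by simp
  ultimately have "2 ^ b dvd (2 ^ c :: int)" using coprime_dvd_mult_left_iff by blast
  then have "b \<le> c" using power_dvd_imp_le[of "2::nat" b c] by (simp flip: of_nat_dvd_iff[where 'a = int])
  show thesis
    by (rule that[OF fr' \<open>a \<le> b\<close> \<open>b \<le> c\<close> w(1) u(1) v(1) w(2) u(2) v(2) w(3) z(1) z'(1) z(3) z'(2) z'(3,4)])
qed

lemma ex_univ_form:
  obtains a b c q11 q12 q13 q22 q23 q33
  where "univ_form N (2 ^ a) (2 ^ b) (2 ^ c) q11 q12 q13 q22 q23 q33" "a \<le> b" "b \<le> c" "c < K"
proof -
  obtain e1 e2 e3 f1 f2 f3 a b c u v w where fr: "frame e1 e2 e3 f1 f2 f3"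
    and abc: "a \<le> b" "b \<le> c" "c < K" and odd: "odd u" "odd v" "odd w"
    and B: "B e1 f1 = 2 ^ a * u" "B e2 f2 = 2 ^ b * v" "B e3 f3 = 2 ^ c * w"
    "B e1 f2 = 0" "B e1 f3 = 0" "B e2 f1 = 0" "B e2 f3 = 0" "B e3 f1 = 0" "B e3 f2 = 0"
    by (rule ex_diagonal_frame) blast
  let ?F = "bf (2 ^ a) (2 ^ b) (2 ^ c) (B f1 f1) (B f1 f2) (B f1 f3) (B f2 f2) (B f2 f3) (B f3 f3)"
  define vec where "vec t = (case t of (x1, x2, x3, y1, y2, y3) \<Rightarrow> lincomb6 x1 e1 x2 e2 x3 e3 y1 f1 y2 f2 y3 f3)"
    for t :: "int \<times> int \<times> int \<times> int \<times> int \<times> int"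
  \<comment> \<open>The odd factors u, v, w are absorbed into the x coordinates, where
    multiplication by a unit leaves parity unchanged.\<close>
  define scl where "scl t = (case t of (x1, x2, x3, y1, y2, y3) \<Rightarrow> (u * x1, v * x2, w * x3, y1, y2, y3))"
    for t :: "int \<times> int \<times> int \<times> int \<times> int \<times> int"
  have form: "2 ^ N dvd B (vec s) (vec t) - ?F (scl s) (scl t)" for s t
  proof -
    obtain x1 x2 x3 y1 y2 y3 where s: "s = (x1, x2, x3, y1, y2, y3)" by (cases s) auto
    obtain x1' x2' x3' y1' y2' y3' where t: "t = (x1', x2', x3', y1', y2', y3')" by (cases t) auto
    note Bc = B_commute[of f1 e1] B_commute[of f1 e2] B_commute[of f1 e3] B_commute[of f2 e1]
      B_commute[of f2 e2] B_commute[of f2 e3] B_commute[of f3 e1] B_commute[of f3 e2] B_commute[of f3 e3]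
      B_commute[of f2 f1] B_commute[of f3 f1] B_commute[of f3 f2]
      B_commute[of e2 e1] B_commute[of e3 e1] B_commute[of e3 e2]
    \<comment> \<open>Only the pairings among e1, e2, e3 remain, and these are divisible by
      2^N.\<close>
    have "B (vec s) (vec t) - ?F (scl s) (scl t) = x1 * x1' * B e1 e1 + (x1 * x2' + x2 * x1') * B e1 e2 +
      (x1 * x3' + x3 * x1') * B e1 e3 + x2 * x2' * B e2 e2 + (x2 * x3' + x3 * x2') * B e2 e3 + x3 * x3' * B e3 e3"
      unfolding s t vec_def scl_def prod.case bil_lincomb6_left bil_lincomb6_right Bc B bf.simps
      by (simp add: algebra_simps)
    moreover have "2 ^ N dvd \<dots>" using fr unfolding frame_def by (intro dvd_add dvd_mult) blast+
    ultimately show ?thesis by simp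
  qed
  have coords: "\<exists>t. \<forall>i<n. 2 ^ N dvd x i - vec t i" for x
    using fr unfolding frame_def spanning_def vec_def by (simp add: split_paired_Ex)
  have "univ_form N (2 ^ a) (2 ^ b) (2 ^ c) (B f1 f1) (B f1 f2) (B f1 f3) (B f2 f2) (B f2 f3) (B f3 f3)"
    unfolding univ_form_def Let_def
  proof (intro allI impI)
    fix s11 s12 s22 s33 :: int
    assume "(s11 * s22 - s12 * s12) * s33 \<noteq> 0"
    then obtain d1 d2 d3 where d: "primv n d1 d2 d3" "2 ^ N dvd B d1 d1 - s11" "2 ^ N dvd B d1 d2 - s12"
      "2 ^ N dvd B d2 d2 - s22" "2 ^ N dvd B d3 d1" "2 ^ N dvd B d3 d2" "2 ^ N dvd B d3 d3 - s33"
      using universal by blast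
    obtain t1 t2 t3 where t: "\<And>i. i < n \<Longrightarrow> 2 ^ N dvd d1 i - vec t1 i"
      "\<And>i. i < n \<Longrightarrow> 2 ^ N dvd d2 i - vec t2 i" "\<And>i. i < n \<Longrightarrow> 2 ^ N dvd d3 i - vec t3 i"
      using coords by metis
    have *: "2 ^ N dvd ?F (scl s) (scl t) - k"
      if "2 ^ N dvd B x y - k" "\<And>i. i < n \<Longrightarrow> 2 ^ N dvd x i - vec s i"
        "\<And>i. i < n \<Longrightarrow> 2 ^ N dvd y i - vec t i" for x y s t k
    proof -
      have 1: "2 ^ N dvd B x y - B (vec s) y" using that(2) by (rule bil_cong_left)
      have 2: "2 ^ N dvd B (vec s) y - B (vec s) (vec t)" using that(3) by (rule bil_cong_right)
      have "?F (scl s) (scl t) - k = (B x y - k) - (B x y - B (vec s) y) -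
        (B (vec s) y - B (vec s) (vec t)) - (B (vec s) (vec t) - ?F (scl s) (scl t))" by simp
      then show ?thesis using that(1) 1 2 form[of s t] by (simp only: dvd_diff)
    qed
    have "prim3 (scl t1) (scl t2) (scl t3)"
      unfolding prim3_def
    proof (intro allI impI)
      fix r s t
      assume e: "even6 (comb6 (comb6 (comb6 (0, 0, 0, 0, 0, 0) r (scl t1)) s (scl t2)) t (scl t3))"
      obtain x1 x2 x3 y1 y2 y3 where x: "t1 = (x1, x2, x3, y1, y2, y3)" by (cases t1) auto
      obtain x1' x2' x3' y1' y2' y3' where x': "t2 = (x1', x2', x3', y1', y2', y3')" by (cases t2) auto
      obtain x1'' x2'' x3'' y1'' y2'' y3'' where x'': "t3 = (x1'', x2'', x3'', y1'', y2'', y3'')"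
        by (cases t3) auto
      have ev: "even (r * x1 + s * x1' + t * x1'')" "even (r * x2 + s * x2' + t * x2'')"
        "even (r * x3 + s * x3' + t * x3'')" "even (r * y1 + s * y1' + t * y1'')"
        "even (r * y2 + s * y2' + t * y2'')" "even (r * y3 + s * y3' + t * y3'')"
        using e odd unfolding x x' x'' scl_def by auto
      have "even (r * d1 i + s * d2 i + t * d3 i)" if "i < n" for i
      proof -
        have "2 dvd (2 ^ N :: int)" using N by simp
        then have "2 dvd d1 i - vec t1 i" "2 dvd d2 i - vec t2 i" "2 dvd d3 i - vec t3 i"
          using t that dvd_trans by blast+
        then have "2 dvd r * (d1 i - vec t1 i) + s * (d2 i - vec t2 i) + t * (d3 i - vec t3 i)"
          by (intro dvd_add dvd_mult)
        moreover have "r * d1 i + s * d2 i + t * d3 i =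
          (r * (d1 i - vec t1 i) + s * (d2 i - vec t2 i) + t * (d3 i - vec t3 i)) +
          ((r * x1 + s * x1' + t * x1'') * e1 i + (r * x2 + s * x2' + t * x2'') * e2 i +
           (r * x3 + s * x3' + t * x3'') * e3 i + (r * y1 + s * y1' + t * y1'') * f1 i +
           (r * y2 + s * y2' + t * y2'') * f2 i + (r * y3 + s * y3' + t * y3'') * f3 i)"
          unfolding x x' x'' vec_def by (simp add: lincomb6_def algebra_simps)
        moreover have "2 dvd ((r * x1 + s * x1' + t * x1'') * e1 i + (r * x2 + s * x2' + t * x2'') * e2 i +
           (r * x3 + s * x3' + t * x3'') * e3 i + (r * y1 + s * y1' + t * y1'') * f1 i +
           (r * y2 + s * y2' + t * y2'') * f2 i + (r * y3 + s * y3' + t * y3'') * f3 i)"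
          using ev by (simp only: dvd_add dvd_mult2)
        ultimately show ?thesis by (simp only: dvd_add)
      qed
      then show "even r \<and> even s \<and> even t" using d(1) unfolding primv_def by blast
    qed
    moreover have "2 ^ N dvd B d3 d1 - 0" "2 ^ N dvd B d3 d2 - 0" using d(5,6) by simp_all
    note *[OF this(1) t(3,1)] *[OF this(2) t(3,2)]
    ultimately show "\<exists>a' b' u. prim3 a' b' u \<and> 2 ^ N dvd ?F a' a' - s11 \<and> 2 ^ N dvd ?F a' b' - s12 \<and>
        2 ^ N dvd ?F b' b' - s22 \<and> 2 ^ N dvd ?F u a' \<and> 2 ^ N dvd ?F u b' \<and> 2 ^ N dvd ?F u u - s33"
      using *[OF d(2) t(1,1)] *[OF d(3) t(1,2)] *[OF d(4) t(2,2)] *[OF d(7) t(3,3)]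
      by (metis diff_zero)
  qed
  then show thesis using that abc by blast
qed

lemma contradiction: False
  using ex_univ_form not_univ_form_pow2 N by (metis add_le_mono1 less_imp_le_nat mult_le_mono2 le_trans)

end

section \<open>Lattices over the 2-adic integers\<close>

definition zcong :: "nat \<Rightarrow> z2 \<Rightarrow> z2 \<Rightarrow> bool" where
  "zcong N x y \<longleftrightarrow> 2 ^ N dvd x - y"

lemma zcong_refl: "zcong N x x"
  by (simp add: zcong_def)

lemma zcong_sym: "zcong N x y \<Longrightarrow> zcong N y x"
  unfolding zcong_def by (metis dvd_minus_iff minus_diff_eq)

lemma zcong_mult: "zcong N x x' \<Longrightarrow> zcong N y y' \<Longrightarrow> zcong N (x * y) (x' * y')"
proof -
  assume "zcong N x x'" "zcong N y y'"
  then have "2 ^ N dvd (x - x') * y + x' * (y - y')" unfolding zcong_def by (intro dvd_add dvd_mult dvd_mult2)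
  then show ?thesis unfolding zcong_def by (simp add: algebra_simps)
qed

lemma zcong_sum: "(\<And>i. i \<in> I \<Longrightarrow> zcong N (f i) (h i)) \<Longrightarrow> zcong N (sum f I) (sum h I)"
  unfolding zcong_def sum_subtractf[symmetric] by (rule dvd_sum)

lemma zcong_Rep: "zcong N (of_int (Rep_z2 x N)) x"
  by (rule zcong_sym) (simp add: zcong_def z2_dvd_diff_Rep)

lemma zcong_dvd: "zcong N x y \<Longrightarrow> k \<le> N \<Longrightarrow> 2 ^ k dvd x \<longleftrightarrow> 2 ^ k dvd y"
  unfolding zcong_def by (metis dvd_add_right_iff diff_add_cancel dvd_trans le_imp_power_dvd)

lemma dvd_of_int_zcong: "zcong N (of_int a) (of_int b) \<longleftrightarrow> 2 ^ N dvd a - b"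
  unfolding zcong_def using z2_dvd_of_int_iff[of N "a - b"] by simp

lemma det_block3:
  fixes f :: "nat \<Rightarrow> nat \<Rightarrow> 'a :: comm_ring_1"
  assumes "f 2 0 = 0" "f 2 1 = 0"
  shows "det (mat 3 3 (\<lambda>(i, j). f i j)) = (f 0 0 * f 1 1 - f 0 1 * f 1 0) * f 2 2"
proof -
  let ?A = "mat 3 3 (\<lambda>(i, j). f i j)" and ?D = "mat 2 2 (\<lambda>(i, j). f i j)"
  have D: "mat_delete ?A 2 2 = ?D" by (rule eq_matI) (auto simp: mat_delete_def)
  have "mat_delete ?D 0 0 = mat 1 1 (\<lambda>_. f 1 1)" "mat_delete ?D 0 1 = mat 1 1 (\<lambda>_. f 1 0)"
    by (rule eq_matI; auto simp: mat_delete_def)+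
  then have "cofactor ?D 0 0 = f 1 1" "cofactor ?D 0 1 = - f 1 0"
    by (simp_all add: cofactor_def det_single)
  then have "det ?D = f 0 0 * f 1 1 - f 0 1 * f 1 0"
    by (subst laplace_expansion_row[of _ 2 0]) (simp_all add: numeral_2_eq_2)
  then have "cofactor ?A 2 2 = f 0 0 * f 1 1 - f 0 1 * f 1 0" by (simp add: cofactor_def D)
  then show ?thesis
    using assms by (subst laplace_expansion_row[of _ 3 2]) (simp_all add: numeral_3_eq_3 numeral_2_eq_2 mult.commute)
qed

section \<open>Passage from Z_2 to integers modulo 2^N\<close>

lemma universal_lattice_of_prim_universal:
  assumes G: "z2_lattice n G" and univ: "prim_universal 3 G" and n: "3 \<le> n" "n \<le> 6"
    and K: "\<not> 2 ^ K dvd det G" and N: "2 * K + 6 \<le> N"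
  shows "universal_lattice n N K (\<lambda>i j. Rep_z2 (G $$ (i, j)) N)"
proof
  have Gc: "G \<in> carrier_mat n n" and Gt: "G\<^sup>T = G" using G unfolding z2_lattice_def by auto
  let ?g = "\<lambda>i j. Rep_z2 (G $$ (i, j)) N"
  have bil: "zcong N (of_int (bil n ?g x y)) (\<Sum>i<n. \<Sum>j<n. X i * G $$ (i, j) * Y j)"
    if "\<And>i. i < n \<Longrightarrow> zcong N (of_int (x i)) (X i)" "\<And>i. i < n \<Longrightarrow> zcong N (of_int (y i)) (Y i)"
    for x y X Y
    unfolding bil_def of_int_sum of_int_mult
    using that by (intro zcong_sum zcong_mult zcong_Rep) auto
  show "2 * K + 6 \<le> N" by (rule N)
  show "Rep_z2 (G $$ (i, j)) N = Rep_z2 (G $$ (j, i)) N" if "i < n" "j < n" for i j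
    using that Gc Gt by (metis carrier_matD index_transpose_mat(1))
  show "even (x i)" if x: "\<And>y. 2 ^ K dvd bil n ?g x y" and "i < n" for x i
  proof (rule ccontr)
    assume "odd (x i)"
    then obtain r where r: "2 ^ K dvd x i * r - 1" by (rule odd_inverse_mod_pow2)
    have col: "2 ^ K dvd (\<Sum>l<n. of_int (x l) * G $$ (l, k))" if "k < n" for k
    proof -
      let ?d = "\<lambda>j. if j = k then 1 else 0 :: int"
      have KN: "K \<le> N" using N by simp
      have "2 ^ K dvd (of_int (bil n ?g x ?d) :: z2)"
        using x[of ?d] by (simp only: z2_dvd_of_int_iff)
      moreover have "zcong N (of_int (bil n ?g x ?d))
          (\<Sum>i<n. \<Sum>j<n. of_int (x i) * G $$ (i, j) * of_int (?d j))"
        by (rule bil) (rule zcong_refl)+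
      ultimately have "2 ^ K dvd (\<Sum>i<n. \<Sum>j<n. of_int (x i) * G $$ (i, j) * of_int (?d j))"
        using zcong_dvd[OF _ KN] by blast
      then show ?thesis
        using that by (simp add: if_distrib[of of_int] if_distrib[of "\<lambda>c. _ * c"] cong: if_cong)
    qed
    \<comment> \<open>Multiplying the row x G by the adjugate gives det G times x. As x_i is odd,
      2^K would divide det G.\<close>
    define A where "A = adj_mat G"
    have A: "A \<in> carrier_mat n n" "G * A = det G \<cdot>\<^sub>m 1\<^sub>m n"
      using adj_mat[OF Gc] unfolding A_def by auto
    have "(\<Sum>k<n. (\<Sum>l<n. of_int (x l) * G $$ (l, k)) * A $$ (k, i)) =
        (\<Sum>l<n. of_int (x l) * (\<Sum>k<n. G $$ (l, k) * A $$ (k, i)))"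
      unfolding sum_distrib_left sum_distrib_right by (subst sum.swap) (simp add: mult.assoc)
    also have "\<dots> = (\<Sum>l<n. of_int (x l) * (G * A) $$ (l, i))"
      using Gc A(1) \<open>i < n\<close> by (intro sum.cong refl) (simp add: scalar_prod_def lessThan_atLeast0)
    also have "\<dots> = of_int (x i) * det G"
      unfolding A(2) using \<open>i < n\<close> by (simp add: if_distrib[of "\<lambda>c. _ * c"] cong: if_cong)
    finally have "2 ^ K dvd of_int (x i) * det G"
      using col by (metis (no_types, lifting) dvd_mult2 dvd_sum lessThan_iff)
    then have "2 ^ K dvd of_int r * (of_int (x i) * det G)" by (rule dvd_mult)
    moreover have "2 ^ K dvd (of_int (x i * r - 1) :: z2)" using r by (simp only: z2_dvd_of_int_iff)
    then have "2 ^ K dvd of_int (x i * r - 1) * det G" by (rule dvd_mult2)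
    ultimately have "2 ^ K dvd of_int r * (of_int (x i) * det G) - of_int (x i * r - 1) * det G"
      by (rule dvd_diff)
    then show False using K by (simp add: algebra_simps)
  qed
  fix s11 s12 s22 s33 :: int
  assume s: "(s11 * s22 - s12 * s12) * s33 \<noteq> 0"
  show "\<exists>e1 e2 e3 f1 f2 f3. spanning n N e1 e2 e3 f1 f2 f3 \<and> primv n e1 e2 e3 \<and>
      2 ^ N dvd bil n ?g e1 e1 - s11 \<and> 2 ^ N dvd bil n ?g e1 e2 - s12 \<and> 2 ^ N dvd bil n ?g e2 e2 - s22 \<and>
      2 ^ N dvd bil n ?g e3 e1 \<and> 2 ^ N dvd bil n ?g e3 e2 \<and> 2 ^ N dvd bil n ?g e3 e3 - s33"
  proof -
    define S where "S i j = (if i = 0 \<and> j = 0 then s11 else if i = 1 \<and> j = 1 then s22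
      else if i = 2 \<and> j = 2 then s33 else if i < 2 \<and> j < 2 then s12 else 0)" for i j :: nat
    define A where "A = mat 3 3 (\<lambda>(i, j). of_int (S i j) :: z2)"
    have "det A = of_int ((s11 * s22 - s12 * s12) * s33)"
      unfolding A_def by (subst det_block3) (simp_all add: S_def)
    then have "z2_lattice 3 A"
      using of_int_z2_nonzero[OF s] unfolding z2_lattice_def
      by (auto simp: A_def S_def intro!: eq_matI)
    then have "prim_represents G A" using univ unfolding prim_universal_def by blast
    then obtain X U where X: "X \<in> carrier_mat n 3" "X\<^sup>T * G * X = A"
      and U: "U \<in> carrier_mat n n" "invertible_mat U" "\<And>i j. i < n \<Longrightarrow> j < 3 \<Longrightarrow> U $$ (i, j) = X $$ (i, j)"
      using Gc unfolding prim_represents_def by (auto simp: A_def)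
    obtain V where V: "U * V = 1\<^sub>m n" "V * U = 1\<^sub>m (dim_row V)"
      using U(1,2) unfolding invertible_mat_def inverts_mat_def by auto
    have Vc: "V \<in> carrier_mat n n"
      using arg_cong[OF V(1), of dim_col] arg_cong[OF V(2), of dim_col] U(1) by auto
    have UV: "(\<Sum>j<n. U $$ (i, j) * V $$ (j, k)) = (if i = k then 1 else 0)"
      and VU: "(\<Sum>j<n. V $$ (i, j) * U $$ (j, k)) = (if i = k then 1 else 0)"
      if "i < n" "k < n" for i k
      using arg_cong[OF V(1), of "\<lambda>M. M $$ (i, k)"] arg_cong[OF V(2), of "\<lambda>M. M $$ (i, k)"] that U(1) Vc
      by (simp_all add: scalar_prod_def lessThan_atLeast0)
    \<comment> \<open>The columns of U modulo 2^N, padded with zero vectors up to six.\<close>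
    define b where "b j i = (if j < n then Rep_z2 (U $$ (i, j)) N else 0)" for i j
    have b: "zcong N (of_int (b j i)) (U $$ (i, j))" if "j < n" for i j
      using that zcong_Rep by (simp add: b_def)
    have six: "(\<Sum>j<6. c j * b j i) = lincomb6 (c 0) (b 0) (c 1) (b 1) (c 2) (b 2) (c 3) (b 3) (c 4) (b 4) (c 5) (b 5) i"
      for c i by (simp add: lincomb6_def eval_nat_numeral)
    have "spanning n N (b 0) (b 1) (b 2) (b 3) (b 4) (b 5)"
      unfolding spanning_def
    proof
      fix x
      \<comment> \<open>Coordinates of x in the basis of columns of U, obtained from the inverse
        V.\<close>
      define c where "c j = Rep_z2 (\<Sum>k<n. V $$ (j, k) * of_int (x k)) N" for j
      have "2 ^ N dvd x i - (\<Sum>j<6. c j * b j i)" if "i < n" for i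
      proof -
        have "(\<Sum>j<6. c j * b j i) = (\<Sum>j<n. c j * b j i)"
          by (rule sum.mono_neutral_right) (use n in \<open>auto simp: b_def\<close>)
        moreover have "zcong N (of_int (\<Sum>j<n. c j * b j i)) (\<Sum>j<n. (\<Sum>k<n. V $$ (j, k) * of_int (x k)) * U $$ (i, j))"
          unfolding of_int_sum of_int_mult c_def
          by (intro zcong_sum zcong_mult zcong_Rep b) simp
        moreover have "(\<Sum>j<n. (\<Sum>k<n. V $$ (j, k) * of_int (x k)) * U $$ (i, j)) =
          (\<Sum>k<n. (\<Sum>j<n. U $$ (i, j) * V $$ (j, k)) * of_int (x k))"
          unfolding sum_distrib_right by (subst sum.swap) (simp add: mult_ac)
        moreover have "\<dots> = of_int (x i)"
          using that UV by (simp add: if_distrib[of "\<lambda>c. c * _"] cong: if_cong)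
        ultimately have "zcong N (of_int (\<Sum>j<6. c j * b j i)) (of_int (x i))" by simp
        then show ?thesis using dvd_of_int_zcong zcong_sym by blast
      qed
      then show "\<exists>a1 a2 a3 b1 b2 b3. \<forall>i<n. 2 ^ N dvd x i -
          lincomb6 a1 (b 0) a2 (b 1) a3 (b 2) b1 (b 3) b2 (b 4) b3 (b 5) i"
        unfolding six by blast
    qed
    moreover have "primv n (b 0) (b 1) (b 2)"
      unfolding primv_def
    proof (intro allI impI)
      fix r s t
      assume ev: "\<forall>i<n. even (r * b 0 i + s * b 1 i + t * b 2 i)"
      define a where "a k = (if k = 0 then r else if k = 1 then s else if k = 2 then t else 0)" for k :: nat
      have three: "(\<Sum>k<n. h k * of_int (a k)) = h 0 * of_int r + h 1 * of_int s + h 2 * of_int t"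
        for h :: "nat \<Rightarrow> z2"
      proof -
        have "(\<Sum>k<n. h k * of_int (a k)) = (\<Sum>k<3. h k * of_int (a k))"
          by (rule sum.mono_neutral_right) (use n in \<open>auto simp: a_def\<close>)
        then show ?thesis by (simp add: a_def eval_nat_numeral)
      qed
      have col: "2 ^ 1 dvd (\<Sum>k<n. U $$ (i, k) * of_int (a k))" if "i < n" for i
      proof -
        have "2 ^ 1 dvd (of_int (r * b 0 i + s * b 1 i + t * b 2 i) :: z2)"
          using ev that by (simp only: z2_dvd_of_int_iff) simp
        moreover have "zcong N (of_int (r * b 0 i + s * b 1 i + t * b 2 i))
            (U $$ (i, 0) * of_int r + U $$ (i, 1) * of_int s + U $$ (i, 2) * of_int t)"
        proof -
          have "zcong N (\<Sum>k<3. of_int (a k) * of_int (b k i)) (\<Sum>k<3. of_int (a k) * U $$ (i, k))"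
            using n by (intro zcong_sum zcong_mult zcong_refl b) simp
          then show ?thesis by (simp add: a_def eval_nat_numeral mult_ac add_ac)
        qed
        ultimately show ?thesis
          unfolding three using zcong_dvd[of N _ _ 1] N by auto
      qed
      have "even (a j)" if "j < 3" for j
      proof -
        have "(\<Sum>i<n. V $$ (j, i) * (\<Sum>k<n. U $$ (i, k) * of_int (a k))) =
          (\<Sum>k<n. (\<Sum>i<n. V $$ (j, i) * U $$ (i, k)) * of_int (a k))"
          unfolding sum_distrib_left sum_distrib_right by (subst sum.swap) (simp add: mult_ac)
        also have "\<dots> = of_int (a j)"
          using that n VU by (simp add: if_distrib[of "\<lambda>c. c * _"] cong: if_cong)
        finally have "2 ^ 1 dvd (of_int (a j) :: z2)"
          using col by (metis (no_types, lifting) dvd_mult dvd_sum lessThan_iff)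
        then show ?thesis unfolding z2_dvd_of_int_iff by simp
      qed
      from this[of 0] this[of 1] this[of 2] show "even r \<and> even s \<and> even t" by (simp add: a_def)
    qed
    moreover have bX: "zcong N (of_int (b p i)) (X $$ (i, p))" if "p < 3" "i < n" for p i
      using b[of p i] U(3)[of i p] that n by simp
    have gram: "2 ^ N dvd bil n ?g (b p) (b q) - S p q" if "p < 3" "q < 3" for p q
    proof -
      have "zcong N (of_int (bil n ?g (b p) (b q))) (\<Sum>i<n. \<Sum>j<n. X $$ (i, p) * G $$ (i, j) * X $$ (j, q))"
        using bX that by (intro bil)
      moreover have "(\<Sum>i<n. \<Sum>j<n. X $$ (i, p) * G $$ (i, j) * X $$ (j, q)) = (X\<^sup>T * G * X) $$ (p, q)"
        using X(1) Gc that by (simp add: scalar_prod_def lessThan_atLeast0 sum_distrib_left mult.assoc)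
      moreover have "\<dots> = of_int (S p q)" unfolding X(2) A_def using that by simp
      ultimately show ?thesis using dvd_of_int_zcong by simp
    qed
    ultimately show ?thesis
      using gram[of 0 0] gram[of 0 1] gram[of 1 1] gram[of 2 0] gram[of 2 1] gram[of 2 2]
      by (intro exI conjI) (assumption | simp add: S_def)+
  qed
qed

lemma not_prim_universal_of_rank_3_to_6:
  assumes "z2_lattice n G" "3 \<le> n" "n \<le> 6"
  shows "\<not> prim_universal 3 G"
proof
  assume univ: "prim_universal 3 G"
  have "det G \<noteq> 0" using assms(1) unfolding z2_lattice_def by blast
  then obtain K where K: "\<not> 2 ^ K dvd det G" by (rule z2_nonzero_not_dvd)
  show False
    using universal_lattice.contradiction[OF universal_lattice_of_prim_universal[OF assms(1) univ assms(2,3) K order_refl]] .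
qed

section \<open>Ranks below 3\<close>

text \<open>The unit matrix of size 3 cannot factor through rank n < 3: after padding to square
  matrices one factor has a zero row, so its determinant is 0.\<close>

lemma not_prim_universal_of_rank_less_3:
  assumes "z2_lattice n G" "n < 3"
  shows "\<not> prim_universal 3 G"
proof
  assume "prim_universal 3 G"
  moreover have "z2_lattice 3 (1\<^sub>m 3)" unfolding z2_lattice_def by simp
  ultimately have "prim_represents G (1\<^sub>m 3)" unfolding prim_universal_def by blast
  moreover have Gc: "G \<in> carrier_mat n n" using assms(1) unfolding z2_lattice_def by blast
  ultimately obtain X where X: "X \<in> carrier_mat n 3" "X\<^sup>T * G * X = 1\<^sub>m 3"
    unfolding prim_represents_def by auto
  define Y where "Y = X\<^sup>T * G"
  have Y: "Y \<in> carrier_mat 3 n" unfolding Y_def using X(1) Gc by simp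
  define X' where "X' = mat 3 3 (\<lambda>(i, j). if i < n then X $$ (i, j) else 0)"
  define Y' where "Y' = mat 3 3 (\<lambda>(i, j). if j < n then Y $$ (i, j) else 0)"
  have "Y' * X' = Y * X"
  proof (rule eq_matI)
    fix i j assume "i < dim_row (Y * X)" "j < dim_col (Y * X)"
    then have ij: "i < 3" "j < 3" using X Y by auto
    have "(Y' * X') $$ (i, j) = (\<Sum>k<3. (if k < n then Y $$ (i, k) * X $$ (k, j) else 0))"
      using ij by (auto simp: X'_def Y'_def scalar_prod_def lessThan_atLeast0 intro!: sum.cong)
    also have "\<dots> = (\<Sum>k<n. Y $$ (i, k) * X $$ (k, j))"
      by (rule sum.mono_neutral_cong_right) (use assms(2) in auto)
    also have "\<dots> = (Y * X) $$ (i, j)" using ij X Y by (simp add: scalar_prod_def lessThan_atLeast0)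
    finally show "(Y' * X') $$ (i, j) = (Y * X) $$ (i, j)" .
  qed (use X Y in \<open>auto simp: X'_def Y'_def\<close>)
  then have "det Y' * det X' = 1"
    using det_mult[of Y' 3 X'] X(2) unfolding Y_def by (simp add: X'_def Y'_def)
  moreover have "det X' = (\<Sum>j<3. X' $$ (2, j) * cofactor X' 2 j)"
    by (rule laplace_expansion_row) (simp_all add: X'_def)
  then have "det X' = 0" using assms(2) by (simp add: X'_def)
  ultimately show False by simp
qed

section \<open>The universal lattice H + H + H + <1>\<close>

lemma sum_lessThan_7:
  fixes f :: "nat \<Rightarrow> 'a :: comm_monoid_add"
  shows "(\<Sum>i<7. f i) = f 0 + f 1 + f 2 + f 3 + f 4 + f 5 + f 6"
  by (simp add: eval_nat_numeral)

definition hyperbolic7 :: "z2 mat" where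
  "hyperbolic7 = mat 7 7 (\<lambda>(i, j). if i = 6 \<and> j = 6 \<or> i < 3 \<and> j = i + 3 \<or> j < 3 \<and> i = j + 3 then 1 else 0)"

lemma less_7_cases: "i < 7 \<Longrightarrow> i = 0 \<or> i = 1 \<or> i = 2 \<or> i = 3 \<or> i = 4 \<or> i = 5 \<or> i = (6::nat)"
  by auto

text \<open>The Gram matrix is an involution, so its determinant squares to 1.\<close>

lemma hyperbolic7_lattice: "z2_lattice 7 hyperbolic7"
proof -
  have c: "hyperbolic7 \<in> carrier_mat 7 7" by (simp add: hyperbolic7_def)
  have "hyperbolic7 * hyperbolic7 = 1\<^sub>m 7"
  proof (rule eq_matI)
    fix i j assume "i < dim_row (1\<^sub>m 7)" "j < dim_col (1\<^sub>m 7)"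
    then have ij: "i < 7" "j < 7" by simp_all
    then have "(hyperbolic7 * hyperbolic7) $$ (i, j) = (\<Sum>k<7. hyperbolic7 $$ (i, k) * hyperbolic7 $$ (k, j))"
      using c by (simp add: scalar_prod_def lessThan_atLeast0)
    also have "\<dots> = 1\<^sub>m 7 $$ (i, j)"
      using less_7_cases[OF ij(1)] less_7_cases[OF ij(2)]
      unfolding sum_lessThan_7 by (elim disjE; simp add: hyperbolic7_def)
    finally show "(hyperbolic7 * hyperbolic7) $$ (i, j) = 1\<^sub>m 7 $$ (i, j)" .
  qed (use c in auto)
  then have "det hyperbolic7 * det hyperbolic7 = 1" using det_mult[OF c c] by simp
  then have "det hyperbolic7 \<noteq> 0" by auto
  moreover have "hyperbolic7\<^sup>T = hyperbolic7" by (rule eq_matI) (auto simp: hyperbolic7_def)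
  ultimately show ?thesis using c unfolding z2_lattice_def by blast
qed

text \<open>The row c of X is chosen so that A - c c^t has even diagonal; then T can be upper triangular.\<close>

lemma hyperbolic7_universal: "prim_universal 3 hyperbolic7"
  unfolding prim_universal_def
proof (intro allI impI)
  fix A assume A: "z2_lattice 3 A"
  then have Ac: "A \<in> carrier_mat 3 3" and At: "A\<^sup>T = A" unfolding z2_lattice_def by auto
  have sym: "A $$ (j, i) = A $$ (i, j)" if "i < 3" "j < 3" for i j
    using that Ac At by (metis carrier_matD index_transpose_mat(1))
  have "\<exists>c t. x = 2 * t + c * c" for x :: z2
  proof -
    \<comment> \<open>The residue of x modulo 2 is 0 or 1, hence its own square, and serves as
      c.\<close>
    have "2 ^ 1 dvd x - of_int (Rep_z2 x 1)" by (rule z2_dvd_diff_Rep)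
    then obtain t where t: "x = 2 * t + of_int (Rep_z2 x 1)" by (metis dvdE diff_add_cancel power_one_right)
    have "Rep_z2 x 1 = 0 \<or> Rep_z2 x 1 = 1" using Rep_z2_range[of x 1] by auto
    then have "of_int (Rep_z2 x 1) * of_int (Rep_z2 x 1) = (of_int (Rep_z2 x 1) :: z2)" by auto
    then show ?thesis using t by metis
  qed
  then have "\<forall>i. \<exists>c t. A $$ (i, i) = 2 * t + c * c" by blast
  then obtain c t where ct: "\<And>i. A $$ (i, i) = 2 * t i + c i * c i" by metis
  define T where "T i j = (if i = j then t i else if i < j then A $$ (i, j) - c i * c j else 0)" for i j :: nat
  \<comment> \<open>The blocks of rows are the identity, T and c; the Gram matrix of the columns is
    T + T^t + c c^t.\<close>
  define X where "X = mat 7 3 (\<lambda>(i, j). if i < 3 then if i = j then 1 else 0 else if i < 6 then T (i - 3) j else c j)"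
  have Xc: "X \<in> carrier_mat 7 3" by (simp add: X_def)
  have Hc: "hyperbolic7 \<in> carrier_mat 7 7" by (simp add: hyperbolic7_def)
  have gram: "X\<^sup>T * hyperbolic7 * X = A"
  proof (rule eq_matI)
    fix p q assume "p < dim_row A" "q < dim_col A"
    then have pq: "p < 3" "q < 3" using Ac by auto
    have "(X\<^sup>T * hyperbolic7 * X) $$ (p, q) =
        (\<Sum>i<7. X $$ (i, p) * (\<Sum>j<7. hyperbolic7 $$ (i, j) * X $$ (j, q)))"
      using pq Xc Hc by (simp add: scalar_prod_def lessThan_atLeast0)
    also have "\<dots> = T p q + T q p + c p * c q"
    proof -
      have "p = 0 \<or> p = 1 \<or> p = 2" "q = 0 \<or> q = 1 \<or> q = 2" using pq by auto
      then show ?thesis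
        unfolding sum_lessThan_7 by (elim disjE; simp add: hyperbolic7_def X_def)
    qed
    also have "\<dots> = A $$ (p, q)"
      using ct[of p] sym[OF pq] unfolding T_def by (cases p q rule: linorder_cases) (auto simp: mult.commute)
    finally show "(X\<^sup>T * hyperbolic7 * X) $$ (p, q) = A $$ (p, q)" .
  qed (use Ac Xc in auto)
  \<comment> \<open>The top block of X is the identity, so unit columns complete X to a lower
    triangular matrix with 1 on the diagonal.\<close>
  define U where "U = mat 7 7 (\<lambda>(i, j). if j < 3 then X $$ (i, j) else if i = j then 1 else 0)"
  have Uc: "U \<in> carrier_mat 7 7" by (simp add: U_def)
  have "det U = prod_list (diag_mat U)"
  proof (rule det_lower_triangular[OF _ Uc])
    fix i j :: nat assume "i < j" "j < 7"
    then show "U $$ (i, j) = 0" by (auto simp: U_def X_def)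
  qed
  also have "diag_mat U = map (\<lambda>i. 1) [0..<7]"
    unfolding diag_mat_def using Uc by (auto simp: U_def X_def)
  finally have "det U = 1" by (simp add: upt_rec)
  then have "U * adj_mat U = 1\<^sub>m 7" "adj_mat U * U = 1\<^sub>m 7" "adj_mat U \<in> carrier_mat 7 7"
    using adj_mat[OF Uc] by (auto simp: smult_one[symmetric] intro!: eq_matI)
  then have inv: "invertible_mat U"
    unfolding invertible_mat_def inverts_mat_def square_mat.simps using Uc by auto
  have "\<forall>i<7. \<forall>j<3. U $$ (i, j) = X $$ (i, j)" by (simp add: U_def)
  then show "prim_represents hyperbolic7 A"
    unfolding prim_represents_def using gram inv Xc Uc Ac Hc by auto
qed

theorem theorem6p1:
  shows "(\<forall>G. z2_lattice 6 G \<longrightarrow> \<not> prim_universal 3 G) \<and> u_star_z2 3 = 7"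
proof
  show "\<forall>G. z2_lattice 6 G \<longrightarrow> \<not> prim_universal 3 G"
    using not_prim_universal_of_rank_3_to_6 by simp
  show "u_star_z2 3 = 7"
    unfolding u_star_z2_def
  proof (rule Least_equality)
    show "\<exists>G. z2_lattice 7 G \<and> prim_universal 3 G"
      using hyperbolic7_lattice hyperbolic7_universal by blast
    show "7 \<le> r" if "\<exists>G. z2_lattice r G \<and> prim_universal 3 G" for r
    proof (rule ccontr)
      assume "\<not> 7 \<le> r"
      then consider "r < 3" | "3 \<le> r" "r \<le> 6" by linarith
      then show False
        using that not_prim_universal_of_rank_3_to_6 not_prim_universal_of_rank_less_3 by cases blast+
    qed
  qed
qed

end
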